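(* Let $F$ be a clause-set with all clauses of length $1$ or $2$, and $L$ a linear order on the literals of $F$. The procedure which, for each unit-clause $\{x\}\in F$ in order $L$, runs $\mathrm{enum}(F,\{x\},L)$ and then removes $\{x\}$ from $F$, enumerates the paths $P\in\bigcup_{\{x\}\in F}\mathfrak U_x(\mathrm{idg}(F))$ in $L$-pathlex order, as delivered to the calls OUTPUT$(P)$, using time $O(n(F)\,\ell(F))$ for finding the first such path and each subsequent one, while finally determining that there are no further paths takes time $O(u(F)\,\ell(F))$; space usage is $O(\ell(F))$. For the resulting enumeration of the minimally unsatisfiable subsets of $F$ containing at least one unit-clause, in $L$-pathlex order, given that $m\in\mathbb N_0$ of them have been printed so far, finding the next one (or determining there is none) takes time $O((m+1)\,n(F)\,\ell(F))$.
   Context: Literals are variables and complements; clauses are finite sets of literals without complementary pair; clause-sets are finite sets of clauses; minimally unsatisfiable = unsatisfiable but removing any clause makes it satisfiable. $n(F)$ = number of variables, $u(F)$ = number of unit-clauses, $\ell(F)=\sum_{C\in F}|C|$. The implication digraph $G=\mathrm{idg}(F)$ has vertex set all literals whose variable occurs in $F$; binary clause $\{a,b\}$ yields arcs $(\overline a,b),(\overline b,a)$; unit-clause $\{a\}$ yields arc $(\overline a,a)$, arcs of form $(a,\overline a)$ are units. $\mathcal{CL}(A)=\{\{\overline a,b\}:(a,b)\in A\}$. Paths have distinct vertices; regular = no complementary pair among vertices; nearly regular = exactly one complementary pair and regular after removing the last vertex; $\mathfrak U_z(G)$ = nearly regular paths starting at $z$; $F(P)=\mathcal{CL}(E(P))\cup\{\{z\}\}$.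 Regular decomposition $P=P_0;P_1$ of nearly regular $P$ with last vertex $w$: split at the vertex $\overline w$. Contraposition $\overline Q$: replace arcs $(a,b)$ by $(\overline b,\overline a)$ in reversed order. $L$-pathlex order: paths compared lexicographically as words of literals ordered by $L$; for a minimally unsatisfiable subset $F'$ with a unit-clause, $x(F')$ is the $L$-smallest $z$ with $\{z\}\in F'$, $P(F')$ the lexicographically smaller path $P\in\mathfrak U_{x(F')}(G)$ with $F(P)=F'$, and $F'<_LF''$ iff $P(F')<_LP(F'')$. Procedure $\mathrm{enum}(F,\{x\},L)$: if $\overline x$ is reachable from $x$ in $G$, call DFS with empty path and vertex $x$. DFS$(P,y)$: append $y$ to $P$; if $V(P)$ contains a complementary pair call OUTPUT$(P)$; otherwise compute (by one BFS) the set $R$ of out-neighbours $z$ of $y$ in $G-V(P)$ from which $\overline x$ is reachable in $G-V(P)$, and for each $z\in R$ in order $L$ call DFS$(P,z)$. OUTPUT$(P)$: if the last arc of $P$ is a unit, print $F(P)$; otherwise with $P=P_0;P_1$ and $P'=P_0;\overline{P_1}$, print $F(P)$ only if $P<_LP'$.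
   Formalization: The paths from x are taken in idg of F after the unit-clauses {y} with y before x in L were removed; with the initial F the claim fails, e.g. F={{v},{¬v}} with v before ¬v: path (¬v,v) is never delivered. A bound O(f) is read as c·max(1,f). *)

theory Defs
  imports "Graph_Theory.Pair_Digraph" "Graph_Theory.Vertex_Walk"
begin

section \<open>Clause-sets\<close>

datatype 'v lit = Pos 'v | Neg 'v

fun compl :: "'v lit \<Rightarrow> 'v lit" where
  "compl (Pos v) = Neg v"
| "compl (Neg v) = Pos v"

fun var :: "'v lit \<Rightarrow> 'v" where
  "var (Pos v) = v"
| "var (Neg v) = v"

type_synonym 'v clause = "'v lit set"

definition clause :: "'v clause \<Rightarrow> bool" where
  "clause C \<longleftrightarrow> finite C \<and> (\<forall>a\<in>C. compl a \<notin> C)"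

definition clause_set :: "'v clause set \<Rightarrow> bool" where
  "clause_set F \<longleftrightarrow> finite F \<and> (\<forall>C\<in>F. clause C)"

definition vars :: "'v clause set \<Rightarrow> 'v set" where
  "vars F = var ` \<Union>F"

text \<open>Both literals of every occurring variable, whether or not they occur themselves.\<close>
definition lits :: "'v clause set \<Rightarrow> 'v lit set" where
  "lits F = {a. var a \<in> vars F}"

definition num_vars :: "'v clause set \<Rightarrow> nat" where
  "num_vars F = card (vars F)"

definition num_units :: "'v clause set \<Rightarrow> nat" where
  "num_units F = card {C\<in>F. card C = 1}"

definition num_occs :: "'v clause set \<Rightarrow> nat" where
  "num_occs F = (\<Sum>C\<in>F. card C)"

fun lit_true :: "('v \<Rightarrow> bool) \<Rightarrow> 'v lit \<Rightarrow> bool" where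
  "lit_true \<phi> (Pos v) \<longleftrightarrow> \<phi> v"
| "lit_true \<phi> (Neg v) \<longleftrightarrow> \<not> \<phi> v"

definition satisfiable :: "'v clause set \<Rightarrow> bool" where
  "satisfiable F \<longleftrightarrow> (\<exists>\<phi>. \<forall>C\<in>F. \<exists>a\<in>C. lit_true \<phi> a)"

definition min_unsat :: "'v clause set \<Rightarrow> bool" where
  "min_unsat F \<longleftrightarrow> \<not> satisfiable F \<and> (\<forall>C\<in>F. satisfiable (F - {C}))"


section \<open>The implication digraph and nearly regular paths\<close>

text \<open>The case \<open>a = b\<close> covers the unit-clauses.\<close>
definition idg :: "'v clause set \<Rightarrow> 'v lit pair_pre_digraph" where
  "idg F = \<lparr> pverts = lits F, parcs = {(compl a, b) | a b. {a, b} \<in> F} \<rparr>"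

definition CL :: "('v lit \<times> 'v lit) set \<Rightarrow> 'v clause set" where
  "CL A = (\<lambda>(a, b). {compl a, b}) ` A"

definition compl_pairs :: "'v lit list \<Rightarrow> 'v lit set set" where
  "compl_pairs P = {{a, compl a} | a. a \<in> set P \<and> compl a \<in> set P}"

definition regular :: "'v lit list \<Rightarrow> bool" where
  "regular P \<longleftrightarrow> compl_pairs P = {}"

definition nearly_regular :: "'v lit list \<Rightarrow> bool" where
  "nearly_regular P \<longleftrightarrow> card (compl_pairs P) = 1 \<and> regular (butlast P)"

text \<open>The set $\mathfrak{U}_z(G)$, with paths given by their words of vertices.\<close>
definition NR :: "'v lit \<Rightarrow> 'v lit pair_pre_digraph \<Rightarrow> 'v lit list set" where
  "NR z G = {P. vpath P (with_proj G) \<and> hd P = z \<and> nearly_regular P}"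

definition F_of :: "'v lit list \<Rightarrow> 'v clause set" where
  "F_of P = CL (set (vwalk_arcs P)) \<union> {{hd P}}"


section \<open>The orders\<close>

text \<open>Linear orders are reflexive relations, as in \<open>linear_order_on\<close>; the two derived orders
  below are the strict ones.\<close>

definition pathlex :: "'v lit rel \<Rightarrow> 'v lit list \<Rightarrow> 'v lit list \<Rightarrow> bool" where
  "pathlex L P Q \<longleftrightarrow> (P, Q) \<in> lexord (L - Id)"

definition min_unit :: "'v lit rel \<Rightarrow> 'v clause set \<Rightarrow> 'v lit" where
  "min_unit L F' = (THE z. {z} \<in> F' \<and> (\<forall>y. {y} \<in> F' \<longrightarrow> (z, y) \<in> L))"

definition path_of :: "'v lit rel \<Rightarrow> 'v clause set \<Rightarrow> 'v clause set \<Rightarrow> 'v lit list" where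
  "path_of L F F' =
     (THE P. P \<in> NR (min_unit L F') (idg F) \<and> F_of P = F' \<and>
        (\<forall>Q \<in> NR (min_unit L F') (idg F). F_of Q = F' \<and> Q \<noteq> P \<longrightarrow> pathlex L P Q))"

definition mu_less :: "'v lit rel \<Rightarrow> 'v clause set \<Rightarrow> 'v clause set \<Rightarrow> 'v clause set \<Rightarrow> bool" where
  "mu_less L F F' F'' \<longleftrightarrow> pathlex L (path_of L F F') (path_of L F F'')"

text \<open>The clause-set at the moment when the procedure treats the unit-clause \<open>{x}\<close>.\<close>
definition remaining :: "'v lit rel \<Rightarrow> 'v clause set \<Rightarrow> 'v lit \<Rightarrow> 'v clause set" where
  "remaining L F x = F - {{y} | y. (y, x) \<in> L \<and> y \<noteq> x}"


section \<open>Machine model\<close>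

text \<open>
  A sequential machine with unit costs.  It has finitely many registers holding a literal, finitely
  many list variables holding a (singly linked) list of literals, and finitely many tables with one
  such list for every literal; literals serve as addresses.  Every elementary command or
  test, built from a bounded number of operations \<open>hd\<close>, \<open>tl\<close>, consing one literal, testing for emptiness, complementing and comparing
  literals and accessing a table cell, costs one step.  Lists are immutable, so that copying a list
  only copies a pointer.  There is no primitive for the order \<open>L\<close>.
\<close>

datatype reg = rX | rY | rV | rW
datatype lvar = Units | Bins | Ord | Todo | Path | Cur | Nxt | It | Tmp | Fwd
datatype table = Out | In | IsUnit | OnPath | Seen | Rem

datatype lexp = Reg reg | Co lexp | Top sexp
  and sexp = Lst lvar | Tab table lexp | Empty | Push lexp sexp | Pop sexp

datatype bexp = IsEmpty sexp | EqL lexp lexp | NotB bexp | AndB bexp bexp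

datatype com =
    SetR reg lexp               (\<open>(_ :=\<^sub>R/ _)\<close> [62, 62] 62)
  | SetS lvar sexp              (\<open>(_ :=\<^sub>S/ _)\<close> [62, 62] 62)
  | SetT table lexp sexp        (\<open>(_\<lbrakk>_\<rbrakk> :=\<^sub>T/ _)\<close> [62, 0, 62] 62)
  | Seq com com                 (infixr \<open>;;\<close> 60)
  | Cond bexp com com           (\<open>(IF _/ THEN _/ ELSE _)\<close> [0, 0, 61] 61)
  | While bexp com              (\<open>(WHILE _/ DO _)\<close> [0, 61] 61)
  | Skip
  | Deliver lvar
  | Print lvar

record 'v store =
  regs :: "reg \<Rightarrow> 'v lit"
  lvars :: "lvar \<Rightarrow> 'v lit list"
  tables :: "table \<Rightarrow> 'v lit \<Rightarrow> 'v lit list"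

fun lval :: "lexp \<Rightarrow> 'v store \<Rightarrow> 'v lit" and sval :: "sexp \<Rightarrow> 'v store \<Rightarrow> 'v lit list" where
  "lval (Reg r) s = regs s r"
| "lval (Co a) s = compl (lval a s)"
| "lval (Top k) s = hd (sval k s)"
| "sval (Lst i) s = lvars s i"
| "sval (Tab t a) s = tables s t (lval a s)"
| "sval Empty s = []"
| "sval (Push a k) s = lval a s # sval k s"
| "sval (Pop k) s = tl (sval k s)"

fun bval :: "bexp \<Rightarrow> 'v store \<Rightarrow> bool" where
  "bval (IsEmpty k) s \<longleftrightarrow> sval k s = []"
| "bval (EqL a b) s \<longleftrightarrow> lval a s = lval b s"
| "bval (NotB b) s \<longleftrightarrow> \<not> bval b s"
| "bval (AndB b c) s \<longleftrightarrow> bval b s \<and> bval c s"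

text \<open>
  A run is recorded as a list of events: a step together with the store it leads to, the call
  OUTPUT(\<open>P\<close>), and the completed printing of a clause-set.
\<close>

datatype 'v event = Step "'v store" | Delivered "'v lit list" | Printed "'v clause set"

text \<open>
  Paths are held in list variables with the last vertex first.  Printing \<open>F(P)\<close> costs one step per
  clause, and \<open>F(P)\<close> has as many clauses as \<open>P\<close> has vertices.
\<close>

inductive exec :: "com \<Rightarrow> 'v store \<Rightarrow> 'v event list \<Rightarrow> 'v store \<Rightarrow> bool" where
  SetR: "s' = s\<lparr>regs := (regs s)(r := lval a s)\<rparr> \<Longrightarrow> exec (r :=\<^sub>R a) s [Step s'] s'"
| SetS: "s' = s\<lparr>lvars := (lvars s)(i := sval k s)\<rparr> \<Longrightarrow> exec (i :=\<^sub>S k) s [Step s'] s'"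
| SetT: "s' = s\<lparr>tables := (tables s)(t := (tables s t)(lval a s := sval k s))\<rparr> \<Longrightarrow>
    exec (t\<lbrakk>a\<rbrakk> :=\<^sub>T k) s [Step s'] s'"
| Seq: "exec c1 s tr1 s1 \<Longrightarrow> exec c2 s1 tr2 s2 \<Longrightarrow> exec (c1 ;; c2) s (tr1 @ tr2) s2"
| IfTrue: "bval b s \<Longrightarrow> exec c1 s tr s' \<Longrightarrow> exec (IF b THEN c1 ELSE c2) s (Step s # tr) s'"
| IfFalse: "\<not> bval b s \<Longrightarrow> exec c2 s tr s' \<Longrightarrow> exec (IF b THEN c1 ELSE c2) s (Step s # tr) s'"
| WhileFalse: "\<not> bval b s \<Longrightarrow> exec (WHILE b DO c) s [Step s] s"
| WhileTrue: "bval b s \<Longrightarrow> exec c s tr1 s1 \<Longrightarrow> exec (WHILE b DO c) s1 tr2 s2 \<Longrightarrow>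
    exec (WHILE b DO c) s (Step s # tr1 @ tr2) s2"
| Skip: "exec Skip s [Step s] s"
| Deliver: "exec (Deliver i) s [Step s, Delivered (rev (lvars s i))] s"
| Print: "exec (Print i) s
    (replicate (length (lvars s i)) (Step s) @ [Printed (F_of (rev (lvars s i)))]) s"

inductive_cases SetRE: "exec (r :=\<^sub>R a) s tr t"
inductive_cases SetSE: "exec (i :=\<^sub>S k) s tr t"
inductive_cases SetTE: "exec (tb\<lbrakk>a\<rbrakk> :=\<^sub>T k) s tr t"
inductive_cases SeqE: "exec (c1 ;; c2) s tr t"
inductive_cases CondE: "exec (IF b THEN c1 ELSE c2) s tr t"
inductive_cases WhileE: "exec (WHILE b DO c) s tr t"
inductive_cases SkipE: "exec Skip s tr t"
inductive_cases DeliverE: "exec (Deliver i) s tr t"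
inductive_cases PrintE: "exec (Print i) s tr t"

lemma exec_deterministic:
  "exec c s tr t \<Longrightarrow> exec c s tr' t' \<Longrightarrow> tr' = tr \<and> t' = t"
proof (induction arbitrary: tr' t' rule: exec.induct)
  case (SetR s' s r a)
  from SetR.prems show ?case by (rule SetRE) (simp add: SetR.hyps)
next
  case (SetS s' s i k)
  from SetS.prems show ?case by (rule SetSE) (simp add: SetS.hyps)
next
  case (SetT s' s t a k)
  from SetT.prems show ?case by (rule SetTE) (simp add: SetT.hyps)
next
  case (Seq c1 s tr1 s1 c2 tr2 s2)
  from Seq.prems show ?case
  proof (rule SeqE)
    fix tr1' s1' tr2'
    assume *: "tr' = tr1' @ tr2'" "exec c1 s tr1' s1'" "exec c2 s1' tr2' t'"
    from Seq.IH(1)[OF *(2)] *(3) have "exec c2 s1 tr2' t'" by simp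
    from Seq.IH(2)[OF this] Seq.IH(1)[OF *(2)] *(1) show ?thesis by simp
  qed
next
  case (IfTrue b s c1 tr s' c2)
  from IfTrue.prems show ?case
    by (rule CondE) (use IfTrue.hyps in \<open>auto dest: IfTrue.IH\<close>)
next
  case (IfFalse b s c2 tr s' c1)
  from IfFalse.prems show ?case
    by (rule CondE) (use IfFalse.hyps in \<open>auto dest: IfFalse.IH\<close>)
next
  case (WhileFalse b s c)
  from WhileFalse.prems show ?case by (rule WhileE) (use WhileFalse.hyps in auto)
next
  case (WhileTrue b s c tr1 s1 tr2 s2)
  from WhileTrue.prems show ?case
  proof (rule WhileE)
    fix tr1' s1' tr2'
    assume *: "tr' = Step s # tr1' @ tr2'" "exec c s tr1' s1'" "exec (WHILE b DO c) s1' tr2' t'"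
    from WhileTrue.IH(1)[OF *(2)] *(3) have "exec (WHILE b DO c) s1 tr2' t'" by simp
    from WhileTrue.IH(2)[OF this] WhileTrue.IH(1)[OF *(2)] *(1) show ?thesis by simp
  qed (use WhileTrue.hyps in auto)
next
  case (Skip s)
  then show ?case by (rule SkipE) simp
next
  case (Deliver i s)
  then show ?case by (rule DeliverE) simp
next
  case (Print i s)
  then show ?case by (rule PrintE) simp
qed

fun delivered :: "'v event list \<Rightarrow> 'v lit list list" where
  "delivered [] = []"
| "delivered (Delivered P # tr) = P # delivered tr"
| "delivered (_ # tr) = delivered tr"

fun printed :: "'v event list \<Rightarrow> 'v clause set list" where
  "printed [] = []"
| "printed (Printed F # tr) = F # printed tr"
| "printed (_ # tr) = printed tr"

definition is_delivered :: "'v event \<Rightarrow> bool" where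
  "is_delivered e \<longleftrightarrow> (\<exists>P. e = Delivered P)"

definition is_printed :: "'v event \<Rightarrow> bool" where
  "is_printed e \<longleftrightarrow> (\<exists>F. e = Printed F)"

text \<open>
  The number of steps before the first event satisfying \<open>p\<close>, between any two successive such
  events, and (as last entry) after the last one up to the end of the run.
\<close>
fun delays :: "('v event \<Rightarrow> bool) \<Rightarrow> 'v event list \<Rightarrow> nat list" where
  "delays p [] = [0]"
| "delays p (e # tr) =
    (if p e then 0 # delays p tr
     else case e of Step _ \<Rightarrow> Suc (hd (delays p tr)) # tl (delays p tr) | _ \<Rightarrow> delays p tr)"

text \<open>
  Space counts all list variables and, for all tables, the cells and the lists they refer
  to, including the input.  A list shared by several variables is counted each time.
  (Only finitely many cells are ever nonempty, so that the inner sum is a proper one.)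
\<close>
definition space :: "'v clause set \<Rightarrow> 'v store \<Rightarrow> nat" where
  "space F s =
     (\<Sum>i\<in>UNIV. 1 + length (lvars s i)) + card (UNIV :: reg set) +
     (\<Sum>t\<in>UNIV. \<Sum>a \<in> lits F \<union> {a. tables s t a \<noteq> []}. 1 + length (tables s t a))"

instance reg :: finite
proof
  have "a \<in> {rX, rY, rV, rW}" for a :: reg by (cases a) simp_all
  then have "(UNIV :: reg set) \<subseteq> {rX, rY, rV, rW}" by blast
  then show "finite (UNIV :: reg set)" by (rule finite_subset) simp
qed

instance lvar :: finite
proof
  have "a \<in> {Units, Bins, Ord, Todo, Path, Cur, Nxt, It, Tmp, Fwd}" for a :: lvar
    by (cases a) simp_all
  then have "(UNIV :: lvar set) \<subseteq> {Units, Bins, Ord, Todo, Path, Cur, Nxt, It, Tmp, Fwd}" by blast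
  then show "finite (UNIV :: lvar set)" by (rule finite_subset) simp
qed

instance table :: finite
proof
  have "a \<in> {Out, In, IsUnit, OnPath, Seen, Rem}" for a :: table by (cases a) simp_all
  then have "(UNIV :: table set) \<subseteq> {Out, In, IsUnit, OnPath, Seen, Rem}" by blast
  then show "finite (UNIV :: table set)" by (rule finite_subset) simp
qed

text \<open>
  The input \<open>(F, L)\<close> consists of the unit-clauses, the binary clauses (flattened, two entries
  per clause), and the literals in the order \<open>L\<close>.  All tables are empty at the start.
\<close>

definition presents ::
  "'v lit list \<Rightarrow> ('v lit \<times> 'v lit) list \<Rightarrow> 'v lit list \<Rightarrow> 'v clause set \<Rightarrow> 'v lit rel \<Rightarrow> bool" where
  "presents us bs ls F L \<longleftrightarrow>
     distinct us \<and> set us = {a. {a} \<in> F} \<and>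
     distinct (map (\<lambda>(a, b). {a, b}) bs) \<and> (\<lambda>(a, b). {a, b}) ` set bs = {C\<in>F. card C = 2} \<and>
     set ls = lits F \<and> sorted_wrt (\<lambda>a b. (a, b) \<in> L \<and> a \<noteq> b) ls"

definition input :: "'v lit list \<Rightarrow> ('v lit \<times> 'v lit) list \<Rightarrow> 'v lit list \<Rightarrow> 'v store" where
  "input us bs ls =
     \<lparr> regs = (\<lambda>_. undefined),
       lvars = (\<lambda>_. [])(Units := us, Bins := concat (map (\<lambda>(a, b). [a, b]) bs), Ord := ls),
       tables = (\<lambda>_ _. []) \<rparr>"


section \<open>The procedure\<close>

text \<open>Traverses the list variable \<open>i\<close>, thereby emptying it.\<close>
definition for_each :: "reg \<Rightarrow> lvar \<Rightarrow> com \<Rightarrow> com" where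
  "for_each r i c = WHILE NotB (IsEmpty (Lst i)) DO (r :=\<^sub>R Top (Lst i) ;; i :=\<^sub>S Pop (Lst i) ;; c)"

text \<open>
  Adjacency lists of the implication digraph: \<open>In\<close> in arbitrary order, and \<open>Out\<close> in the order \<open>L\<close>,
  obtained by treating the heads of the arcs in descending order.
\<close>
definition build_idg :: com where
  "build_idg =
     It :=\<^sub>S Lst Units ;;
     for_each rV It (IsUnit\<lbrakk>Reg rV\<rbrakk> :=\<^sub>T Push (Reg rV) Empty ;;
       In\<lbrakk>Reg rV\<rbrakk> :=\<^sub>T Push (Co (Reg rV)) (Tab In (Reg rV))) ;;
     It :=\<^sub>S Lst Bins ;;
     for_each rV It (rW :=\<^sub>R Top (Lst It) ;; It :=\<^sub>S Pop (Lst It) ;;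
       In\<lbrakk>Reg rV\<rbrakk> :=\<^sub>T Push (Co (Reg rW)) (Tab In (Reg rV)) ;;
       In\<lbrakk>Reg rW\<rbrakk> :=\<^sub>T Push (Co (Reg rV)) (Tab In (Reg rW))) ;;
     It :=\<^sub>S Lst Ord ;; Tmp :=\<^sub>S Empty ;;
     for_each rV It (Tmp :=\<^sub>S Push (Reg rV) (Lst Tmp)) ;;
     for_each rV Tmp (It :=\<^sub>S Tab In (Reg rV) ;;
       for_each rW It (Out\<lbrakk>Reg rW\<rbrakk> :=\<^sub>T Push (Reg rV) (Tab Out (Reg rW))))"

text \<open>
  Backward breadth-first search, level by level: afterwards \<open>Seen\<close> marks the vertices from which
  \<open>compl rX\<close> is reachable after the vertices marked by \<open>OnPath\<close> have been deleted.
\<close>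
definition bfs :: com where
  "bfs =
     It :=\<^sub>S Lst Ord ;; for_each rV It (Seen\<lbrakk>Reg rV\<rbrakk> :=\<^sub>T Empty) ;;
     Seen\<lbrakk>Co (Reg rX)\<rbrakk> :=\<^sub>T Push (Reg rX) Empty ;;
     Cur :=\<^sub>S Push (Co (Reg rX)) Empty ;; Nxt :=\<^sub>S Empty ;;
     WHILE NotB (IsEmpty (Lst Cur)) DO
      (for_each rV Cur
        (It :=\<^sub>S Tab In (Reg rV) ;;
         for_each rW It
          (IF AndB (IsEmpty (Tab OnPath (Reg rW))) (IsEmpty (Tab Seen (Reg rW)))
           THEN (Seen\<lbrakk>Reg rW\<rbrakk> :=\<^sub>T Push (Reg rW) Empty ;; Nxt :=\<^sub>S Push (Reg rW) (Lst Nxt))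
           ELSE Skip)) ;;
       Cur :=\<^sub>S Lst Nxt ;; Nxt :=\<^sub>S Empty)"

text \<open>
  OUTPUT(\<open>P\<close>), where \<open>rY\<close> is the last vertex of \<open>P\<close>.  If the last arc is not a unit, then \<open>Fwd\<close> becomes
  the word of \<open>P\<^sub>1\<close>, while the word of its contraposition is read off by complementing the entries of
  \<open>Path\<close> (which is stored in reversed order).  Since \<open>P\<close> and \<open>P'\<close> share \<open>P\<^sub>0\<close>, the comparison amounts to
  comparing these two words; at the first difference the two literals are searched for in \<open>Ord\<close>.
\<close>
definition output_path :: com where
  "output_path =
     Deliver Path ;;
     IF EqL (Top (Pop (Lst Path))) (Co (Reg rY)) THEN Print Path
     ELSE
      (It :=\<^sub>S Lst Path ;; Fwd :=\<^sub>S Empty ;;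
       WHILE NotB (EqL (Top (Lst It)) (Co (Reg rY))) DO
        (Fwd :=\<^sub>S Push (Top (Lst It)) (Lst Fwd) ;; It :=\<^sub>S Pop (Lst It)) ;;
       Fwd :=\<^sub>S Push (Co (Reg rY)) (Lst Fwd) ;;
       It :=\<^sub>S Lst Path ;;
       WHILE AndB (NotB (IsEmpty (Lst Fwd))) (EqL (Top (Lst Fwd)) (Co (Top (Lst It)))) DO
        (Fwd :=\<^sub>S Pop (Lst Fwd) ;; It :=\<^sub>S Pop (Lst It)) ;;
       IF IsEmpty (Lst Fwd) THEN Skip
       ELSE
        (rV :=\<^sub>R Top (Lst Fwd) ;; rW :=\<^sub>R Co (Top (Lst It)) ;;
         It :=\<^sub>S Lst Ord ;;
         WHILE AndB (NotB (EqL (Top (Lst It)) (Reg rV))) (NotB (EqL (Top (Lst It)) (Reg rW)))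
         DO It :=\<^sub>S Pop (Lst It) ;;
         IF EqL (Top (Lst It)) (Reg rV) THEN Print Path ELSE Skip))"

text \<open>
  DFS(\<open>P, rY\<close>) up to its loop over \<open>R\<close>.  The set \<open>R\<close> is stored, in the order \<open>L\<close>, in the cell of \<open>Rem\<close>
  belonging to \<open>rY\<close>.  As \<open>P\<close> was regular before, a complementary pair must involve \<open>rY\<close>.
\<close>
definition enter :: com where
  "enter =
     Path :=\<^sub>S Push (Reg rY) (Lst Path) ;; OnPath\<lbrakk>Reg rY\<rbrakk> :=\<^sub>T Push (Reg rY) Empty ;;
     IF NotB (IsEmpty (Tab OnPath (Co (Reg rY)))) THEN output_path
     ELSE
      (bfs ;;
       It :=\<^sub>S Tab Out (Reg rY) ;; Tmp :=\<^sub>S Empty ;;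
       for_each rV It (IF IsEmpty (Tab Seen (Reg rV)) THEN Skip ELSE Tmp :=\<^sub>S Push (Reg rV) (Lst Tmp)) ;;
       for_each rV Tmp (Rem\<lbrakk>Reg rY\<rbrakk> :=\<^sub>T Push (Reg rV) (Tab Rem (Reg rY))))"

text \<open>The recursion of DFS is unfolded, with \<open>Path\<close> serving as the recursion stack.\<close>
definition enum :: com where
  "enum =
     bfs ;;
     IF IsEmpty (Tab Seen (Reg rX)) THEN Skip
     ELSE
      (rY :=\<^sub>R Reg rX ;; enter ;;
       WHILE NotB (IsEmpty (Lst Path)) DO
        (rY :=\<^sub>R Top (Lst Path) ;;
         IF IsEmpty (Tab Rem (Reg rY))
         THEN (OnPath\<lbrakk>Reg rY\<rbrakk> :=\<^sub>T Empty ;; Path :=\<^sub>S Pop (Lst Path))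
         ELSE (rV :=\<^sub>R Top (Tab Rem (Reg rY)) ;; Rem\<lbrakk>Reg rY\<rbrakk> :=\<^sub>T Pop (Tab Rem (Reg rY)) ;;
               rY :=\<^sub>R Reg rV ;; enter)))"

text \<open>Removal of the unit-clause \<open>{rX}\<close>, that is, of the arc from \<open>compl rX\<close> to \<open>rX\<close>.\<close>
definition remove_unit :: com where
  "remove_unit =
     It :=\<^sub>S Tab Out (Co (Reg rX)) ;; Tmp :=\<^sub>S Empty ;;
     for_each rV It (IF EqL (Reg rV) (Reg rX) THEN Skip ELSE Tmp :=\<^sub>S Push (Reg rV) (Lst Tmp)) ;;
     Out\<lbrakk>Co (Reg rX)\<rbrakk> :=\<^sub>T Empty ;;
     for_each rV Tmp (Out\<lbrakk>Co (Reg rX)\<rbrakk> :=\<^sub>T Push (Reg rV) (Tab Out (Co (Reg rX)))) ;;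
     It :=\<^sub>S Tab In (Reg rX) ;; In\<lbrakk>Reg rX\<rbrakk> :=\<^sub>T Empty ;;
     for_each rV It (IF EqL (Reg rV) (Co (Reg rX)) THEN Skip
                    ELSE In\<lbrakk>Reg rX\<rbrakk> :=\<^sub>T Push (Reg rV) (Tab In (Reg rX)))"

definition enum_all :: com where
  "enum_all =
     IF IsEmpty (Lst Units) THEN Skip
     ELSE
      (build_idg ;;
       Todo :=\<^sub>S Lst Ord ;;
       for_each rX Todo
        (IF IsEmpty (Tab IsUnit (Reg rX)) THEN Skip ELSE (enum ;; remove_unit)))"

end

theory Submission
  imports Defs
begin

text \<open>
  Let \<open>P\<close> be a nearly regular path from \<open>x\<close>, split as \<open>P\<^sub>0; P\<^sub>1\<close> at the complement of its last vertex \<open>w\<close>.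
  The contraposition of \<open>P\<^sub>0\<close> leads from \<open>w\<close> back to the complement of \<open>x\<close>, so that this literal stays
  reachable from every vertex of \<open>P\<close> after the deletion of the preceding vertices.  Conversely, a walk
  towards the complement of \<open>x\<close> that starts with a regular path completes a complementary pair.  Hence the
  search of DFS is exact: no call is a dead end, and between two calls of OUTPUT there are at most
  linearly many calls of DFS, each dominated by one linear-time breadth-first search.

  Unit propagation along \<open>P\<close> refutes \<open>F(P)\<close>, while cutting \<open>P\<close> at an arc leaves segments that can be made
  true, false and true.  If \<open>F(P) = F(Q)\<close> for two paths from \<open>x\<close> that separate at \<open>y\<close>, then \<open>Q\<close> leaves \<open>y\<close> by
  the contraposition of the last arc of \<open>P\<close>; so \<open>P\<close> ends in the complement of \<open>y\<close>, and \<open>Q\<close> is the partner of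
  \<open>P\<close> obtained by contraposing \<open>P\<^sub>1\<close>.  A path that is not printed is thus preceded by its printed partner:
  after \<open>m\<close> clause-sets have been printed, at most \<open>m\<close> paths are skipped before the next one.
\<close>

text \<open>A binary clause stands for two arcs, contrapositions of each other, so a clause-set
  fixes its path only up to contraposition; that is where partners come from. On the machine side
  three obstacles shape the proof. A call of DFS is not a command: the recursion is one WHILE loop,
  so a subtree of the search is a block of loop iterations. Delays are not local: the stretch after
  the last path of one subtree merges with the stretch before the first path of the next. Traces
  therefore carry separate bounds for their first and last stretch, next to a common bound
  \<open>D\<close> for the inner ones. Finally, a unit-clause may own no path at all, and
  arbitrarily many fruitless linear-time searches can precede the next delivery; what saves the
  delay bound is that there are at most two unit-clauses per variable, so that all fruitless
  searches together still fit into one delay. Space is handled by an invariant that holds after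
  every single step and bounds each table cell by a degree in the original digraph, so that removing
  arcs never affects it.\<close>

lemma compl_compl [simp]: "compl (compl a) = a"
  by (cases a) simp_all

lemma compl_neq [simp]: "compl a \<noteq> a" "a \<noteq> compl a"
  by (cases a; simp)+

lemma compl_inject [simp]: "compl a = compl b \<longleftrightarrow> a = b"
  by (metis compl_compl)

lemma var_compl [simp]: "var (compl a) = var a"
  by (cases a) simp_all

lemma compl_in_lits [simp]: "compl a \<in> lits F \<longleftrightarrow> a \<in> lits F"
  by (simp add: lits_def)

lemma lit_true_compl [simp]: "lit_true \<phi> (compl a) \<longleftrightarrow> \<not> lit_true \<phi> a"
  by (cases a) simp_all

lemma regular_iff: "regular q \<longleftrightarrow> (\<forall>a\<in>set q. compl a \<notin> set q)"
  by (auto simp: regular_def compl_pairs_def)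

lemma regular_snoc: "regular (q @ [y]) \<longleftrightarrow> regular q \<and> compl y \<notin> set q"
  by (auto simp: regular_iff)

lemma mem_idg: "(a, b) \<in> parcs (idg F) \<longleftrightarrow> {compl a, b} \<in> F"
  by (auto simp: idg_def) (metis compl_compl)

section \<open>Arc sets closed under contraposition, and nearly regular paths as words\<close>

definition skew :: "('v lit \<times> 'v lit) set \<Rightarrow> bool" where
  "skew A \<longleftrightarrow> (\<forall>a b. (a, b) \<in> A \<longrightarrow> (compl b, compl a) \<in> A)"

lemma skewD: "skew A \<Longrightarrow> (a, b) \<in> A \<Longrightarrow> (compl b, compl a) \<in> A"
  by (auto simp: skew_def)

lemma skew_idg: "skew (parcs (idg F))"
  by (auto simp: skew_def mem_idg insert_commute)

text \<open>The notion depends on the arcs alone, so that it is monotone in \<open>A\<close> and can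
  be compared across the shrinking digraphs of the procedure. The vertex set is redundant: such a
  path has at least two vertices, and each of them lies on an arc.\<close>

definition nr_path :: "('v lit \<times> 'v lit) set \<Rightarrow> 'v lit \<Rightarrow> 'v lit list \<Rightarrow> bool" where
  "nr_path A x P \<longleftrightarrow> distinct P \<and> set (vwalk_arcs P) \<subseteq> A \<and>
     (\<exists>q w. P = q @ [w] \<and> hd q = x \<and> compl w \<in> set q \<and> regular q)"

text \<open>Once \<open>butlast P\<close> is regular, a complementary pair must involve the last
  vertex, and the only possible pair is that vertex with its complement.\<close>

lemma nearly_regular_iff:
  "nearly_regular P \<longleftrightarrow> (\<exists>q w. P = q @ [w] \<and> compl w \<in> set q \<and> regular q)"
proof
  assume P: "nearly_regular P"
  then obtain X where X: "compl_pairs P = {X}"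
    by (auto simp: nearly_regular_def card_1_singleton_iff)
  then have "P \<noteq> []" by (auto simp: compl_pairs_def)
  then obtain q w where q: "P = q @ [w]" by (metis rev_exhaust)
  with P have "regular q" by (simp add: nearly_regular_def)
  moreover have "X \<in> compl_pairs P" using X by simp
  then obtain a where "a \<in> set P" "compl a \<in> set P" by (auto simp: compl_pairs_def)
  with \<open>regular q\<close> q have "compl w \<in> set q" by (auto simp: regular_iff)
  ultimately show "\<exists>q w. P = q @ [w] \<and> compl w \<in> set q \<and> regular q" using q by blast
next
  assume "\<exists>q w. P = q @ [w] \<and> compl w \<in> set q \<and> regular q"
  then obtain q w where *: "P = q @ [w]" "compl w \<in> set q" "regular q" by blast
  then have "compl_pairs P = {{w, compl w}}"
    by (auto simp: compl_pairs_def regular_iff)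
  with * show "nearly_regular P" by (simp add: nearly_regular_def)
qed

lemma vertices_of_arcs:
  assumes "set (vwalk_arcs P) \<subseteq> A" "A \<subseteq> V \<times> V" "length P \<ge> 2"
  shows "set P \<subseteq> V"
  using assms
proof (induction P rule: vwalk_arcs.induct)
  case (3 x y xs)
  then show ?case by (cases xs) auto
qed auto

lemma idg_arcs_lits: "parcs (idg F) \<subseteq> lits F \<times> lits F"
proof (clarify, unfold mem_idg)
  fix a b assume "{compl a, b} \<in> F"
  then have "var (compl a) \<in> vars F" "var b \<in> vars F" by (auto simp: vars_def simp del: var_compl)
  then show "a \<in> lits F \<and> b \<in> lits F" by (simp add: lits_def)
qed

lemma NR_iff: "P \<in> NR x (idg F) \<longleftrightarrow> nr_path (parcs (idg F)) x P"
proof -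
  have "hd P = x \<longleftrightarrow> hd q = x" if "P = q @ [w]" "compl w \<in> set q" for q w
    using that by (cases q) auto
  moreover have "set P \<subseteq> lits F"
    if "set (vwalk_arcs P) \<subseteq> parcs (idg F)" "P = q @ [w]" "compl w \<in> set q" for q w
    by (rule vertices_of_arcs[OF that(1) idg_arcs_lits]) (use that in \<open>cases q; auto\<close>)
  moreover have "pverts (idg F) = lits F" by (simp add: idg_def)
  ultimately show ?thesis
    unfolding NR_def nr_path_def nearly_regular_iff vpath_def vwalk_def mem_Collect_eq with_proj_simps
    by (metis append_is_Nil_conv not_Cons_self2)
qed

lemma nr_path_mono: "A \<subseteq> B \<Longrightarrow> nr_path A x P \<Longrightarrow> nr_path B x P"
  by (auto simp: nr_path_def)

lemma nr_pathE:
  assumes "nr_path A x P"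
  obtains q w where "P = q @ [w]" "q \<noteq> []" "hd q = x" "x \<in> set q" "compl w \<in> set q" "regular q"
    "distinct P" "set (vwalk_arcs P) \<subseteq> A"
proof -
  from assms obtain q w where *: "P = q @ [w]" "hd q = x" "compl w \<in> set q" "regular q"
    "distinct P" "set (vwalk_arcs P) \<subseteq> A" unfolding nr_path_def by auto
  with * have "q \<noteq> []" by auto
  with * that show thesis by auto
qed

lemma nr_path_prefix_regular:
  assumes "nr_path A x P" "P = p @ r" "r \<noteq> []"
  shows "regular p"
proof -
  from assms obtain q w where q: "P = q @ [w]" "regular q" by (auto elim: nr_pathE)
  with assms have "q = p @ butlast r" by (metis butlast_append butlast_snoc)
  with q show ?thesis by (auto simp: regular_iff)
qed

lemma nr_path_not_regular: "nr_path A x P \<Longrightarrow> \<not> regular P"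
  by (auto simp: nr_path_def regular_snoc)

text \<open>Proper prefixes of nearly regular paths are regular. Nearly regular paths hence form a
  prefix-free code, which makes the lexicographic comparison depend on genuine differences
  only.\<close>

lemma nr_path_prefix_eq:
  assumes "nr_path A x P" "nr_path B y Q" "Q = P @ r"
  shows "r = []"
  using assms nr_path_prefix_regular nr_path_not_regular by blast

lemma nr_path_hd: "nr_path A x P \<Longrightarrow> hd P = x \<and> P \<noteq> []"
  by (auto elim!: nr_pathE)

section \<open>Depth-first search for nearly regular paths\<close>

text \<open>The vertices from which \<open>compl x\<close> is reachable after deleting \<open>D\<close>; the target itself is never deleted.\<close>
definition reach :: "('v lit \<times> 'v lit) set \<Rightarrow> 'v lit \<Rightarrow> 'v lit set \<Rightarrow> 'v lit set" where
  "reach A x D = {u. (u, compl x) \<in> {(a, b) \<in> A. a \<notin> D}\<^sup>*}"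

text \<open>The leaves of the search tree below the node \<open>q\<close>.\<close>

definition ext :: "('v lit \<times> 'v lit) set \<Rightarrow> 'v lit \<Rightarrow> 'v lit list \<Rightarrow> 'v lit list set" where
  "ext A x q = {P. nr_path A x P \<and> (\<exists>r. P = q @ r)}"

lemma reach_base: "compl x \<in> reach A x D"
  by (simp add: reach_def)

lemma reach_step: "(u, v) \<in> A \<Longrightarrow> u \<notin> D \<Longrightarrow> v \<in> reach A x D \<Longrightarrow> u \<in> reach A x D"
  by (auto simp: reach_def intro: converse_rtrancl_into_rtrancl)

lemma reach_not_deleted: "u \<in> reach A x D \<Longrightarrow> u = compl x \<or> u \<notin> D"
  unfolding reach_def by (auto elim: converse_rtranclE)

text \<open>\<open>reach\<close> is the least set containing the target and closed under undeleted
  predecessors; backward search is complete because its set of seen vertices is closed in this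
  way.\<close>

lemma reach_least:
  assumes "compl x \<in> S" "\<And>u v. v \<in> S \<Longrightarrow> (u, v) \<in> A \<Longrightarrow> u \<notin> D \<Longrightarrow> u \<in> S"
  shows "reach A x D \<subseteq> S"
proof
  fix u assume "u \<in> reach A x D"
  then have "(u, compl x) \<in> {(a, b) \<in> A. a \<notin> D}\<^sup>*" by (simp add: reach_def)
  then show "u \<in> S" by (induction rule: converse_rtrancl_induct) (use assms in auto)
qed

lemma reach_finite:
  assumes "A \<subseteq> V \<times> V" "x \<in> V" "\<And>a. a \<in> V \<Longrightarrow> compl a \<in> V"
  shows "reach A x D \<subseteq> V"
  by (rule reach_least) (use assms in auto)

text \<open>No dead ends: cut a path to \<open>compl x\<close> at its last visit of \<open>y\<close>.\<close>
lemma reach_successor: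
  assumes "y \<in> reach A x D" "y \<noteq> compl x"
  shows "\<exists>z. (y, z) \<in> A \<and> z \<in> reach A x (insert y D)"
proof -
  have "u \<in> reach A x (insert y D) \<or> (\<exists>z. (y, z) \<in> A \<and> z \<in> reach A x (insert y D))"
    if "(u, compl x) \<in> {(a, b) \<in> A. a \<notin> D}\<^sup>*" for u
    using that
  proof (induction rule: converse_rtrancl_induct)
    case base
    then show ?case by (simp add: reach_base)
  next
    case (step u v)
    then show ?case by (cases "u = y") (auto intro: reach_step)
  qed
  \<comment> \<open>For \<open>u = y\<close> the first alternative is impossible, since
    \<open>y\<close> is deleted and differs from the target.\<close>
  from this[of y] assms show ?thesis
    using reach_not_deleted[of y A x "insert y D"] by (auto simp: reach_def)
qed

text \<open>Contraposing \<open>p\<close> arc by arc gives a walk from the complement of its last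
  vertex to \<open>compl x\<close>. Its vertices are the complements of those of \<open>p\<close>,
  which is why the hypothesis on \<open>D\<close> speaks of complements.\<close>

lemma reach_contraposition:
  assumes "skew A" "set (vwalk_arcs p) \<subseteq> A" "p \<noteq> []" "hd p = x" "\<forall>v\<in>set p. compl v \<notin> D"
  shows "compl (last p) \<in> reach A x D"
  using assms
proof (induction p rule: rev_induct)
  case (snoc v p)
  show ?case
  proof (cases "p = []")
    case True
    with snoc.prems show ?thesis by (simp add: reach_base)
  next
    case False
    with snoc have "compl (last p) \<in> reach A x D" "(last p, v) \<in> A"
      by (auto simp: set_vwalk_arcs_snoc)
    from reach_step[OF skewD[OF snoc.prems(1) this(2)] _ this(1)] snoc.prems(5) show ?thesis by simp
  qed
qed simp

lemma reach_along:
  assumes "set (vwalk_arcs (r @ [w])) \<subseteq> A" "set r \<inter> D = {}" "w \<in> reach A x D"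
  shows "hd (r @ [w]) \<in> reach A x D"
  using assms
proof (induction r)
  case (Cons a r)
  then have "hd (r @ [w]) \<in> reach A x D" by auto
  moreover from Cons.prems have "(a, hd (r @ [w])) \<in> A" "a \<notin> D" by auto
  ultimately show ?case by (auto intro: reach_step)
qed simp

text \<open>Exactness of one branching step. The inclusion with content is that the search never
  prunes a vertex through which some nearly regular path continues: from \<open>hd r\<close> follow
  the path to its end \<open>w\<close>, then the contraposition of its initial part back to
  \<open>compl x\<close>.\<close>

lemma ext_regular:
  assumes "skew A" "regular q" "q \<noteq> []"
  shows "ext A x q = (\<Union>z \<in> {z. (last q, z) \<in> A \<and> z \<in> reach A x (set q)}. ext A x (q @ [z]))"
proof (intro equalityI subsetI)
  fix P assume "P \<in> ext A x q"
  then obtain r where P: "nr_path A x P" "P = q @ r" by (auto simp: ext_def)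
  with assms nr_path_not_regular have "r \<noteq> []" by fastforce
  from P(1) obtain q' w where q': "P = q' @ [w]" "hd q' = x" "compl w \<in> set q'" "regular q'"
    "distinct P" "set (vwalk_arcs P) \<subseteq> A" "q' \<noteq> []" by (auto elim: nr_pathE)
  have r: "q' = q @ butlast r" "last r = w"
    using P q' \<open>r \<noteq> []\<close> by (metis butlast_append butlast_snoc, metis last_append last_snoc)
  from q' obtain p1 p2 where p: "q' = (p1 @ [compl w]) @ p2" by (metis split_list append_Cons append_Nil append_assoc)
  \<comment> \<open>The way back from \<open>w\<close>: it uses complements of vertices of the
    regular path \<open>q'\<close>, hence meets no vertex of \<open>q\<close>.\<close>
  have "compl (last (p1 @ [compl w])) \<in> reach A x (set q)"
  proof (rule reach_contraposition[OF assms(1)])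
    show "set (vwalk_arcs (p1 @ [compl w])) \<subseteq> A"
      using q' p set_vwalk_arcs_append1 by (metis append_assoc subset_trans)
    show "hd (p1 @ [compl w]) = x" using q' p by (cases p1) auto
    show "\<forall>v\<in>set (p1 @ [compl w]). compl v \<notin> set q"
    proof
      fix v assume "v \<in> set (p1 @ [compl w])"
      then have "v \<in> set q'" by (subst p) auto
      with q'(4) have "compl v \<notin> set q'" by (simp add: regular_iff)
      then show "compl v \<notin> set q" by (subst (asm) r(1)) auto
    qed
  qed simp
  then have "w \<in> reach A x (set q)" by simp
  \<comment> \<open>The way forward to \<open>w\<close>: the vertices of \<open>butlast r\<close>
    are new because \<open>P\<close> is a path.\<close>
  then have "hd (butlast r @ [w]) \<in> reach A x (set q)"
  proof (rule reach_along[rotated 2])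
    show "set (vwalk_arcs (butlast r @ [w])) \<subseteq> A"
      using q' r P set_vwalk_arcs_append2 by (metis append_assoc subset_trans)
    show "set (butlast r) \<inter> set q = {}" using q' r by auto
  qed
  then have "hd r \<in> reach A x (set q)" using r \<open>r \<noteq> []\<close> by (metis append_butlast_last_id)
  moreover have "(last q, hd r) \<in> A"
    using q'(6) P(2) \<open>r \<noteq> []\<close> assms(3) by (auto simp: vwalk_arcs_append)
  moreover have "P \<in> ext A x (q @ [hd r])"
    using P \<open>r \<noteq> []\<close> by (auto simp: ext_def) (metis append_Cons append_Nil list.collapse)
  ultimately show "P \<in> (\<Union>z \<in> {z. (last q, z) \<in> A \<and> z \<in> reach A x (set q)}. ext A x (q @ [z]))"
    by blast
next
  fix P assume "P \<in> (\<Union>z \<in> {z. (last q, z) \<in> A \<and> z \<in> reach A x (set q)}. ext A x (q @ [z]))"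
  then obtain z r where "nr_path A x P" "P = (q @ [z]) @ r" by (auto simp: ext_def)
  then show "P \<in> ext A x q" by (simp add: ext_def)
qed

text \<open>A nearly regular path is a leaf, by prefix-freeness.\<close>

lemma ext_complete:
  assumes "distinct (q @ [w])" "set (vwalk_arcs (q @ [w])) \<subseteq> A" "hd q = x" "compl w \<in> set q" "regular q"
  shows "ext A x (q @ [w]) = {q @ [w]}"
proof -
  have "nr_path A x (q @ [w])" using assms by (auto simp: nr_path_def)
  then have "P = q @ [w]" if "nr_path A x P" "P = (q @ [w]) @ r" for P r
    using nr_path_prefix_eq[OF _ that] that(2) by simp
  with \<open>nr_path A x (q @ [w])\<close> show ?thesis by (auto simp: ext_def simp del: append_assoc)
qed

section \<open>Minimally unsatisfiable clause-sets and nearly regular paths\<close>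

lemma arc_split:
  assumes "(a, b) \<in> set (vwalk_arcs (u @ v))"
  shows "(a, b) \<in> set (vwalk_arcs u) \<or> (a, b) \<in> set (vwalk_arcs v) \<or>
    u \<noteq> [] \<and> v \<noteq> [] \<and> a = last u \<and> b = hd v"
  using assms by (cases "u = []"; cases "v = []") (auto simp: vwalk_arcs_append)

lemma arc_mem: "(a, b) \<in> set (vwalk_arcs u) \<Longrightarrow> a \<in> set u \<and> b \<in> set u"
  using arcs_in_vwalk_arcs by fastforce

lemma set_vwalk_arcs_split:
  "set (vwalk_arcs (p @ a # r)) = set (vwalk_arcs (p @ [a])) \<union> set (vwalk_arcs (a # r))"
  by (cases "p = []"; cases r) (auto simp: vwalk_arcs_append)

lemma mem_vwalk_arcsE:
  assumes "(a, b) \<in> set (vwalk_arcs P)"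
  obtains p r where "P = p @ a # b # r"
  using assms
proof (induction P arbitrary: thesis rule: vwalk_arcs.induct)
  case (3 x y xs)
  show ?case
  proof (cases "(a, b) = (x, y)")
    case True
    with 3(2)[of "[]" xs] show ?thesis by simp
  next
    case False
    with 3(3) have "(a, b) \<in> set (vwalk_arcs (y # xs))" by auto
    from 3(1)[OF _ this] obtain p r where "y # xs = p @ a # b # r" by blast
    then show ?thesis using 3(2)[of "x # p" r] by simp
  qed
qed simp_all

text \<open>A clause determines its arc only up to contraposition; the second alternative is the
  only source of distinct paths with the same clause-set.\<close>

lemma mem_CL: "{compl a, b} \<in> CL A \<longleftrightarrow> (a, b) \<in> A \<or> (compl b, compl a) \<in> A"
proof
  assume "{compl a, b} \<in> CL A"
  then obtain c d where "(c, d) \<in> A" "{compl a, b} = {compl c, d}" by (auto simp: CL_def)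
  then show "(a, b) \<in> A \<or> (compl b, compl a) \<in> A" by (auto simp: doubleton_eq_iff)
next
  assume "(a, b) \<in> A \<or> (compl b, compl a) \<in> A"
  then show "{compl a, b} \<in> CL A"
    unfolding CL_def by (auto intro: rev_image_eqI)
qed

lemma CL_E:
  assumes "C \<in> CL A"
  obtains a b where "C = {compl a, b}" "(a, b) \<in> A"
  using assms by (auto simp: CL_def)

lemma F_of_subset:
  assumes "set (vwalk_arcs P) \<subseteq> parcs (idg F)" "{hd P} \<in> F"
  shows "F_of P \<subseteq> F"
proof
  fix C assume "C \<in> F_of P"
  then consider "C = {hd P}" | a b where "C = {compl a, b}" "(a, b) \<in> set (vwalk_arcs P)"
    unfolding F_of_def by (blast elim: CL_E)
  then show "C \<in> F" using assms by cases (auto simp: mem_idg[symmetric])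
qed

lemma satisfiable_mono: "satisfiable G \<Longrightarrow> F \<subseteq> G \<Longrightarrow> satisfiable F"
  unfolding satisfiable_def by blast

lemma unit_propagation:
  assumes "\<forall>(a, b)\<in>set (vwalk_arcs P). lit_true \<phi> a \<longrightarrow> lit_true \<phi> b" "lit_true \<phi> (hd P)"
  shows "\<forall>v\<in>set P. lit_true \<phi> v"
  using assms
proof (induction P rule: vwalk_arcs.induct)
  case (3 x y xs)
  have "(x, y) \<in> set (vwalk_arcs (x # y # xs))" by simp
  with 3(2,3) have "lit_true \<phi> y" by fastforce
  with 3 have "\<forall>v\<in>set (y # xs). lit_true \<phi> v" by simp
  with 3(3) show ?case by simp
qed simp_all

lemma F_of_unsat:
  assumes "nr_path A x P"
  shows "\<not> satisfiable (F_of P)"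
proof
  assume "satisfiable (F_of P)"
  then obtain \<phi> where \<phi>: "\<And>C. C \<in> F_of P \<Longrightarrow> \<exists>a\<in>C. lit_true \<phi> a"
    by (auto simp: satisfiable_def)
  have "lit_true \<phi> (hd P)" using \<phi>[of "{hd P}"] by (simp add: F_of_def)
  moreover have "lit_true \<phi> a \<longrightarrow> lit_true \<phi> b" if "(a, b) \<in> set (vwalk_arcs P)" for a b
    using \<phi>[of "{compl a, b}"] that by (auto simp: F_of_def mem_CL)
  ultimately have "\<forall>v\<in>set P. lit_true \<phi> v" by (intro unit_propagation) auto
  moreover from assms obtain w where "w \<in> set P" "compl w \<in> set P"
    unfolding nr_path_def by (metis Un_iff list.set_intros(1) set_append)
  ultimately show False by (metis lit_true_compl)
qed

text \<open>The literals of \<open>p\<close> and the complements of those of \<open>m\<close> can be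
  made true together: a clash inside one part contradicts its regularity, and a clash between the
  parts would be a common element of \<open>p\<close> and \<open>m\<close>.\<close>

lemma assignment_of_parts:
  assumes "regular p" "regular m" "set p \<inter> set m = {}"
  shows "\<exists>\<phi>. (\<forall>a\<in>set p. lit_true \<phi> a) \<and> (\<forall>a\<in>set m. \<not> lit_true \<phi> a)"
proof -
  define T where "T = set p \<union> compl ` set m"
  have cons: "compl a \<notin> T" if "a \<in> T" for a
    using that assms by (auto simp: regular_iff T_def)
  have true: "lit_true (\<lambda>y. Pos y \<in> T) a" if "a \<in> T" for a
    using that cons[OF that] by (cases a) simp_all
  have "lit_true (\<lambda>y. Pos y \<in> T) (compl a)" if "a \<in> set m" for a
    using true that unfolding T_def by blast
  with true have "(\<forall>a\<in>set p. lit_true (\<lambda>y. Pos y \<in> T) a) \<and> (\<forall>a\<in>set m. \<not> lit_true (\<lambda>y. Pos y \<in> T) a)"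
    unfolding T_def by simp
  then show ?thesis by blast
qed

text \<open>
  If the arc between the segments \<open>u\<close> and \<open>m\<close> is dropped (or, for empty \<open>u\<close>, the unit-clause), then
  making \<open>u\<close> and \<open>v\<close> true and \<open>m\<close> false satisfies the rest.
\<close>
lemma satisfiable_parts:
  assumes P: "P = u @ m @ v" "distinct P" "regular (u @ v)" "regular m" "m \<noteq> []"
    and C: "C = (if u = [] then {hd P} else {compl (last u), hd m})"
  shows "satisfiable (F_of P - {C})"
proof -
  from assignment_of_parts[OF P(3,4)] P(1,2) obtain \<phi> where
    \<phi>: "\<forall>a\<in>set u \<union> set v. lit_true \<phi> a" "\<forall>a\<in>set m. \<not> lit_true \<phi> a" by auto
  have "\<exists>a\<in>E. lit_true \<phi> a" if "E \<in> F_of P - {C}" for E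
  proof (cases "E = {hd P}")
    case True
    with that C have "u \<noteq> []" by auto
    then show ?thesis using True P(1) \<phi>(1) by auto
  next
    case False
    with that obtain a b where E: "E = {compl a, b}" "(a, b) \<in> set (vwalk_arcs P)"
      unfolding F_of_def by (blast elim: CL_E)
    have "a \<in> set m \<or> b \<in> set u \<union> set v"
    proof -
      from arc_split[OF E(2)[unfolded P(1)]] consider "b \<in> set u" | "(a, b) \<in> set (vwalk_arcs (m @ v))"
        | "u \<noteq> []" "a = last u" "b = hd m" using P(5) by (auto dest: arc_mem)
      then show ?thesis
      proof cases
        case 2
        from arc_split[OF this] show ?thesis using P(5) by (auto dest: arc_mem)
      next
        case 3
        with C E that show ?thesis by auto
      qed simp
    qed
    then show ?thesis using E(1) \<phi> by auto
  qed
  then show ?thesis unfolding satisfiable_def by blast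
qed

lemma nr_path_splitE:
  assumes "nr_path A x P"
  obtains p1 p2 w where "P = p1 @ [compl w] @ p2 @ [w]" "regular (p1 @ [compl w] @ p2)" "distinct P"
    "hd (p1 @ [compl w]) = x" "set (vwalk_arcs P) \<subseteq> A"
proof -
  from assms obtain q w where q: "P = q @ [w]" "hd q = x" "compl w \<in> set q" "regular q"
    "distinct P" "set (vwalk_arcs P) \<subseteq> A" by (auto elim: nr_pathE)
  from q(3) obtain p1 p2 where "q = p1 @ compl w # p2" by (auto dest: split_list)
  with q show thesis by (intro that[of p1 w p2]) (cases p1; simp)+
qed

text \<open>The segments must be chosen so that \<open>w\<close> and \<open>compl w\<close> get
  opposite values. Without the unit-clause, everything up to \<open>compl w\<close> is false and the
  rest true. If the dropped arc starts at or after \<open>compl w\<close>, the vertices before the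
  cut are true and those after it false. If it ends at or before \<open>compl w\<close>, the false
  segment runs from the cut to \<open>compl w\<close>, and both outer segments are true.\<close>

lemma F_of_min_unsat:
  assumes "nr_path A x P"
  shows "min_unsat (F_of P)"
proof -
  from assms obtain p1 p2 w where P: "P = p1 @ [compl w] @ p2 @ [w]" "regular (p1 @ [compl w] @ p2)"
    "distinct P" by (auto elim: nr_path_splitE)
  have sub: "regular r" if "set r \<subseteq> set p1 \<union> {compl w} \<union> set p2" for r
  proof -
    have "set r \<subseteq> set (p1 @ [compl w] @ p2)" using that by auto
    with P(2) show ?thesis unfolding regular_iff by blast
  qed
  \<comment> \<open>\<open>w\<close> and \<open>compl w\<close> are the only complementary pair of
    \<open>P\<close>, so omitting \<open>compl w\<close> instead of \<open>w\<close> also leaves a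
    regular set.\<close>
  have subw: "regular r" if "set r \<subseteq> insert w (set p1 \<union> set p2)" for r
  proof -
    let ?W = "insert w (set p1 \<union> set p2)"
    have "\<forall>a\<in>?W. compl a \<notin> ?W" using P(2,3) unfolding regular_iff P(1) by auto
    with that show ?thesis unfolding regular_iff by blast
  qed
  have "satisfiable (F_of P - {C})" if "C \<in> F_of P" for C
  proof (cases "C = {hd P}")
    case True
    show ?thesis
      by (rule satisfiable_parts[of P "[]" "p1 @ [compl w]" "p2 @ [w]"])
        (use P True in \<open>auto intro: sub subw\<close>)
  next
    case False
    with that obtain a b where C: "C = {compl a, b}" "(a, b) \<in> set (vwalk_arcs P)"
      unfolding F_of_def by (blast elim: CL_E)
    from C(2) obtain p r where p: "P = p @ a # b # r" by (rule mem_vwalk_arcsE)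
    show ?thesis
    proof (cases "compl w \<in> set (p @ [a])")
      case True
      show ?thesis
      proof (rule satisfiable_parts[of P "p @ [a]" "b # r" "[]"])
        have "butlast P = p @ a # butlast (b # r)" unfolding p by (simp add: butlast_append)
        then have "set (p @ [a]) \<subseteq> set (p1 @ [compl w] @ p2)" using P(1) by (auto simp: butlast_append)
        then show "regular ((p @ [a]) @ [])" by (intro sub) auto
        have "compl w \<notin> set (b # r)" using True P(3) p by auto
        moreover have "set (b # r) \<subseteq> set P" using p by auto
        ultimately show "regular (b # r)" unfolding P(1) by (intro subw) auto
      qed (use p P C in auto)
    next
      case False
      then have "compl w \<in> set (b # r)" using P(1) p by (metis Un_iff append.assoc append_Cons append_Nil in_set_conv_decomp set_append)
      then obtain v1 v2 where v: "b # r = v1 @ compl w # v2" by (meson split_list)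
      have "P = (p @ [a] @ v1) @ compl w # v2" using p v by simp
      then have eq: "p @ [a] @ v1 = p1" "v2 = p2 @ [w]"
        using P(1,3) append_Cons_eq_iff[of "compl w" "p @ [a] @ v1" v2 p1 "p2 @ [w]"] by auto
      show ?thesis
      proof (rule satisfiable_parts[of P "p @ [a]" "v1 @ [compl w]" v2])
        show "regular ((p @ [a]) @ v2)" unfolding eq(2) using eq(1) by (intro subw) auto
        show "regular (v1 @ [compl w])" using eq(1) by (intro sub) auto
        have "hd (v1 @ [compl w]) = b" using v by (cases v1) auto
        then show "C = (if p @ [a] = [] then {hd P} else {compl (last (p @ [a])), hd (v1 @ [compl w])})"
          using C(1) by simp
      qed (use p v P in auto)
    qed
  qed
  with F_of_unsat[OF assms] show ?thesis by (simp add: min_unsat_def)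
qed

text \<open>A regular path is dragged along the walk. A repeated vertex allows cutting back to its
  first visit, and a vertex whose complement was already visited would complete a nearly regular
  path.\<close>

lemma rtrancl_nr_path:
  assumes "(z, s) \<in> A\<^sup>*" "\<nexists>P. nr_path A z P"
  shows "\<exists>q. q \<noteq> [] \<and> hd q = z \<and> last q = s \<and> distinct q \<and> set (vwalk_arcs q) \<subseteq> A \<and> regular q"
  using assms(1)
proof (induction rule: rtrancl_induct)
  case base
  then show ?case by (intro exI[of _ "[z]"]) (simp add: regular_iff)
next
  case (step s t)
  then obtain q where q: "q \<noteq> []" "hd q = z" "last q = s" "distinct q" "set (vwalk_arcs q) \<subseteq> A" "regular q"
    by auto
  have arcs: "set (vwalk_arcs (q @ [t])) \<subseteq> A" using q step by (simp add: set_vwalk_arcs_snoc)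
  consider "t \<in> set q" | "t \<notin> set q" "compl t \<in> set q" | "t \<notin> set q" "compl t \<notin> set q" by blast
  then show ?case
  proof cases
    case 1
    then obtain p r where p: "q = p @ t # r" by (meson split_list)
    then have "set (vwalk_arcs (p @ [t])) \<subseteq> A" using q(5) set_vwalk_arcs_split[of p t r] by simp
    then show ?thesis using q p by (intro exI[of _ "p @ [t]"]) (cases p; auto simp: regular_iff)
  next
    case 2
    with q arcs have "nr_path A z (q @ [t])" by (auto simp: nr_path_def)
    with assms(2) show ?thesis by blast
  next
    case 3
    with q arcs show ?thesis by (intro exI[of _ "q @ [t]"]) (auto simp: regular_snoc)
  qed
qed

text \<open>Let \<open>S\<close> be the literals forced by \<open>z\<close>. Without a nearly
  regular path \<open>S\<close> is consistent, and overriding a satisfying assignment of the other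
  clauses by \<open>S\<close> satisfies all of \<open>F\<close>: a clause touched by
  \<open>S\<close> or its complements contains a literal of \<open>S\<close>, and the others keep
  their value.\<close>

lemma unsat_nr_path:
  assumes unsat: "\<not> satisfiable F" and sat: "satisfiable (F - {{z}})"
    and card: "\<forall>C\<in>F. card C = 1 \<or> card C = 2"
  shows "\<exists>P. nr_path (parcs (idg F)) z P"
proof (rule ccontr)
  assume no: "\<nexists>P. nr_path (parcs (idg F)) z P"
  define A where "A = parcs (idg F)"
  have skew: "skew A" unfolding A_def by (rule skew_idg)
  define S where "S = {s. (z, s) \<in> A\<^sup>*}"
  have bwd: "(compl s, compl z) \<in> A\<^sup>*" if "(z, s) \<in> A\<^sup>*" for s
    using that
  proof (induction rule: rtrancl_induct)
    case (step s t)
    then show ?case using skewD[OF skew step(2)] by (rule_tac converse_rtrancl_into_rtrancl)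
  qed simp
  \<comment> \<open>Walks from \<open>z\<close> to \<open>compl s\<close> and, by contraposing the
    walk to \<open>s\<close>, from \<open>compl s\<close> to \<open>compl z\<close> combine to a
    walk from \<open>z\<close> to \<open>compl z\<close>; its reduction to a regular path is
    absurd.\<close>
  have cons: "compl s \<notin> S" if "s \<in> S" for s
  proof
    assume "compl s \<in> S"
    with that bwd[of s] have "(z, compl z) \<in> A\<^sup>*" unfolding S_def by (auto intro: rtrancl_trans)
    from rtrancl_nr_path[OF this no[folded A_def]] obtain q where
      "q \<noteq> []" "hd q = z" "last q = compl z" "regular q" by blast
    then show False by (metis hd_in_set last_in_set regular_iff)
  qed
  from sat obtain \<phi> where \<phi>: "\<And>C. C \<in> F - {{z}} \<Longrightarrow> \<exists>a\<in>C. lit_true \<phi> a"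
    unfolding satisfiable_def by blast
  \<comment> \<open>Literals of \<open>S\<close> become true and their complements false; all other
    variables keep their value under \<phi>.\<close>
  define \<psi> where "\<psi> y \<longleftrightarrow> Pos y \<in> S \<or> Neg y \<notin> S \<and> \<phi> y" for y
  have in_S: "lit_true \<psi> a" if "a \<in> S" for a
    using that cons[of a] by (cases a) (auto simp: \<psi>_def)
  have not_in_S: "lit_true \<psi> a \<longleftrightarrow> lit_true \<phi> a" if "a \<notin> S" "compl a \<notin> S" for a
    using that by (cases a) (auto simp: \<psi>_def)
  have step: "b \<in> S" if "compl a \<in> S" "{a, b} \<in> F" for a b
    using that unfolding S_def by (auto intro: rtrancl_into_rtrancl simp: A_def mem_idg)
  have "\<exists>a\<in>C. lit_true \<psi> a" if "C \<in> F" for C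
  proof (cases "C = {z}")
    case True
    then show ?thesis using in_S by (simp add: S_def)
  next
    case False
    obtain a b where C: "C = {a, b}"
    proof (cases "card C = 1")
      case True
      then obtain a where "C = {a}" by (rule card_1_singletonE)
      then show ?thesis using that[of a a] by simp
    next
      case False
      with card \<open>C \<in> F\<close> have "card C = 2" by blast
      then show ?thesis using that by (auto simp: card_2_iff)
    qed
    have sym: "{b, a} \<in> F" using C that by (simp add: insert_commute)
    show ?thesis
    proof (cases "a \<in> S \<or> b \<in> S \<or> compl a \<in> S \<or> compl b \<in> S")
      case True
      then show ?thesis using step[of a b] step[of b a] sym \<open>C \<in> F\<close> C in_S by auto
    next
      case no: False
      then show ?thesis using \<phi>[of C] False that C not_in_S[of a] not_in_S[of b] by auto
    qed
  qed
  then show False using unsat unfolding satisfiable_def by blast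
qed

text \<open>A nearly regular path found inside \<open>F\<close> already has an unsatisfiable
  clause-set, so minimality leaves no clause over.\<close>

lemma min_unsat_F_of:
  assumes "min_unsat F" "{z} \<in> F" "\<forall>C\<in>F. card C = 1 \<or> card C = 2"
  shows "\<exists>P. nr_path (parcs (idg F)) z P \<and> F_of P = F"
proof -
  obtain P where P: "nr_path (parcs (idg F)) z P"
    using unsat_nr_path[of F z] assms by (auto simp: min_unsat_def)
  then have sub: "F_of P \<subseteq> F"
    using assms(2) nr_path_hd[OF P] by (intro F_of_subset) (auto simp: nr_path_def)
  have "C \<in> F_of P" if "C \<in> F" for C
  proof (rule ccontr)
    assume "C \<notin> F_of P"
    with sub have "F_of P \<subseteq> F - {C}" by blast
    moreover have "satisfiable (F - {C})" using that assms(1) by (simp add: min_unsat_def)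
    ultimately show False using F_of_unsat[OF P] satisfiable_mono by blast
  qed
  with P sub show ?thesis by blast
qed

section \<open>The partner of a nearly regular path, and paths with equal clause-sets\<close>

text \<open>The path \<open>P'\<close> of the procedure OUTPUT.  It equals \<open>P\<close> if the last arc of \<open>P\<close> is a unit.\<close>
definition alt :: "'v lit list \<Rightarrow> 'v lit list" where
  "alt P = takeWhile (\<lambda>v. v \<noteq> compl (last P)) P @
     map compl (rev (dropWhile (\<lambda>v. v \<noteq> compl (last P)) P))"

lemma alt_split:
  assumes "compl w \<notin> set p1"
  shows "alt (p1 @ compl w # p2 @ [w]) = p1 @ compl w # rev (map compl p2) @ [w]"
proof -
  have *: "\<forall>v\<in>set p1. v \<noteq> compl w" using assms by auto
  have "takeWhile (\<lambda>v. v \<noteq> compl w) (p1 @ compl w # p2 @ [w]) = p1"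
    "dropWhile (\<lambda>v. v \<noteq> compl w) (p1 @ compl w # p2 @ [w]) = compl w # p2 @ [w]"
    using * by (simp_all add: takeWhile_tail dropWhile_append3 takeWhile_append2)
  then show ?thesis by (simp add: alt_def rev_map)
qed

lemma nr_path_splitE':
  assumes "nr_path A x P"
  obtains p1 p2 w where "P = p1 @ compl w # p2 @ [w]" "regular (p1 @ compl w # p2)" "distinct P"
    "hd (p1 @ [compl w]) = x" "set (vwalk_arcs P) \<subseteq> A"
    "alt P = p1 @ compl w # rev (map compl p2) @ [w]"
proof -
  from assms obtain p1 p2 w where P: "P = p1 @ [compl w] @ p2 @ [w]" "regular (p1 @ [compl w] @ p2)"
    "distinct P" "hd (p1 @ [compl w]) = x" "set (vwalk_arcs P) \<subseteq> A" by (rule nr_path_splitE)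
  then show thesis using alt_split[of w p1 p2] by (intro that[of p1 w p2]) auto
qed

lemma set_vwalk_arcs_contraposition:
  "set (vwalk_arcs (map compl (rev P))) = {(compl b, compl a) |a b. (a, b) \<in> set (vwalk_arcs P)}"
proof (induction P rule: vwalk_arcs.induct)
  case (3 x y xs)
  have "map compl (rev (x # y # xs)) = map compl (rev (y # xs)) @ [compl x]" by simp
  then have "set (vwalk_arcs (map compl (rev (x # y # xs)))) =
      insert (compl y, compl x) (set (vwalk_arcs (map compl (rev (y # xs)))))"
    using set_vwalk_arcs_snoc[of "map compl (rev (y # xs))" "compl x"] by simp
  also have "\<dots> = {(compl b, compl a) |a b. (a, b) \<in> set (vwalk_arcs (x # y # xs))}"
    unfolding 3 by auto
  finally show ?case .
qed simp_all

lemma CL_contraposition: "CL {(compl b, compl a) |a b. (a, b) \<in> A} = CL A"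
proof -
  define R where "R = {(compl b, compl a) |a b. (a, b) \<in> A}"
  have R: "(c, d) \<in> R \<longleftrightarrow> (compl d, compl c) \<in> A" for c d
  proof
    assume "(compl d, compl c) \<in> A"
    then show "(c, d) \<in> R" unfolding R_def
      by (intro CollectI exI[of _ "compl d"] exI[of _ "compl c"]) simp
  qed (auto simp: R_def)
  have "{compl a, b} \<in> CL R \<longleftrightarrow> {compl a, b} \<in> CL A" for a b
    unfolding mem_CL R by (simp add: disj_commute)
  then have "C \<in> CL R \<longleftrightarrow> C \<in> CL A" for C
    by (metis CL_E)
  then show ?thesis unfolding R_def by blast
qed

context
  fixes A :: "('v lit \<times> 'v lit) set" and x :: "'v lit" and P :: "'v lit list"
  assumes skew: "skew A" and P: "nr_path A x P"
begin

lemma alt_arcs: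
  "set (vwalk_arcs (alt P)) \<subseteq> A" "CL (set (vwalk_arcs (alt P))) = CL (set (vwalk_arcs P))"
proof -
  from P obtain p1 p2 w where p: "P = p1 @ compl w # p2 @ [w]" "set (vwalk_arcs P) \<subseteq> A"
    "alt P = p1 @ compl w # rev (map compl p2) @ [w]" by (rule nr_path_splitE')
  let ?B = "set (vwalk_arcs (compl w # p2 @ [w]))" and ?H = "set (vwalk_arcs (p1 @ [compl w]))"
  let ?B' = "{(compl b, compl a) |a b. (a, b) \<in> ?B}"
  have eq: "compl w # rev (map compl p2) @ [w] = map compl (rev (compl w # p2 @ [w]))"
    by (simp add: rev_map)
  have "set (vwalk_arcs (alt P)) = ?H \<union> set (vwalk_arcs (compl w # rev (map compl p2) @ [w]))"
    unfolding p(3) by (rule set_vwalk_arcs_split)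
  then have arcs1: "set (vwalk_arcs (alt P)) = ?H \<union> ?B'"
    by (simp only: eq set_vwalk_arcs_contraposition)
  have arcs2: "set (vwalk_arcs P) = ?H \<union> ?B"
    unfolding p(1) by (rule set_vwalk_arcs_split)
  note arcs = arcs1 arcs2
  have "?B' \<subseteq> A" using p(2) arcs(2) skewD[OF skew] by auto
  then show "set (vwalk_arcs (alt P)) \<subseteq> A" using arcs p(2) by simp
  have "CL (S \<union> T) = CL S \<union> CL T" for S T :: "('v lit \<times> 'v lit) set" by (auto simp: CL_def)
  then show "CL (set (vwalk_arcs (alt P))) = CL (set (vwalk_arcs P))"
    unfolding arcs by (simp only: CL_contraposition)
qed

text \<open>Complementing \<open>p2\<close> exchanges the two requirements: \<open>p1\<close> and
  the new inner part are disjoint because \<open>P\<close> was regular, and they contain no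
  complementary pair because the vertices of \<open>P\<close> were distinct.\<close>

lemma nr_path_alt: "nr_path A x (alt P)"
proof -
  from P obtain p1 p2 w where p: "P = p1 @ compl w # p2 @ [w]" "regular (p1 @ compl w # p2)" "distinct P"
    "hd (p1 @ [compl w]) = x" "alt P = p1 @ compl w # rev (map compl p2) @ [w]"
    by (rule nr_path_splitE')
  let ?q = "p1 @ compl w # rev (map compl p2)"
  have neq: "compl a \<noteq> b" if "a \<in> set (p1 @ compl w # p2)" "b \<in> set (p1 @ compl w # p2)" for a b
    using p(2) that unfolding regular_iff by blast
  have w: "w \<noteq> a" if "a \<in> set (p1 @ compl w # p2)" for a using p(1,3) that by auto
  have disj: "a \<noteq> b" if "a \<in> set p1" "b \<in> set p2" for a b using p(1,3) that by auto
  have w': "compl w \<noteq> a" if "a \<in> set p1 \<or> a \<in> set p2" for a using p(1,3) that by auto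
  have "regular ?q"
    unfolding regular_iff
  proof
    fix a assume "a \<in> set ?q"
    then consider "a \<in> set p1" | "a = compl w" | b where "a = compl b" "b \<in> set p2" by auto
    then show "compl a \<notin> set ?q"
    proof cases
      case 1
      then show ?thesis using neq[of a] disj[of a] by auto
    next
      case 2
      have "w \<noteq> compl c" if "c \<in> set p2" for c
        using w'[of c] that by auto
      with 2 show ?thesis using w[of w] by auto
    next
      case 3
      then have "b \<notin> set p1" "b \<noteq> compl w" "\<And>c. c \<in> set p2 \<Longrightarrow> b \<noteq> compl c"
        using disj[of b b] w'[of b] neq[of _ b] by auto
      with 3 show ?thesis by auto
    qed
  qed
  moreover have "distinct (alt P)"
    unfolding p(5) using p(1,3) neq w w' by (auto simp: distinct_map inj_on_def)
  moreover have "hd ?q = x" using p(4) by (cases p1) auto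
  ultimately show ?thesis
    using alt_arcs(1) unfolding nr_path_def p(5) by (intro conjI exI[of _ ?q] exI[of _ w]) auto
qed

lemma F_of_alt: "F_of (alt P) = F_of P"
  using alt_arcs(2) nr_path_hd[OF P] nr_path_hd[OF nr_path_alt] by (simp add: F_of_def)

lemma alt_alt: "alt (alt P) = P"
proof -
  from P obtain p1 p2 w where p: "P = p1 @ compl w # p2 @ [w]" "distinct P"
    "alt P = p1 @ compl w # rev (map compl p2) @ [w]" by (rule nr_path_splitE')
  have "compl w \<notin> set p1" using p(1,2) by auto
  then show ?thesis unfolding p(3) using alt_split[of w p1 "rev (map compl p2)"] p(1)
    by (simp add: rev_map comp_def)
qed

text \<open>Both sides say that \<open>p2\<close> is empty: a nonempty \<open>p2\<close> invariant
  under contraposition would contain the complement of its own last vertex.\<close>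

lemma alt_eq_iff: "alt P = P \<longleftrightarrow> last (butlast P) = compl (last P)"
proof -
  from P obtain p1 p2 w where p: "P = p1 @ compl w # p2 @ [w]" "distinct P"
    "regular (p1 @ compl w # p2)" "alt P = p1 @ compl w # rev (map compl p2) @ [w]"
    by (rule nr_path_splitE')
  have "alt P = P \<longleftrightarrow> p2 = []"
  proof
    assume "alt P = P"
    then have eq: "rev (map compl p2) = p2" using p(1,4) by simp
    show "p2 = []"
    proof (rule ccontr)
      assume "p2 \<noteq> []"
      then have "last p2 \<in> set p2" by simp
      then have "compl (last p2) \<in> set (rev (map compl p2))" by simp
      then have "compl (last p2) \<in> set p2" unfolding eq .
      with \<open>last p2 \<in> set p2\<close> p(3) show False unfolding regular_iff by auto
    qed
  next
    assume "p2 = []"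
    with p(4) have "alt P = p1 @ [compl w, w]" by simp
    also have "\<dots> = P" using p(1) \<open>p2 = []\<close> by simp
    finally show "alt P = P" .
  qed
  moreover have "last (butlast P) = compl w \<longleftrightarrow> p2 = []"
  proof
    assume *: "last (butlast P) = compl w"
    show "p2 = []"
    proof (rule ccontr)
      assume "p2 \<noteq> []"
      then have "last (butlast P) \<in> set p2" using p(1) by (simp add: butlast_append)
      with * p(1,2) show False by auto
    qed
  qed (simp add: p butlast_append)
  ultimately show ?thesis using p(1) by simp
qed

end

lemma first_difference:
  assumes "\<And>r. Q \<noteq> P @ r" "\<And>r. P \<noteq> Q @ r"
  shows "\<exists>r a b P' Q'. P = r @ a # P' \<and> Q = r @ b # Q' \<and> a \<noteq> b"
  using assms
proof (induction P arbitrary: Q)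
  case (Cons c P)
  from Cons.prems(2)[of "c # P"] obtain d Q1 where Q: "Q = d # Q1" by (cases Q) auto
  show ?case
  proof (cases "c = d")
    case True
    have "\<exists>r a b P' Q'. P = r @ a # P' \<and> Q1 = r @ b # Q' \<and> a \<noteq> b"
      using Cons.prems Q True by (intro Cons.IH) auto
    then obtain r a b P' Q' where "P = r @ a # P' \<and> Q1 = r @ b # Q' \<and> a \<noteq> b" by blast
    then have "c # P = (c # r) @ a # P' \<and> Q = (c # r) @ b # Q' \<and> a \<noteq> b" using Q True by simp
    then show ?thesis by blast
  next
    case False
    then show ?thesis using Q by (intro exI[of _ "[]"]) auto
  qed
next
  case Nil
  from Nil(1)[of Q] show ?case by simp
qed

text \<open>Since both paths start at \<open>x\<close>, the common part is nonempty;
  \<open>y\<close> is its last vertex, the point of separation.\<close>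

lemma nr_path_difference:
  assumes P: "nr_path A x P" and Q: "nr_path B x Q" and "P \<noteq> Q"
  obtains r y a b P' Q' where "P = r @ y # a # P'" "Q = r @ y # b # Q'" "a \<noteq> b"
proof -
  have "\<exists>r a b P' Q'. P = r @ a # P' \<and> Q = r @ b # Q' \<and> a \<noteq> b"
  proof (rule first_difference)
    show "Q \<noteq> P @ r" for r using nr_path_prefix_eq[OF P Q, of r] \<open>P \<noteq> Q\<close> by auto
    show "P \<noteq> Q @ r" for r using nr_path_prefix_eq[OF Q P, of r] \<open>P \<noteq> Q\<close> by auto
  qed
  then obtain r a b P' Q' where *: "P = r @ a # P'" "Q = r @ b # Q'" "a \<noteq> b" by blast
  have "r \<noteq> []" using * nr_path_hd[OF P] nr_path_hd[OF Q] by (cases r) auto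
  then obtain s y where "r = s @ [y]" by (metis rev_exhaust)
  with * that[of s y a _ b] show thesis by simp
qed

text \<open>The clause of the arc \<open>(y, b)\<close> of \<open>Q\<close> must come from
  \<open>P\<close> too. It does not come from \<open>(y, b)\<close> itself, as \<open>P\<close>
  visits \<open>y\<close> only once and leaves it by \<open>a\<close>. So the contraposition lies on
  \<open>P\<close>, and \<open>compl y\<close> can only be the last vertex, because \<open>y\<close>
  is among the earlier ones.\<close>

lemma fibre_difference:
  assumes P: "nr_path A x P" and Q: "nr_path B x Q" and eq: "F_of P = F_of Q"
    and PQ: "P = r @ y # a # P'" "Q = r @ y # b # Q'" "a \<noteq> b"
  shows "\<exists>s. P = s @ [compl b, compl y]"
proof -
  have dist: "distinct P" "distinct Q" using P Q by (auto simp: nr_path_def)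
  have "(y, b) \<in> set (vwalk_arcs Q)"
    unfolding PQ(2) by (cases "r = []") (auto simp: vwalk_arcs_append)
  then have "{compl y, b} \<in> F_of Q" by (simp add: F_of_def mem_CL)
  then have "{compl y, b} \<in> F_of P" by (simp only: eq)
  \<comment> \<open>The unit-clause of the start vertex is no substitute: then \<open>Q\<close>
    would return to its start.\<close>
  moreover have "{compl y, b} \<noteq> {hd P}"
  proof
    assume "{compl y, b} = {hd P}"
    then have "b = hd Q" using nr_path_hd[OF P] nr_path_hd[OF Q] by auto
    then show False using dist(2) PQ(2) by (cases r) auto
  qed
  ultimately have "(y, b) \<in> set (vwalk_arcs P) \<or> (compl b, compl y) \<in> set (vwalk_arcs P)"
    unfolding F_of_def Un_iff mem_CL singleton_iff by blast
  then show ?thesis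
  proof
    assume "(y, b) \<in> set (vwalk_arcs P)"
    then obtain p q where "P = p @ y # b # q" by (rule mem_vwalk_arcsE)
    then have "b = a" using dist(1) PQ(1) append_Cons_eq_iff[of y p "b # q" r "a # P'"] by auto
    with PQ(3) show ?thesis by simp
  next
    assume "(compl b, compl y) \<in> set (vwalk_arcs P)"
    then obtain p q where p: "P = p @ compl b # compl y # q" by (rule mem_vwalk_arcsE)
    from P obtain q0 w where w: "P = q0 @ [w]" "regular q0" by (auto elim: nr_pathE)
    have "y \<in> set q0"
    proof -
      have "butlast P = r @ y # butlast (a # P')" unfolding PQ(1) by (simp add: butlast_append)
      then show ?thesis using w(1) by simp
    qed
    have "q = []"
    proof (rule ccontr)
      assume "q \<noteq> []"
      then have "butlast P = p @ compl b # compl y # butlast q" unfolding p by (simp add: butlast_append)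
      then have "compl y \<in> set q0" using w(1) by simp
      with \<open>y \<in> set q0\<close> w(2) show False unfolding regular_iff by blast
    qed
    with p show ?thesis by simp
  qed
qed

text \<open>A third path \<open>Q\<close> ends in the complement of the vertex where it leaves
  \<open>P\<close>, and likewise for \<open>alt P\<close>. These vertices therefore coincide, yet at
  this vertex \<open>Q\<close> and \<open>alt P\<close> both continue with \<open>b\<close>.\<close>

lemma fibre:
  assumes skew: "skew A" and P: "nr_path A x P" and Q: "nr_path A x Q" and eq: "F_of Q = F_of P"
  shows "Q = P \<or> Q = alt P"
proof (rule ccontr)
  assume "\<not> (Q = P \<or> Q = alt P)"
  then have neq: "P \<noteq> Q" "Q \<noteq> alt P" by auto
  note aP = nr_path_alt[OF skew P] F_of_alt[OF skew P]
  from nr_path_difference[OF P Q neq(1)] obtain r y a b P' Q' where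
    d: "P = r @ y # a # P'" "Q = r @ y # b # Q'" "a \<noteq> b" .
  from fibre_difference[OF P Q eq[symmetric] d] obtain s where s: "P = s @ [compl b, compl y]" by blast
  \<comment> \<open>The situation is symmetric in \<open>P\<close> and \<open>Q\<close>, so both
    paths end in \<open>compl y\<close>.\<close>
  have lQ: "last Q = compl y"
    using fibre_difference[OF Q P eq d(2,1)] d(3) by auto
  from nr_path_difference[OF Q aP(1) neq(2)] obtain r' y' c e Q'' P'' where
    d': "Q = r' @ y' # c # Q''" "alt P = r' @ y' # e # P''" "c \<noteq> e" .
  from fibre_difference[OF Q aP(1) _ d'] eq aP(2) obtain s' where "Q = s' @ [compl e, compl y']" by auto
  with lQ have "y' = y" by simp
  have "distinct Q" using Q by (simp add: nr_path_def)
  then have c: "c = b" "r' = r"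
    using d(2) d'(1) \<open>y' = y\<close> append_Cons_eq_iff[of y r "b # Q'" r' "c # Q''"] by auto
  from P obtain p1 p2 w where p: "P = p1 @ compl w # p2 @ [w]" "distinct P"
    "alt P = p1 @ compl w # rev (map compl p2) @ [w]" by (rule nr_path_splitE')
  have w: "w = compl y" using p(1) s by simp
  then have "p1 = r" "p2 @ [w] = a # P'"
    using p(1,2) d(1) append_Cons_eq_iff[of y p1 "p2 @ [w]" r "a # P'"] by auto
  \<comment> \<open>If \<open>p2\<close> is empty, the last arc of \<open>P\<close> is a unit and
    \<open>a\<close> and \<open>b\<close> are both \<open>compl y\<close>. Otherwise the last inner
    vertex of \<open>P\<close> is \<open>compl b\<close>, so contraposition lets
    \<open>alt P\<close> go from \<open>y\<close> to \<open>b\<close>.\<close>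
  show False
  proof (cases p2 rule: rev_cases)
    case Nil
    then have "P = (p1 @ [y]) @ [compl y]" using p(1) w by simp
    moreover have "P = (s @ [compl b]) @ [compl y]" using s by simp
    ultimately have "p1 @ [y] = s @ [compl b]" by (simp only: append_same_eq)
    then have "compl b = y" by simp
    moreover have "a = compl y" using \<open>p2 @ [w] = a # P'\<close> Nil w by simp
    ultimately show False using d(3) by auto
  next
    case (snoc p3 z)
    then have "P = (p1 @ compl w # p3 @ [z]) @ [compl y]" using p(1) w by simp
    moreover have "P = (s @ [compl b]) @ [compl y]" using s by simp
    ultimately have "p1 @ compl w # p3 @ [z] = s @ [compl b]" by (simp only: append_same_eq)
    then have "z = compl b" using arg_cong[of _ _ last] by fastforce
    then have "alt P = r @ y # b # rev (map compl p3) @ [w]" using p(3) snoc w \<open>p1 = r\<close> by simp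
    then show False using d'(2,3) \<open>y' = y\<close> c by simp
  qed
qed

section \<open>The orders\<close>

text \<open>The condition under which OUTPUT prints; the first alternative is the case of a final
  unit arc.\<close>

definition good :: "'v lit rel \<Rightarrow> 'v lit list \<Rightarrow> bool" where
  "good L P \<longleftrightarrow> alt P = P \<or> pathlex L P (alt P)"

context
  fixes V :: "'v lit set" and L :: "'v lit rel"
  assumes lin: "linear_order_on V L"
begin

lemma strict_asym: "asym (L - Id)"
  using lin unfolding order_on_defs by (auto simp: antisym_def intro!: asymI)

lemma strict_total: "a \<in> V \<Longrightarrow> b \<in> V \<Longrightarrow> a \<noteq> b \<Longrightarrow> (a, b) \<in> L - Id \<or> (b, a) \<in> L - Id"
  using lin unfolding order_on_defs total_on_def by auto

lemma pathlex_asym: "pathlex L P Q \<Longrightarrow> \<not> pathlex L Q P"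
  using lexord_asym[OF strict_asym] unfolding pathlex_def by (auto dest: asymD)

lemma pathlex_irrefl: "\<not> pathlex L P P"
  using pathlex_asym by blast

lemma pathlex_differ: "(a, b) \<in> L - Id \<Longrightarrow> pathlex L (r @ a # P) (r @ b # Q)"
  unfolding pathlex_def by (intro lexord_append_leftI) simp

lemma nr_path_vertices:
  assumes "nr_path A x P" "A \<subseteq> V \<times> V"
  shows "set P \<subseteq> V"
proof -
  from assms obtain q w where q: "P = q @ [w]" "q \<noteq> []" "set (vwalk_arcs P) \<subseteq> A" by (rule_tac nr_pathE)
  then have "length P \<ge> 2" by (cases q) auto
  with q(3) assms(2) show ?thesis by (rule_tac vertices_of_arcs)
qed

lemma pathlex_total:
  assumes P: "nr_path A x P" and Q: "nr_path A x Q" and "A \<subseteq> V \<times> V" "P \<noteq> Q"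
  shows "pathlex L P Q \<or> pathlex L Q P"
proof -
  from nr_path_difference[OF P Q \<open>P \<noteq> Q\<close>] obtain r y a b P' Q' where
    d: "P = r @ y # a # P'" "Q = r @ y # b # Q'" "a \<noteq> b" .
  then have "a \<in> V" "b \<in> V"
    using nr_path_vertices[OF P] nr_path_vertices[OF Q] assms(3) by auto
  from strict_total[OF this d(3)] show ?thesis
    using pathlex_differ[of a b "r @ [y]" P' Q'] pathlex_differ[of b a "r @ [y]" Q' P'] d(1,2) by auto
qed

lemma finite_least:
  assumes "finite S" "S \<noteq> {}" "S \<subseteq> V"
  shows "\<exists>m\<in>S. \<forall>y\<in>S. (m, y) \<in> L"
  using assms
proof (induction S rule: finite_ne_induct)
  case (singleton x)
  then show ?case using lin unfolding order_on_defs refl_on_def by auto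
next
  case (insert x S)
  then obtain m where m: "m \<in> S" "\<forall>y\<in>S. (m, y) \<in> L" by auto
  have refl: "(x, x) \<in> L" using lin insert.prems unfolding order_on_defs refl_on_def by auto
  have trans: "trans L" using lin unfolding order_on_defs by auto
  show ?case
  proof (cases "(x, m) \<in> L")
    case True
    then have "\<forall>y\<in>insert x S. (x, y) \<in> L" using m refl trans by (auto dest: transD)
    then show ?thesis by blast
  next
    case False
    then have "(m, x) \<in> L" using strict_total[of x m] insert.prems m(1) refl by auto
    then show ?thesis using m by auto
  qed
qed

end

section \<open>The path belonging to a minimally unsatisfiable subset\<close>

lemma mem_remaining: "{y} \<in> remaining L F x \<longleftrightarrow> {y} \<in> F \<and> \<not> ((y, x) \<in> L \<and> y \<noteq> x)"
  by (auto simp: remaining_def)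

lemma remaining_subset: "remaining L F x \<subseteq> F"
  by (auto simp: remaining_def)

lemma idg_mono: "F \<subseteq> G \<Longrightarrow> parcs (idg F) \<subseteq> parcs (idg G)"
  by (auto simp: mem_idg)

definition all_paths :: "'v lit rel \<Rightarrow> 'v clause set \<Rightarrow> 'v lit list set" where
  "all_paths L F = (\<Union>x \<in> {x. {x} \<in> F}. NR x (idg (remaining L F x)))"

context
  fixes F :: "'v clause set" and L :: "'v lit rel"
  assumes F: "clause_set F" and card: "\<forall>C\<in>F. card C = 1 \<or> card C = 2"
    and lin: "linear_order_on (lits F) L"
begin

text \<open>The unit-clause under treatment is recovered from the path as its first vertex.\<close>

lemma mem_all_paths: "P \<in> all_paths L F \<longleftrightarrow> {hd P} \<in> F \<and> nr_path (parcs (idg (remaining L F (hd P)))) (hd P) P"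
  unfolding all_paths_def using nr_path_hd by (auto simp: NR_iff)

lemma unit_in_lits: "{x} \<in> F \<Longrightarrow> x \<in> lits F"
  by (force simp: lits_def vars_def)

text \<open>Smaller unit-clauses have been removed before \<open>hd P\<close> is treated, which is
  what makes \<open>hd P\<close> the least unit of \<open>F_of P\<close>. The last fact returns to
  the full digraph, where \<open>path_of\<close> is defined.\<close>

lemma all_paths_facts:
  assumes "P \<in> all_paths L F"
  shows "F_of P \<subseteq> remaining L F (hd P)" "min_unsat (F_of P)" "min_unit L (F_of P) = hd P"
    "nr_path (parcs (idg F)) (hd P) P"
proof -
  let ?x = "hd P"
  from assms have x: "{?x} \<in> F" and P: "nr_path (parcs (idg (remaining L F ?x))) ?x P"
    by (auto simp: mem_all_paths)
  show sub: "F_of P \<subseteq> remaining L F ?x"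
    using P x by (intro F_of_subset) (auto simp: nr_path_def mem_remaining)
  show "min_unsat (F_of P)" using F_of_min_unsat[OF P] .
  show "nr_path (parcs (idg F)) ?x P"
    using nr_path_mono[OF idg_mono[OF remaining_subset] P] .
  show "min_unit L (F_of P) = ?x"
    unfolding min_unit_def
  proof (rule the_equality)
    have "{?x} \<in> F_of P" by (simp add: F_of_def)
    moreover have "(?x, y) \<in> L" if "{y} \<in> F_of P" for y
    proof -
      from that sub have y: "{y} \<in> F" "\<not> ((y, ?x) \<in> L \<and> y \<noteq> ?x)" by (auto simp: mem_remaining)
      have "y \<in> lits F" "?x \<in> lits F" using y x unit_in_lits by auto
      with y(2) strict_total[OF lin, of ?x y] show ?thesis
        using lin unfolding order_on_defs refl_on_def by auto
    qed
    ultimately show *: "{?x} \<in> F_of P \<and> (\<forall>y. {y} \<in> F_of P \<longrightarrow> (?x, y) \<in> L)" by blast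
    fix z assume "{z} \<in> F_of P \<and> (\<forall>y. {y} \<in> F_of P \<longrightarrow> (z, y) \<in> L)"
    with * have "(z, ?x) \<in> L" "(?x, z) \<in> L" by auto
    then show "z = ?x" using lin unfolding order_on_defs antisym_def by auto
  qed
qed

lemma alt_all_paths: "P \<in> all_paths L F \<Longrightarrow> alt P \<in> all_paths L F"
  using nr_path_alt[OF skew_idg] nr_path_hd unfolding mem_all_paths by metis

lemma alt_alt_all_paths: "P \<in> all_paths L F \<Longrightarrow> alt (alt P) = P"
  using alt_alt[OF skew_idg] unfolding mem_all_paths by blast

lemma F_of_alt_all_paths: "P \<in> all_paths L F \<Longrightarrow> F_of (alt P) = F_of P"
  using F_of_alt[OF skew_idg] unfolding mem_all_paths by blast

lemma all_paths_total:
  assumes "P \<in> all_paths L F" "alt P \<noteq> P"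
  shows "pathlex L P (alt P) \<or> pathlex L (alt P) P"
proof -
  note P = all_paths_facts(4)[OF assms(1)]
  show ?thesis
    using pathlex_total[OF lin P nr_path_alt[OF skew_idg P] idg_arcs_lits] assms(2) by auto
qed

text \<open>In the full digraph only \<open>P\<close> and \<open>alt P\<close> have this clause-set
  and start at the least unit, and \<open>good\<close> says that \<open>P\<close> is the smaller
  one.\<close>

lemma path_of_good:
  assumes P: "P \<in> all_paths L F" and good: "good L P"
  shows "path_of L F (F_of P) = P"
proof -
  note nr = all_paths_facts(4)[OF P]
  show ?thesis
    unfolding path_of_def all_paths_facts(3)[OF P] NR_iff
  proof (rule the_equality)
    have "pathlex L P Q" if "nr_path (parcs (idg F)) (hd P) Q" "F_of Q = F_of P \<and> Q \<noteq> P" for Q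
      using fibre[OF skew_idg nr that(1)] that(2) good by (auto simp: good_def)
    then show *: "nr_path (parcs (idg F)) (hd P) P \<and> F_of P = F_of P \<and>
      (\<forall>Q\<in>NR (hd P) (idg F). F_of Q = F_of P \<and> Q \<noteq> P \<longrightarrow> pathlex L P Q)"
      using nr by (simp add: NR_iff)
    fix Q assume Q: "nr_path (parcs (idg F)) (hd P) Q \<and> F_of Q = F_of P \<and>
      (\<forall>R\<in>NR (hd P) (idg F). F_of R = F_of P \<and> R \<noteq> Q \<longrightarrow> pathlex L Q R)"
    show "Q = P"
    proof (rule ccontr)
      assume "Q \<noteq> P"
      then have "pathlex L P Q" "pathlex L Q P" using Q * nr by (auto simp: NR_iff)
      then show False using pathlex_asym[OF lin] by blast
    qed
  qed
qed

text \<open>A minimally unsatisfiable \<open>F'\<close> is caught when its least unit is treated: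
  all of \<open>F'\<close> is then still present. If the path found for it is not the one to be
  printed, its partner is.\<close>

lemma min_unsat_subsets:
  "{F'. F' \<subseteq> F \<and> min_unsat F' \<and> (\<exists>z. {z} \<in> F')} = F_of ` {P \<in> all_paths L F. good L P}"
proof (intro equalityI subsetI)
  fix F' assume "F' \<in> {F'. F' \<subseteq> F \<and> min_unsat F' \<and> (\<exists>z. {z} \<in> F')}"
  then have F': "F' \<subseteq> F" "min_unsat F'" "{z. {z} \<in> F'} \<noteq> {}" by auto
  have "{z. {z} \<in> F'} \<subseteq> (\<lambda>C. THE z. C = {z}) ` F" using F'(1) by (auto intro!: image_eqI)
  then have "finite {z. {z} \<in> F'}" using F by (auto simp: clause_set_def intro: finite_subset)
  moreover have "{z. {z} \<in> F'} \<subseteq> lits F" using F'(1) unit_in_lits by auto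
  ultimately obtain z where z: "{z} \<in> F'" "\<forall>y. {y} \<in> F' \<longrightarrow> (z, y) \<in> L"
    using finite_least[OF lin _ F'(3)] by auto
  obtain P where P: "nr_path (parcs (idg F')) z P" "F_of P = F'"
    using min_unsat_F_of[OF F'(2) z(1)] card F'(1) by blast
  have "F' \<subseteq> remaining L F z"
  proof
    fix C assume C: "C \<in> F'"
    have "C \<noteq> {y}" if "(y, z) \<in> L \<and> y \<noteq> z" for y
    proof
      assume "C = {y}"
      with C z(2) have "(z, y) \<in> L" by auto
      with that show False using lin unfolding order_on_defs antisym_def by auto
    qed
    with C F'(1) show "C \<in> remaining L F z" unfolding remaining_def by blast
  qed
  then have "nr_path (parcs (idg (remaining L F z))) z P"
    using nr_path_mono[OF idg_mono P(1)] by blast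
  then have all: "P \<in> all_paths L F"
    using F'(1) z(1) nr_path_hd[OF P(1)] unfolding mem_all_paths by auto
  show "F' \<in> F_of ` {P \<in> all_paths L F. good L P}"
  proof (cases "good L P")
    case True
    with all P(2) show ?thesis by blast
  next
    case False
    then have "good L (alt P)"
      using all_paths_total[OF all] alt_alt_all_paths[OF all] by (auto simp: good_def)
    then show ?thesis using alt_all_paths[OF all] F_of_alt_all_paths[OF all] P(2) by blast
  qed
next
  fix F' assume "F' \<in> F_of ` {P \<in> all_paths L F. good L P}"
  then obtain P where P: "P \<in> all_paths L F" "F' = F_of P" by blast
  have "{hd P} \<in> F_of P" by (simp add: F_of_def)
  then show "F' \<in> {F'. F' \<subseteq> F \<and> min_unsat F' \<and> (\<exists>z. {z} \<in> F')}"
    using all_paths_facts(1,2)[OF P(1)] remaining_subset[of L F] P(2) by blast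
qed

text \<open>A path that is not printed has been preceded by its printed partner.\<close>
lemma bad_le_good:
  assumes sorted: "sorted_wrt (pathlex L) Ps" and set: "set Ps = all_paths L F"
  shows "length (filter (\<lambda>P. \<not> good L P) (take k Ps)) \<le> length (filter (good L) (take k Ps))"
proof -
  have dist: "distinct Ps"
    using sorted by (induction Ps) (auto simp: pathlex_irrefl[OF lin])
  let ?T = "set (take k Ps)"
  have T: "?T \<subseteq> all_paths L F" using set set_take_subset by fastforce
  have "alt P \<in> {P \<in> ?T. good L P}" if P: "P \<in> {P \<in> ?T. \<not> good L P}" for P
  proof -
    have all: "P \<in> all_paths L F" using P T by auto
    with P have less: "pathlex L (alt P) P" using all_paths_total[OF all] by (auto simp: good_def)
    have "alt P \<in> set Ps" using alt_all_paths[OF all] set by simp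
    moreover have "alt P \<notin> set (drop k Ps)"
    proof
      assume "alt P \<in> set (drop k Ps)"
      moreover have "sorted_wrt (pathlex L) (take k Ps @ drop k Ps)" using sorted by simp
      ultimately have "pathlex L P (alt P)" using P unfolding sorted_wrt_append by blast
      with less pathlex_asym[OF lin] show False by blast
    qed
    ultimately have "alt P \<in> ?T" by (metis Un_iff append_take_drop_id set_append)
    moreover have "good L (alt P)" using less alt_alt_all_paths[OF all] by (simp add: good_def)
    ultimately show ?thesis by simp
  qed
  moreover have "inj_on alt {P \<in> ?T. \<not> good L P}"
    using alt_alt_all_paths T by (intro inj_on_inverseI[of _ alt]) auto
  ultimately have "Finite_Set.card {P \<in> ?T. \<not> good L P} \<le> Finite_Set.card {P \<in> ?T. good L P}"
    by (intro card_inj_on_le) auto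
  moreover have "length (filter p (take k Ps)) = Finite_Set.card {P \<in> ?T. p P}" for p
    using distinct_card[of "filter p (take k Ps)"] dist by simp
  ultimately show ?thesis by simp
qed

end

section \<open>Delays of the printed clause-sets\<close>

text \<open>The delays of the printed clause-sets, measured in delivered paths instead of steps.\<close>
fun gap_counts :: "'v event list \<Rightarrow> nat list" where
  "gap_counts [] = [0]"
| "gap_counts (Step s # tr) = gap_counts tr"
| "gap_counts (Delivered P # tr) = Suc (hd (gap_counts tr)) # tl (gap_counts tr)"
| "gap_counts (Printed F # tr) = 0 # gap_counts tr"

fun is_step :: "'v event \<Rightarrow> bool" where
  "is_step (Step s) = True"
| "is_step (Delivered P) = False"
| "is_step (Printed F) = False"

abbreviation outputs :: "'v event list \<Rightarrow> 'v event list" where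
  "outputs tr \<equiv> filter (\<lambda>e. \<not> is_step e) tr"

lemma event_simps [simp]:
  "\<not> is_delivered (Step s)" "is_delivered (Delivered P)" "\<not> is_delivered (Printed F)"
  "\<not> is_printed (Step s)" "\<not> is_printed (Delivered P)" "is_printed (Printed F)"
  by (simp_all add: is_delivered_def is_printed_def)

lemma gap_counts_outputs: "gap_counts (outputs tr) = gap_counts tr"
  by (induction tr rule: gap_counts.induct) auto

lemma delivered_outputs: "delivered (outputs tr) = delivered tr"
  by (induction tr rule: delivered.induct) auto

lemma printed_outputs: "printed (outputs tr) = printed tr"
  by (induction tr rule: printed.induct) auto

lemma delays_nonempty: "delays p tr \<noteq> []"
  by (induction tr) (auto split: event.split)

lemma gap_counts_nonempty: "gap_counts tr \<noteq> []"
  by (induction tr rule: gap_counts.induct) auto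

text \<open>The \<open>c\<close> deliveries inside a gap between printings cut it into
  \<open>c + 1\<close> pieces, each contained in a gap between deliveries.\<close>

lemma printed_delays:
  assumes "\<forall>d\<in>set (delays is_delivered tr). d \<le> D"
  shows "list_all2 (\<lambda>d c. d \<le> D * Suc c) (delays is_printed tr) (gap_counts tr)"
proof -
  \<comment> \<open>The first gap is still open to the left during the induction and grows with the
    first delivery gap, so it is compared with that gap instead of with \<open>D\<close>.\<close>
  have "hd (delays is_printed tr) \<le> hd (delays is_delivered tr) + D * hd (gap_counts tr) \<and>
    list_all2 (\<lambda>d c. d \<le> D * Suc c) (tl (delays is_printed tr)) (tl (gap_counts tr))"
    using assms
  proof (induction tr rule: gap_counts.induct)
    case (2 s tr)
    obtain d ds where "delays is_delivered tr = d # ds" using delays_nonempty by (cases "delays is_delivered tr") auto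
    with 2 show ?case by simp
  next
    case (3 P tr)
    obtain d ds where "delays is_delivered tr = d # ds" using delays_nonempty by (cases "delays is_delivered tr") auto
    with 3 show ?case by auto
  next
    case (4 F tr)
    obtain d ds where d: "delays is_delivered tr = d # ds" using delays_nonempty by (cases "delays is_delivered tr") auto
    obtain e es where e: "delays is_printed tr = e # es" using delays_nonempty by (cases "delays is_printed tr") auto
    obtain c cs where c: "gap_counts tr = c # cs" using gap_counts_nonempty by (cases "gap_counts tr") auto
    from 4 d e c show ?case by simp
  qed simp
  moreover have "hd (delays is_delivered tr) \<le> D" using assms hd_in_set[OF delays_nonempty] by blast
  moreover obtain e es where "delays is_printed tr = e # es" using delays_nonempty by (cases "delays is_printed tr") auto
  moreover obtain c cs where "gap_counts tr = c # cs" using gap_counts_nonempty by (cases "gap_counts tr") auto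
  ultimately show ?thesis by simp
qed

definition path_events :: "('v lit list \<Rightarrow> bool) \<Rightarrow> 'v lit list \<Rightarrow> 'v event list" where
  "path_events p P = Delivered P # (if p P then [Printed (F_of P)] else [])"

lemma delivered_path_events: "delivered (concat (map (path_events p) Ps)) = Ps"
  by (induction Ps) (auto simp: path_events_def)

lemma printed_path_events: "printed (concat (map (path_events p) Ps)) = map F_of (filter p Ps)"
  by (induction Ps) (auto simp: path_events_def)

text \<open>\<open>a\<close> is a credit of unprinted paths: every printed path raises it by one and
  every skipped path consumes one. The final \<open>1\<close> is the delivery of the path that is
  printed at the end of the gap.\<close>

lemma gap_counts_path_events:
  assumes "\<And>k. length (filter (\<lambda>P. \<not> p P) (take k Ps)) \<le> length (filter p (take k Ps)) + a"
    "m < length (gap_counts (concat (map (path_events p) Ps)))"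
  shows "gap_counts (concat (map (path_events p) Ps)) ! m \<le> m + a + 1"
  using assms
proof (induction Ps arbitrary: a m)
  case (Cons P Ps)
  let ?c = "gap_counts (concat (map (path_events p) Ps))"
  obtain c cs where c: "?c = c # cs" using gap_counts_nonempty by (cases ?c) auto
  show ?case
  proof (cases "p P")
    case True
    have IH: "?c ! m' \<le> m' + Suc a + 1" if "m' < length ?c" for m'
      by (rule Cons.IH) (use Cons.prems(1)[of "Suc _"] True that in auto)
    from True have eq: "gap_counts (concat (map (path_events p) (P # Ps))) = 1 # ?c"
      by (simp add: path_events_def)
    show ?thesis
    proof (cases m)
      case (Suc m')
      with IH[of m'] Cons.prems(2) eq show ?thesis by simp
    qed (use eq in simp)
  next
    case False
    with Cons.prems(1)[of 1] obtain a' where a: "a = Suc a'" by (cases a) auto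
    have IH: "?c ! m' \<le> m' + a' + 1" if "m' < length ?c" for m'
      by (rule Cons.IH) (use Cons.prems(1)[of "Suc _"] False that a in auto)
    from False have eq: "gap_counts (concat (map (path_events p) (P # Ps))) = Suc c # cs"
      using c by (simp add: path_events_def)
    show ?thesis
    proof (cases m)
      case 0
      with IH[of 0] c eq a show ?thesis by simp
    next
      case (Suc m')
      with IH[of m] Cons.prems(2) eq c a show ?thesis by simp
    qed
  qed
qed simp

section \<open>Silent commands\<close>

fun wr_regs :: "com \<Rightarrow> reg set" where
  "wr_regs (SetR r a) = {r}"
| "wr_regs (Seq c1 c2) = wr_regs c1 \<union> wr_regs c2"
| "wr_regs (Cond b c1 c2) = wr_regs c1 \<union> wr_regs c2"
| "wr_regs (While b c) = wr_regs c"
| "wr_regs _ = {}"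

fun wr_lvars :: "com \<Rightarrow> lvar set" where
  "wr_lvars (SetS i k) = {i}"
| "wr_lvars (Seq c1 c2) = wr_lvars c1 \<union> wr_lvars c2"
| "wr_lvars (Cond b c1 c2) = wr_lvars c1 \<union> wr_lvars c2"
| "wr_lvars (While b c) = wr_lvars c"
| "wr_lvars _ = {}"

fun wr_tabs :: "com \<Rightarrow> table set" where
  "wr_tabs (SetT t a k) = {t}"
| "wr_tabs (Seq c1 c2) = wr_tabs c1 \<union> wr_tabs c2"
| "wr_tabs (Cond b c1 c2) = wr_tabs c1 \<union> wr_tabs c2"
| "wr_tabs (While b c) = wr_tabs c"
| "wr_tabs _ = {}"

text \<open>A frame condition computed from the program text. The consequence and loop rules supply
  it for free, so that specifications need only mention what changes.\<close>

definition same :: "com \<Rightarrow> 'v store \<Rightarrow> 'v store \<Rightarrow> bool" where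
  "same c s t \<longleftrightarrow> (\<forall>r. r \<notin> wr_regs c \<longrightarrow> regs t r = regs s r) \<and>
     (\<forall>i. i \<notin> wr_lvars c \<longrightarrow> lvars t i = lvars s i) \<and>
     (\<forall>tb. tb \<notin> wr_tabs c \<longrightarrow> tables t tb = tables s tb)"

lemma same_refl: "same c s s"
  by (simp add: same_def)

lemma same_trans: "same c s t \<Longrightarrow> same c t u \<Longrightarrow> same c s u"
  by (simp add: same_def)

lemma exec_same: "exec c s tr t \<Longrightarrow> same c s t"
  by (induction rule: exec.induct) (auto simp: same_def)

text \<open>The postcondition also receives the number of steps, counted from \<open>n\<close>, and \<open>I\<close> holds after every step.\<close>
definition wps :: "('v store \<Rightarrow> bool) \<Rightarrow> com \<Rightarrow> ('v store \<Rightarrow> nat \<Rightarrow> bool) \<Rightarrow> 'v store \<Rightarrow> nat \<Rightarrow> bool" where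
  "wps I c Q s n \<longleftrightarrow> (\<exists>tr t. exec c s tr t \<and> (\<forall>e\<in>set tr. \<exists>s'. e = Step s' \<and> I s') \<and> Q t (n + length tr))"

lemma wpsE:
  assumes "wps I c Q s n"
  obtains tr t where "exec c s tr t" "\<forall>e\<in>set tr. \<exists>s'. e = Step s' \<and> I s'" "Q t (n + length tr)"
  using assms by (auto simp: wps_def)

lemma exec_inv:
  "exec c s tr t \<Longrightarrow> \<forall>e\<in>set tr. \<exists>s'. e = Step s' \<and> I s' \<Longrightarrow> I t"
  by (induction rule: exec.induct) auto

lemma wps_SetR [simp]: "wps I (r :=\<^sub>R a) Q s n \<longleftrightarrow>
    (let s' = s\<lparr>regs := (regs s)(r := lval a s)\<rparr> in I s' \<and> Q s' (Suc n))"
  unfolding wps_def Let_def by (force elim: SetRE intro: exec.SetR)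

lemma wps_SetS [simp]: "wps I (i :=\<^sub>S k) Q s n \<longleftrightarrow>
    (let s' = s\<lparr>lvars := (lvars s)(i := sval k s)\<rparr> in I s' \<and> Q s' (Suc n))"
  unfolding wps_def Let_def by (force elim: SetSE intro: exec.SetS)

lemma wps_SetT [simp]: "wps I (t\<lbrakk>a\<rbrakk> :=\<^sub>T k) Q s n \<longleftrightarrow>
    (let s' = s\<lparr>tables := (tables s)(t := (tables s t)(lval a s := sval k s))\<rparr> in I s' \<and> Q s' (Suc n))"
  unfolding wps_def Let_def by (force elim: SetTE intro: exec.SetT)

lemma wps_Skip [simp]: "wps I Skip Q s n \<longleftrightarrow> I s \<and> Q s (Suc n)"
  unfolding wps_def by (force elim: SkipE intro: exec.Skip)

lemma wps_Seq [simp]: "wps I (c1 ;; c2) Q s n \<longleftrightarrow> wps I c1 (wps I c2 Q) s n"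
proof
  assume "wps I (c1 ;; c2) Q s n"
  then obtain tr t where *: "exec (c1 ;; c2) s tr t" "\<forall>e\<in>set tr. \<exists>s'. e = Step s' \<and> I s'"
    "Q t (n + length tr)" by (rule wpsE)
  from *(1) show "wps I c1 (wps I c2 Q) s n"
  proof (rule SeqE)
    fix tr1 s1 tr2
    assume e: "tr = tr1 @ tr2" "exec c1 s tr1 s1" "exec c2 s1 tr2 t"
    with * have "wps I c2 Q s1 (n + length tr1)" unfolding wps_def
      by (intro exI[of _ tr2] exI[of _ t]) (auto simp: add.assoc)
    with e * show ?thesis unfolding wps_def[of I c1]
      by (intro exI[of _ tr1] exI[of _ s1]) auto
  qed
next
  assume "wps I c1 (wps I c2 Q) s n"
  then obtain tr1 s1 where 1: "exec c1 s tr1 s1" "\<forall>e\<in>set tr1. \<exists>s'. e = Step s' \<and> I s'"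
    "wps I c2 Q s1 (n + length tr1)" by (rule wpsE)
  from 1(3) obtain tr2 t where 2: "exec c2 s1 tr2 t" "\<forall>e\<in>set tr2. \<exists>s'. e = Step s' \<and> I s'"
    "Q t (n + length tr1 + length tr2)" by (rule wpsE)
  from 1 2 exec.Seq[OF 1(1) 2(1)] show "wps I (c1 ;; c2) Q s n" unfolding wps_def
    by (intro exI[of _ "tr1 @ tr2"] exI[of _ t]) (auto simp: add.assoc)
qed

lemma wps_Cond: "wps I (IF b THEN c1 ELSE c2) Q s n \<longleftrightarrow>
    I s \<and> (if bval b s then wps I c1 Q s (Suc n) else wps I c2 Q s (Suc n))"
proof
  assume "wps I (IF b THEN c1 ELSE c2) Q s n"
  then obtain tr t where *: "exec (IF b THEN c1 ELSE c2) s tr t" "\<forall>e\<in>set tr. \<exists>s'. e = Step s' \<and> I s'"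
    "Q t (n + length tr)" by (rule wpsE)
  from *(1) show "I s \<and> (if bval b s then wps I c1 Q s (Suc n) else wps I c2 Q s (Suc n))"
    by (rule CondE) (use * in \<open>auto simp: wps_def\<close>)
next
  assume *: "I s \<and> (if bval b s then wps I c1 Q s (Suc n) else wps I c2 Q s (Suc n))"
  show "wps I (IF b THEN c1 ELSE c2) Q s n"
  proof (cases "bval b s")
    case True
    with * obtain tr t where "exec c1 s tr t" "\<forall>e\<in>set tr. \<exists>s'. e = Step s' \<and> I s'"
      "Q t (Suc n + length tr)" by (auto elim: wpsE)
    with exec.IfTrue[OF True, of c1 tr t c2] * show ?thesis unfolding wps_def
      by (intro exI[of _ "Step s # tr"] exI[of _ t]) auto
  next
    case False
    with * obtain tr t where "exec c2 s tr t" "\<forall>e\<in>set tr. \<exists>s'. e = Step s' \<and> I s'"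
      "Q t (Suc n + length tr)" by (auto elim: wpsE)
    with exec.IfFalse[OF False, of c2 tr t c1] * show ?thesis unfolding wps_def
      by (intro exI[of _ "Step s # tr"] exI[of _ t]) auto
  qed
qed

lemma wps_conseq:
  assumes "wps I c Q s n" "\<And>t m. Q t m \<Longrightarrow> same c s t \<Longrightarrow> I t \<Longrightarrow> Q' t m"
  shows "wps I c Q' s n"
proof -
  from assms(1) obtain tr t where *: "exec c s tr t" "\<forall>e\<in>set tr. \<exists>s'. e = Step s' \<and> I s'"
    "Q t (n + length tr)" by (rule wpsE)
  with assms(2)[OF *(3) exec_same[OF *(1)] exec_inv[OF *(1,2)]] show ?thesis unfolding wps_def by blast
qed

lemma wps_While_False: "\<not> bval b s \<Longrightarrow> I s \<Longrightarrow> Q s (Suc n) \<Longrightarrow> wps I (WHILE b DO c) Q s n"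
  unfolding wps_def by (intro exI[of _ "[Step s]"] exI[of _ s]) (auto intro: exec.WhileFalse)

lemma wps_While_True:
  assumes "bval b s" "I s" "wps I c (wps I (WHILE b DO c) Q) s (Suc n)"
  shows "wps I (WHILE b DO c) Q s n"
proof -
  from assms(3) obtain tr1 s1 where 1: "exec c s tr1 s1" "\<forall>e\<in>set tr1. \<exists>s'. e = Step s' \<and> I s'"
    "wps I (WHILE b DO c) Q s1 (Suc n + length tr1)" by (rule wpsE)
  from 1(3) obtain tr2 t where 2: "exec (WHILE b DO c) s1 tr2 t" "\<forall>e\<in>set tr2. \<exists>s'. e = Step s' \<and> I s'"
    "Q t (Suc n + length tr1 + length tr2)" by (rule wpsE)
  from 1 2 assms exec.WhileTrue[OF assms(1) 1(1) 2(1)] show ?thesis unfolding wps_def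
    by (intro exI[of _ "Step s # tr1 @ tr2"] exI[of _ t]) (auto simp: add.assoc)
qed

text \<open>The first argument of \<open>J\<close> is the variant that ensures termination; the
  frame condition relative to the initial store and the space invariant need not be part of
  \<open>J\<close>.\<close>

lemma wps_While:
  fixes k :: nat and J :: "nat \<Rightarrow> 'v store \<Rightarrow> nat \<Rightarrow> bool"
  assumes "J k s n" "I s"
    and step: "\<And>k s' n'. J k s' n' \<Longrightarrow> same c s s' \<Longrightarrow> I s' \<Longrightarrow> bval b s' \<Longrightarrow>
      wps I c (\<lambda>t m. \<exists>k'<k. J k' t m) s' (Suc n')"
    and exit: "\<And>k s' n'. J k s' n' \<Longrightarrow> same c s s' \<Longrightarrow> I s' \<Longrightarrow> \<not> bval b s' \<Longrightarrow> Q s' (Suc n')"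
  shows "wps I (WHILE b DO c) Q s n"
proof -
  have "wps I (WHILE b DO c) Q s' n'" if "J k s' n'" "same c s s'" "I s'" for k :: nat and s' n'
    using that
  proof (induction k arbitrary: s' n' rule: less_induct)
    case (less k)
    show ?case
    proof (cases "bval b s'")
      case True
      show ?thesis
      proof (rule wps_While_True)
        show "bval b s'" "I s'" by fact+
        show "wps I c (wps I (WHILE b DO c) Q) s' (Suc n')"
          by (rule wps_conseq[OF step[OF less.prems True]])
            (use less.IH same_trans[OF less.prems(2)] in blast)
      qed
    qed (use less.prems exit in \<open>auto intro: wps_While_False\<close>)
  qed
  with assms(1,2) same_refl show ?thesis by blast
qed

section \<open>Length bounds for list variables and table cells, and the rule for traversing a
  list\<close>

definition lb :: "nat \<Rightarrow> (lvar \<Rightarrow> 'v lit list) \<Rightarrow> bool" where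
  "lb K f \<longleftrightarrow> (\<forall>i. length (f i) \<le> K)"

definition tb1 :: "('v lit \<Rightarrow> nat) \<Rightarrow> ('v lit \<Rightarrow> 'v lit list) \<Rightarrow> bool" where
  "tb1 c h \<longleftrightarrow> (\<forall>a. length (h a) \<le> c a)"

definition tb :: "(table \<Rightarrow> 'v lit \<Rightarrow> nat) \<Rightarrow> (table \<Rightarrow> 'v lit \<Rightarrow> 'v lit list) \<Rightarrow> bool" where
  "tb cap g \<longleftrightarrow> (\<forall>t. tb1 (cap t) (g t))"

text \<open>Bounds for single cells, and not merely for whole tables, are needed to get linear
  space. The layered form lets an assignment simplify to a single inequality on the updated
  list.\<close>

definition bounded :: "nat \<Rightarrow> (table \<Rightarrow> 'v lit \<Rightarrow> nat) \<Rightarrow> 'v store \<Rightarrow> bool" where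
  "bounded K cap s \<longleftrightarrow> lb K (lvars s) \<and> tb cap (tables s)"

lemma lb_upd [simp]: "lb K f \<Longrightarrow> lb K (f(i := xs)) \<longleftrightarrow> length xs \<le> K"
  by (auto simp: lb_def)

lemma lbD [simp]: "lb K f \<Longrightarrow> length (f i) \<le> K"
  by (auto simp: lb_def)

lemma lb_tl [simp]: "lb K f \<Longrightarrow> length (f i) - Suc 0 \<le> K"
  by (metis diff_le_self lbD le_trans)

lemma tb1_upd [simp]: "tb1 c h \<Longrightarrow> tb1 c (h(a := xs)) \<longleftrightarrow> length xs \<le> c a"
  by (auto simp: tb1_def)

lemma tb_upd [simp]: "tb cap g \<Longrightarrow> tb cap (g(t := h)) \<longleftrightarrow> tb1 (cap t) h"
  by (auto simp: tb_def)

lemma tbD [simp]: "tb cap g \<Longrightarrow> tb1 (cap t) (g t)"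
  by (auto simp: tb_def)

lemma tb_cell [simp]: "tb cap g \<Longrightarrow> length (g t a) \<le> cap t a"
  by (auto simp: tb_def tb1_def)

lemma tb_cell_tl [simp]: "tb cap g \<Longrightarrow> length (g t a) - Suc 0 \<le> cap t a"
  by (metis diff_le_self tb_cell le_trans)

text \<open>\<open>J\<close> receives the part of the list that is still to be treated. The three
  steps charged before the body are the loop test, the assignment to \<open>r\<close> and the
  removal of the entry.\<close>

lemma wps_for_each:
  assumes J: "J (lvars s i) s n" and I: "bounded K cap s"
    and step: "\<And>x xs s' n'. J (x # xs) s' n' \<Longrightarrow> lvars s' i = x # xs \<Longrightarrow>
      same (r :=\<^sub>R Top (Lst i) ;; i :=\<^sub>S Pop (Lst i) ;; c) s s' \<Longrightarrow> bounded K cap s' \<Longrightarrow>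
      wps (bounded K cap) c (\<lambda>t m. lvars t i = xs \<and> J xs t m)
        (s'\<lparr>regs := (regs s')(r := x), lvars := (lvars s')(i := xs)\<rparr>) (n' + 3)"
    and exit: "\<And>s' n'. J [] s' n' \<Longrightarrow> lvars s' i = [] \<Longrightarrow>
      same (r :=\<^sub>R Top (Lst i) ;; i :=\<^sub>S Pop (Lst i) ;; c) s s' \<Longrightarrow> bounded K cap s' \<Longrightarrow> Q s' (Suc n')"
  shows "wps (bounded K cap) (for_each r i c) Q s n"
  unfolding for_each_def
proof (rule wps_While[where J = "\<lambda>k s n. k = length (lvars s i) \<and> J (lvars s i) s n" and I = "bounded K cap"])
  let ?c = "r :=\<^sub>R Top (Lst i) ;; i :=\<^sub>S Pop (Lst i) ;; c"
  fix k s' n'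
  assume *: "k = length (lvars s' i) \<and> J (lvars s' i) s' n'" "same ?c s s'" "bounded K cap s'"
  {
    assume "bval (NotB (IsEmpty (Lst i))) s'"
    then obtain x xs where l: "lvars s' i = x # xs" by (cases "lvars s' i") auto
    then have "length (x # xs) \<le> K" using *(3) lbD[of K "lvars s'" i] by (simp add: bounded_def)
    with l * wps_conseq[OF step[OF _ l *(2,3)]]
    show "wps (bounded K cap) ?c (\<lambda>t m. \<exists>k'<k. k' = length (lvars t i) \<and> J (lvars t i) t m) s' (Suc n')"
      by (auto simp: bounded_def numeral_3_eq_3)
  }
  assume "\<not> bval (NotB (IsEmpty (Lst i))) s'"
  then show "Q s' (Suc n')" using * exit by auto
qed (use J I in simp_all)

lemma wr_for_each [simp]:
  "wr_regs (for_each r i c) = insert r (wr_regs c)"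
  "wr_lvars (for_each r i c) = insert i (wr_lvars c)"
  "wr_tabs (for_each r i c) = wr_tabs c"
  by (auto simp: for_each_def)

section \<open>Backward breadth-first search in linear time\<close>

definition indeg :: "('v lit \<times> 'v lit) set \<Rightarrow> 'v lit \<Rightarrow> nat" where
  "indeg A v = card {u. (u, v) \<in> A}"

definition outdeg :: "('v lit \<times> 'v lit) set \<Rightarrow> 'v lit \<Rightarrow> nat" where
  "outdeg A u = card {v. (u, v) \<in> A}"

lemma sum_outdeg:
  assumes "finite V" "A \<subseteq> V \<times> V"
  shows "(\<Sum>u\<in>V. outdeg A u) = card A"
proof -
  have fin: "finite {v. (u, v) \<in> A}" for u using assms by (auto intro: finite_subset[of _ V])
  have "A = (SIGMA u:V. {v. (u, v) \<in> A})" using assms by auto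
  then have "card A = card (SIGMA u:V. {v. (u, v) \<in> A})" by simp
  also have "\<dots> = (\<Sum>u\<in>V. outdeg A u)" using assms fin by (simp add: outdeg_def card_SigmaI)
  finally show ?thesis by simp
qed

lemma sum_indeg:
  assumes "finite V" "A \<subseteq> V \<times> V"
  shows "(\<Sum>v\<in>V. indeg A v) = card A"
proof -
  have "indeg A v = outdeg (A\<inverse>) v" for v by (simp add: indeg_def outdeg_def)
  moreover have "A\<inverse> \<subseteq> V \<times> V" using assms(2) by auto
  ultimately show ?thesis using sum_outdeg[OF assms(1), of "A\<inverse>"] by (simp add: card_inverse)
qed

definition seen :: "'v store \<Rightarrow> 'v lit set" where
  "seen s = {v. tables s Seen v \<noteq> []}"

definition blocked :: "'v store \<Rightarrow> 'v lit set" where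
  "blocked s = {v. tables s OnPath v \<noteq> []}"

definition in_lists :: "('v lit \<times> 'v lit) set \<Rightarrow> 'v store \<Rightarrow> bool" where
  "in_lists A s \<longleftrightarrow> (\<forall>v. distinct (tables s In v) \<and> set (tables s In v) = {u. (u, v) \<in> A})"

text \<open>\<open>X\<close> lists the vertices whose predecessors have been visited, and \<open>C\<close> is the rest of the current level.\<close>
definition bfs_inv :: "('v lit \<times> 'v lit) set \<Rightarrow> 'v lit \<Rightarrow> 'v lit set \<Rightarrow> 'v lit list \<Rightarrow> 'v lit list \<Rightarrow> 'v store \<Rightarrow> bool" where
  "bfs_inv A x D X C s \<longleftrightarrow> distinct (X @ C @ lvars s Nxt) \<and> set (X @ C @ lvars s Nxt) = seen s \<and>
     seen s \<subseteq> reach A x D \<and> compl x \<in> seen s \<and>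
     (\<forall>v\<in>set X. \<forall>u. (u, v) \<in> A \<longrightarrow> u \<notin> D \<longrightarrow> u \<in> seen s)"

text \<open>\<open>A0\<close> holds the arcs of the original digraph. The specifications below speak
  of a subset \<open>A\<close> of it, the arcs left after the removal of unit-clauses, while all
  bounds stay tied to \<open>A0\<close>; \<open>K\<close> bounds the list variables.\<close>

locale network =
  fixes V :: "'v lit set" and A0 :: "('v lit \<times> 'v lit) set" and K :: nat
  assumes finite_V: "finite V" and arcs_V: "A0 \<subseteq> V \<times> V"
    and compl_V: "a \<in> V \<Longrightarrow> compl a \<in> V" and card_V_K: "card V \<le> K"
begin

text \<open>Bounds for the single cells, whose sum over all cells is linear in the size of the input.\<close>
definition cap :: "table \<Rightarrow> 'v lit \<Rightarrow> nat" where
  "cap t a = (case t of In \<Rightarrow> indeg A0 a | Out \<Rightarrow> outdeg A0 a | Rem \<Rightarrow> outdeg A0 a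
     | _ \<Rightarrow> if a \<in> V then 1 else 0)"

lemma cap_simps [simp]:
  "cap In a = indeg A0 a" "cap Out a = outdeg A0 a" "cap Rem a = outdeg A0 a"
  "cap IsUnit a = (if a \<in> V then 1 else 0)" "cap OnPath a = (if a \<in> V then 1 else 0)"
  "cap Seen a = (if a \<in> V then 1 else 0)"
  by (simp_all add: cap_def)

abbreviation inv :: "'v store \<Rightarrow> bool" where
  "inv \<equiv> bounded K cap"

lemma indeg_le: "indeg A0 a \<le> K"
proof -
  have "{u. (u, a) \<in> A0} \<subseteq> V" using arcs_V by auto
  then show ?thesis unfolding indeg_def using finite_V card_V_K by (meson card_mono le_trans)
qed

lemma outdeg_le: "outdeg A0 a \<le> K"
proof -
  have "{u. (a, u) \<in> A0} \<subseteq> V" using arcs_V by auto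
  then show ?thesis unfolding outdeg_def using finite_V card_V_K by (meson card_mono le_trans)
qed

lemma K_pos: "a \<in> V \<Longrightarrow> 1 \<le> K"
  using card_V_K finite_V by (metis One_nat_def Suc_leI card_gt_0_iff empty_iff le_trans)

lemma cap_le_K: "cap t a \<le> K"
  using K_pos[of a] by (cases t) (auto simp: indeg_le outdeg_le)

lemma cell_le_K [simp]: "tb cap g \<Longrightarrow> length (g t a) \<le> K"
  using cap_le_K le_trans tb_cell by blast

lemma distinct_le_K: "distinct xs \<Longrightarrow> set xs \<subseteq> V \<Longrightarrow> length xs \<le> K"
  using card_mono[OF finite_V, of "set xs"] distinct_card[of xs] card_V_K by simp

lemma seen_V: "inv s \<Longrightarrow> seen s \<subseteq> V"
proof
  fix v assume "inv s" "v \<in> seen s"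
  then have "length (tables s Seen v) \<le> cap Seen v" "tables s Seen v \<noteq> []"
    using tb_cell[of cap "tables s" Seen v] unfolding bounded_def seen_def by blast+
  then show "v \<in> V" by (auto split: if_splits)
qed

lemma clear_seen:
  assumes "inv s"
  shows "wps inv (for_each rV It (Seen\<lbrakk>Reg rV\<rbrakk> :=\<^sub>T Empty))
    (\<lambda>t m. seen t = seen s - set (lvars s It) \<and> m \<le> n + 4 * length (lvars s It) + 1) s n"
proof (rule wps_for_each[where J = "\<lambda>xs t m. seen t \<subseteq> (seen s - set (lvars s It)) \<union> set xs \<and>
    seen s - set (lvars s It) \<subseteq> seen t \<and> set xs \<subseteq> set (lvars s It) \<and>
    m + 4 * length xs \<le> n + 4 * length (lvars s It)"])
  fix x xs s' n'
  assume "seen s' \<subseteq> (seen s - set (lvars s It)) \<union> set (x # xs) \<and>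
    seen s - set (lvars s It) \<subseteq> seen s' \<and> set (x # xs) \<subseteq> set (lvars s It) \<and>
    n' + 4 * length (x # xs) \<le> n + 4 * length (lvars s It)" "lvars s' It = x # xs" "inv s'"
  then show "wps inv (Seen\<lbrakk>Reg rV\<rbrakk> :=\<^sub>T Empty) (\<lambda>t m. lvars t It = xs \<and>
      (seen t \<subseteq> (seen s - set (lvars s It)) \<union> set xs \<and>
      seen s - set (lvars s It) \<subseteq> seen t \<and> set xs \<subseteq> set (lvars s It) \<and>
      m + 4 * length xs \<le> n + 4 * length (lvars s It)))
     (s'\<lparr>regs := (regs s')(rV := x), lvars := (lvars s')(It := xs)\<rparr>) (n' + 3)"
    using lbD[of K "lvars s'" It] by (auto simp: bounded_def seen_def Let_def)
qed (use assms in auto)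

abbreviation visit :: com where
  "visit \<equiv> IF AndB (IsEmpty (Tab OnPath (Reg rW))) (IsEmpty (Tab Seen (Reg rW)))
    THEN (Seen\<lbrakk>Reg rW\<rbrakk> :=\<^sub>T Push (Reg rW) Empty ;; Nxt :=\<^sub>S Push (Reg rW) (Lst Nxt)) ELSE Skip"

text \<open>Six steps per predecessor: three for the loop, one test and two assignments; the branch
  without a new vertex is one step cheaper.\<close>

lemma visit_predecessors:
  assumes inv: "inv s" and ws: "set (lvars s It) \<subseteq> V"
    and nxt: "distinct (lvars s Nxt)" "set (lvars s Nxt) \<subseteq> seen s"
  shows "wps inv (for_each rW It visit)
    (\<lambda>t m. (\<exists>N. lvars t Nxt = N @ lvars s Nxt \<and> distinct N \<and> set N = set (lvars s It) - blocked s - seen s) \<and>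
      seen t = seen s \<union> (set (lvars s It) - blocked s) \<and> m \<le> n + 6 * length (lvars s It) + 1) s n"
proof -
  let ?ws = "lvars s It"
  define J where "J = (\<lambda>xs t m. \<exists>Y. ?ws = Y @ xs \<and>
    (\<exists>N. lvars t Nxt = N @ lvars s Nxt \<and> distinct N \<and> set N = set Y - blocked s - seen s) \<and>
    seen t = seen s \<union> (set Y - blocked s) \<and> m + 6 * length xs \<le> n + 6 * length ?ws)"
  show ?thesis
  proof (rule wps_for_each[where J = J])
    show "J (lvars s It) s n" unfolding J_def by (intro exI[of _ "[]"]) auto
    fix x xs s' n'
    assume J: "J (x # xs) s' n'" and l: "lvars s' It = x # xs" and inv': "inv s'"
      and same: "same (rW :=\<^sub>R Top (Lst It) ;; It :=\<^sub>S Pop (Lst It) ;; visit) s s'"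
    from J obtain Y N where Y: "?ws = Y @ x # xs" and N: "lvars s' Nxt = N @ lvars s Nxt"
      "distinct N" "set N = set Y - blocked s - seen s" and se: "seen s' = seen s \<union> (set Y - blocked s)"
      and n: "n' + 6 * length (x # xs) \<le> n + 6 * length ?ws" unfolding J_def by auto
    have bl: "tables s' OnPath = tables s OnPath" using same by (simp add: same_def)
    have x: "x \<in> V" using ws Y by auto
    have lens: "length xs \<le> K" "1 \<le> K" using lbD[of K "lvars s'" It] inv' l by (auto simp: bounded_def)
    have J_keep: "J xs t (n' + 6)" if "x \<in> blocked s \<or> x \<in> seen s'" "lvars t Nxt = lvars s' Nxt" "seen t = seen s'" for t
      using that Y N se n unfolding J_def by (intro exI[of _ "Y @ [x]"]) auto
    have J_mono: "J xs t m'" if "J xs t m" "m' \<le> m" for t m m'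
      using that unfolding J_def by fastforce
    show "wps inv visit (\<lambda>t m. lvars t It = xs \<and> J xs t m)
        (s'\<lparr>regs := (regs s')(rW := x), lvars := (lvars s')(It := xs)\<rparr>) (n' + 3)"
    proof (cases "x \<in> blocked s \<or> x \<in> seen s'")
      case True
      let ?t = "s'\<lparr>regs := (regs s')(rW := x), lvars := (lvars s')(It := xs)\<rparr>"
      have "J xs ?t (n' + 6)" using True by (intro J_keep) (auto simp: seen_def)
      then have J5: "J xs ?t (n' + 5)" using J_mono by simp
      have "tables s' OnPath x \<noteq> [] \<or> tables s' OnPath x = [] \<and> tables s' Seen x \<noteq> []"
        using True bl by (auto simp: blocked_def seen_def)
      then show ?thesis using J5 inv' lens by (auto simp: wps_Cond bounded_def eval_nat_numeral)
    next
      case False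
      then have c: "tables s' OnPath x = [] \<and> tables s' Seen x = []" using bl by (auto simp: blocked_def seen_def)
      \<comment> \<open>The next level never exceeds its space bound, since it consists of distinct
        vertices.\<close>
      have "distinct (x # N @ lvars s Nxt)" "set (x # N @ lvars s Nxt) \<subseteq> V"
        using False se N nxt x seen_V[OF inv] seen_V[OF inv'] ws Y by (auto simp: subset_iff)
      from distinct_le_K[OF this] have len: "Suc (length (lvars s' Nxt)) \<le> K" using N(1) by simp
      let ?t = "s'\<lparr>regs := (regs s')(rW := x), tables := (tables s')(Seen := (tables s' Seen)(x := [x])),
        lvars := (lvars s')(It := xs, Nxt := x # lvars s' Nxt)\<rparr>"
      have "seen ?t = insert x (seen s')" by (auto simp: seen_def)
      then have "J xs ?t (n' + 6)" using False Y N se n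
        unfolding J_def by (intro exI[of _ "Y @ [x]"] conjI exI[of _ "x # N"]) auto
      then show ?thesis
        using c inv' lens x len by (simp add: wps_Cond bounded_def eval_nat_numeral)
    qed
  qed (use inv in \<open>auto simp: J_def\<close>)
qed


lemma bfs_inv_reachD: "bfs_inv A x D X C s \<Longrightarrow> seen s \<subseteq> reach A x D"
  by (simp add: bfs_inv_def)

lemma bfs_inv_visit:
  assumes inv: "bfs_inv A x D X (v # C) s"
    and N: "lvars t Nxt = N @ lvars s Nxt" "distinct N" "set N = {u. (u, v) \<in> A} - D - seen s"
    and se: "seen t = seen s \<union> ({u. (u, v) \<in> A} - D)"
  shows "bfs_inv A x D (X @ [v]) C t"
proof -
  have "v \<in> reach A x D" using inv by (auto simp: bfs_inv_def)
  then have "{u. (u, v) \<in> A} - D \<subseteq> reach A x D" using reach_step by fast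
  moreover have "set N \<inter> (set X \<union> {v} \<union> set C \<union> set (lvars s Nxt)) = {}"
    using inv N(3) unfolding bfs_inv_def by auto
  ultimately show ?thesis
    using inv N se unfolding bfs_inv_def by auto
qed

abbreviation level :: com where
  "level \<equiv> for_each rV Cur (It :=\<^sub>S Tab In (Reg rV) ;; for_each rW It visit)"

text \<open>The constant 5 per vertex consists of three steps of the outer loop, the fetching of the
  predecessor list and the final test of the inner loop.\<close>

lemma bfs_level:
  assumes inv: "inv s" and lists: "in_lists A s" and A: "A \<subseteq> A0"
    and bfs: "bfs_inv A x (blocked s) X (lvars s Cur) s"
  shows "wps inv level
    (\<lambda>t m. bfs_inv A x (blocked s) (X @ lvars s Cur) [] t \<and>
      m \<le> n + (\<Sum>v\<leftarrow>lvars s Cur. 5 + 6 * indeg A v) + 1) s n"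
proof -
  define J where "J = (\<lambda>xs t m. \<exists>Y. lvars s Cur = Y @ xs \<and>
    bfs_inv A x (blocked s) (X @ Y) xs t \<and> m \<le> n + (\<Sum>v\<leftarrow>Y. 5 + 6 * indeg A v))"
  show ?thesis
  proof (rule wps_for_each[where J = J])
    show "J (lvars s Cur) s n" using bfs unfolding J_def by auto
    fix v xs s' n'
    assume J: "J (v # xs) s' n'" and l: "lvars s' Cur = v # xs" and inv': "inv s'"
      and same: "same (rV :=\<^sub>R Top (Lst Cur) ;; Cur :=\<^sub>S Pop (Lst Cur) ;;
        It :=\<^sub>S Tab In (Reg rV) ;; for_each rW It visit) s s'"
    from J obtain Y where Y: "lvars s Cur = Y @ v # xs" "bfs_inv A x (blocked s) (X @ Y) (v # xs) s'"
      "n' \<le> n + (\<Sum>v\<leftarrow>Y. 5 + 6 * indeg A v)" unfolding J_def by auto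
    have eq: "tables s' In = tables s In" "blocked s' = blocked s"
      using same by (auto simp: same_def blocked_def)
    let ?s1 = "s'\<lparr>regs := (regs s')(rV := v), lvars := (lvars s')(Cur := xs, It := tables s In v)\<rparr>"
    have preds: "set (tables s In v) = {u. (u, v) \<in> A}" "length (tables s In v) = indeg A v"
      using lists distinct_card[of "tables s In v"] by (auto simp: in_lists_def indeg_def)
    have lens: "length xs \<le> K" using lbD[of K "lvars s'" Cur] inv' l by (simp add: bounded_def)
    have "length (tables s' In v) \<le> K" using inv' by (simp add: bounded_def)
    then have inv1: "inv ?s1" using inv' lens eq by (simp add: bounded_def)
    have [simp]: "blocked ?s1 = blocked s" "seen ?s1 = seen s'"
      using eq by (auto simp: blocked_def seen_def)
    have "wps inv (for_each rW It visit) (\<lambda>t m. lvars t Cur = xs \<and> J xs t m) ?s1 (n' + 4)"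
    proof (rule wps_conseq[OF visit_predecessors[OF inv1]])
      show "set (lvars ?s1 It) \<subseteq> V" using preds A arcs_V by auto
      show "distinct (lvars ?s1 Nxt)" "set (lvars ?s1 Nxt) \<subseteq> seen ?s1"
        using Y(2) by (auto simp: bfs_inv_def)
      fix t m
      assume post: "(\<exists>N. lvars t Nxt = N @ lvars ?s1 Nxt \<and> distinct N \<and>
            set N = set (lvars ?s1 It) - blocked ?s1 - seen ?s1) \<and>
          seen t = seen ?s1 \<union> (set (lvars ?s1 It) - blocked ?s1) \<and> m \<le> n' + 4 + 6 * length (lvars ?s1 It) + 1"
        and same1: "same (for_each rW It visit) ?s1 t"
      then obtain N where "lvars t Nxt = N @ lvars s' Nxt" "distinct N"
        "set N = {u. (u, v) \<in> A} - blocked s - seen s'" using preds by auto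
      from bfs_inv_visit[OF Y(2) this] post preds
      have "bfs_inv A x (blocked s) ((X @ Y) @ [v]) xs t" by simp
      moreover have "m \<le> n + (\<Sum>v\<leftarrow>Y @ [v]. 5 + 6 * indeg A v)" using post Y(3) preds by simp
      moreover have "lvars s Cur = (Y @ [v]) @ xs" using Y(1) by simp
      ultimately have "J xs t m" unfolding J_def by (metis append_assoc)
      moreover have "lvars t Cur = xs" using same1 by (simp add: same_def)
      ultimately show "lvars t Cur = xs \<and> J xs t m" by simp
    qed
    then show "wps inv (It :=\<^sub>S Tab In (Reg rV) ;; for_each rW It visit) (\<lambda>t m. lvars t Cur = xs \<and> J xs t m)
        (s'\<lparr>regs := (regs s')(rV := v), lvars := (lvars s')(Cur := xs)\<rparr>) (n' + 3)"
      using inv1 eq by (simp add: eval_nat_numeral)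
  next
    fix s' n' assume "J [] s' n'"
    then show "bfs_inv A x (blocked s) (X @ lvars s Cur) [] s' \<and>
      Suc n' \<le> n + (\<Sum>v\<leftarrow>lvars s Cur. 5 + 6 * indeg A v) + 1" unfolding J_def by auto
  qed (use inv in auto)
qed

text \<open>Every vertex is expanded at most once, so the costs per vertex add up to a bound linear
  in vertices and arcs.\<close>

lemma weight_le:
  assumes "distinct X" "set X \<subseteq> V" "A \<subseteq> A0"
  shows "(\<Sum>v\<leftarrow>X. a + b * indeg A v) \<le> a * card V + b * card A0"
proof -
  have fin: "finite A0" using arcs_V finite_V by (auto intro: finite_subset)
  have "(\<Sum>v\<leftarrow>X. a + b * indeg A v) = (\<Sum>v\<in>set X. a + b * indeg A v)"
    using assms(1) by (simp add: sum_list_distinct_conv_sum_set)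
  also have "\<dots> \<le> (\<Sum>v\<in>V. a + b * indeg A v)" using assms(2) finite_V by (intro sum_mono2) auto
  also have "\<dots> = a * card V + b * (\<Sum>v\<in>V. indeg A v)" by (simp add: sum.distrib sum_distrib_left)
  also have "(\<Sum>v\<in>V. indeg A v) = card A" using assms(3) arcs_V finite_V by (intro sum_indeg) auto
  also have "card A \<le> card A0" using assms(3) fin by (rule card_mono[rotated])
  finally show ?thesis by simp
qed

text \<open>The number of vertices not yet expanded serves as variant. On exit both levels are
  empty, so the seen vertices are closed under undeleted predecessors and contain
  \<open>reach\<close> by its minimality.\<close>

lemma bfs_loop:
  assumes inv: "inv s" and lists: "in_lists A s" and A: "A \<subseteq> A0" and x: "x \<in> V"
    and bfs: "bfs_inv A x (blocked s) [] (lvars s Cur) s" and nxt: "lvars s Nxt = []"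
  shows "wps inv (WHILE NotB (IsEmpty (Lst Cur)) DO (level ;; Cur :=\<^sub>S Lst Nxt ;; Nxt :=\<^sub>S Empty))
    (\<lambda>t m. seen t = reach A x (blocked s) \<and> m \<le> n + 9 * card V + 6 * card A0 + 1) s n"
proof -
  let ?c = "level ;; Cur :=\<^sub>S Lst Nxt ;; Nxt :=\<^sub>S Empty"
  have reach_V: "reach A x D \<subseteq> V" for D
    using A arcs_V x compl_V by (intro reach_finite) auto
  define J where "J = (\<lambda>k t m. \<exists>X. k = card V - length X \<and> bfs_inv A x (blocked s) X (lvars t Cur) t \<and>
    lvars t Nxt = [] \<and> m \<le> n + (\<Sum>v\<leftarrow>X. 9 + 6 * indeg A v))"
  have X_V: "distinct X \<and> set X \<subseteq> V" if "bfs_inv A x D X C t" for X C t D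
    using that reach_V unfolding bfs_inv_def by fastforce
  show ?thesis
  proof (rule wps_While[where J = J])
    show "J (card V) s n" using bfs nxt unfolding J_def by (intro exI[of _ "[]"]) auto
  next
    fix k s' n'
    assume J: "J k s' n'" and same: "same ?c s s'" and inv': "inv s'"
      and b: "bval (NotB (IsEmpty (Lst Cur))) s'"
    from J obtain X where X: "k = card V - length X" "bfs_inv A x (blocked s) X (lvars s' Cur) s'"
      "lvars s' Nxt = []" "n' \<le> n + (\<Sum>v\<leftarrow>X. 9 + 6 * indeg A v)" unfolding J_def by auto
    have eq: "tables s' In = tables s In" "blocked s' = blocked s"
      using same by (auto simp: same_def blocked_def)
    have lists': "in_lists A s'" using lists eq by (simp add: in_lists_def)
    have "wps inv level (wps inv (Cur :=\<^sub>S Lst Nxt ;; Nxt :=\<^sub>S Empty) (\<lambda>t m. \<exists>k'<k. J k' t m)) s' (Suc n')"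
    proof (rule wps_conseq[OF bfs_level[OF inv' lists' A]])
      show "bfs_inv A x (blocked s') X (lvars s' Cur) s'" using X(2) eq by simp
      fix t m
      assume post: "bfs_inv A x (blocked s') (X @ lvars s' Cur) [] t \<and>
          m \<le> Suc n' + (\<Sum>v\<leftarrow>lvars s' Cur. 5 + 6 * indeg A v) + 1" and "inv t"
      let ?t = "t\<lparr>lvars := (lvars t)(Cur := lvars t Nxt, Nxt := [])\<rparr>"
      have "bfs_inv A x (blocked s) (X @ lvars s' Cur) (lvars ?t Cur) ?t"
        using post eq unfolding bfs_inv_def by (simp add: seen_def)
      moreover have "Suc (Suc m) \<le> n + (\<Sum>v\<leftarrow>X @ lvars s' Cur. 9 + 6 * indeg A v)"
      proof -
        \<comment> \<open>Each level has an overhead of four steps, two tests and two assignments.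
          It is charged to one vertex of this nonempty level, which turns the weight 5 into
          9.\<close>
        have "1 \<le> length (lvars s' Cur)" using b by (cases "lvars s' Cur") auto
        moreover have "(\<Sum>v\<leftarrow>ys. 9 + 6 * indeg A v) = (\<Sum>v\<leftarrow>ys. 5 + 6 * indeg A v) + 4 * length ys" for ys
          by (induction ys) auto
        ultimately show ?thesis using post X(4) by simp
      qed
      ultimately have "J (card V - length (X @ lvars s' Cur)) ?t (Suc (Suc m))"
        unfolding J_def by (intro exI[of _ "X @ lvars s' Cur"]) simp
      moreover have "card V - length (X @ lvars s' Cur) < k"
      proof -
        have "distinct (X @ lvars s' Cur) \<and> set (X @ lvars s' Cur) \<subseteq> V" using post X_V by blast
        then have "length (X @ lvars s' Cur) \<le> card V"
          using card_mono[OF finite_V] distinct_card by metis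
        moreover have "1 \<le> length (lvars s' Cur)" using b by (cases "lvars s' Cur") auto
        ultimately show ?thesis using X(1) by simp
      qed
      ultimately show "wps inv (Cur :=\<^sub>S Lst Nxt ;; Nxt :=\<^sub>S Empty) (\<lambda>t m. \<exists>k'<k. J k' t m) t m"
        using \<open>inv t\<close> by (auto simp: bounded_def)
    qed
    then show "wps inv ?c (\<lambda>t m. \<exists>k'<k. J k' t m) s' (Suc n')" by simp
  next
    fix k s' n'
    assume J: "J k s' n'" and b: "\<not> bval (NotB (IsEmpty (Lst Cur))) s'"
    then obtain X where X: "bfs_inv A x (blocked s) X [] s'"
      "lvars s' Nxt = []" "n' \<le> n + (\<Sum>v\<leftarrow>X. 9 + 6 * indeg A v)" unfolding J_def by auto
    have "reach A x (blocked s) \<subseteq> seen s'"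
      using X(1,2) unfolding bfs_inv_def by (intro reach_least) auto
    then have "seen s' = reach A x (blocked s)" using bfs_inv_reachD[OF X(1)] by auto
    moreover have "(\<Sum>v\<leftarrow>X. 9 + 6 * indeg A v) \<le> 9 * card V + 6 * card A0"
      using X_V[OF X(1)] A by (intro weight_le) auto
    ultimately show "seen s' = reach A x (blocked s) \<and> Suc n' \<le> n + 9 * card V + 6 * card A0 + 1"
      using X(3) by simp
  qed (use inv in auto)
qed

text \<open>Per vertex, 4 steps for clearing its mark are added to the 9 of the search.\<close>

lemma bfs_spec:
  assumes inv: "inv s" and lists: "in_lists A s" and A: "A \<subseteq> A0" and x: "regs s rX \<in> V"
    and ord: "set (lvars s Ord) = V" "distinct (lvars s Ord)"
  shows "wps inv bfs (\<lambda>t m. seen t = reach A (regs s rX) (blocked s) \<and>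
    m \<le> n + 13 * card V + 6 * card A0 + 6) s n"
proof -
  let ?x = "regs s rX"
  let ?s1 = "s\<lparr>lvars := (lvars s)(It := lvars s Ord)\<rparr>"
  let ?loop = "WHILE NotB (IsEmpty (Lst Cur)) DO (level ;; Cur :=\<^sub>S Lst Nxt ;; Nxt :=\<^sub>S Empty)"
  let ?Q = "\<lambda>t m. seen t = reach A ?x (blocked s) \<and> m \<le> n + 13 * card V + 6 * card A0 + 6"
  have inv1: "inv ?s1" using inv by (simp add: bounded_def)
  have len: "length (lvars s Ord) = card V" using ord distinct_card by metis
  have "wps inv (for_each rV It (Seen\<lbrakk>Reg rV\<rbrakk> :=\<^sub>T Empty)) (wps inv
      (Seen\<lbrakk>Co (Reg rX)\<rbrakk> :=\<^sub>T Push (Reg rX) Empty ;;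
       Cur :=\<^sub>S Push (Co (Reg rX)) Empty ;; Nxt :=\<^sub>S Empty ;; ?loop) ?Q) ?s1 (Suc n)"
  proof (rule wps_conseq[OF clear_seen[OF inv1]])
    fix t m
    assume post: "seen t = seen ?s1 - set (lvars ?s1 It) \<and> m \<le> Suc n + 4 * length (lvars ?s1 It) + 1"
      and same: "same (for_each rV It (Seen\<lbrakk>Reg rV\<rbrakk> :=\<^sub>T Empty)) ?s1 t" and inv_t: "inv t"
    have seen_t: "seen t = {}" using post seen_V[OF inv1] ord(1) by auto
    have eq: "regs t rX = ?x" "tables t In = tables s In" "tables t OnPath = tables s OnPath"
      using same by (auto simp: same_def)
    let ?t = "t\<lparr>tables := (tables t)(Seen := (tables t Seen)(compl ?x := [?x])),
      lvars := (lvars t)(Cur := [compl ?x], Nxt := [])\<rparr>"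
    have inv_t2: "inv ?t" using inv_t compl_V[OF x] K_pos[OF x] by (simp add: bounded_def)
    have b: "blocked ?t = blocked s" using eq(3) by (simp add: blocked_def)
    have "seen ?t = {compl ?x}" using seen_t by (auto simp: seen_def)
    then have "bfs_inv A ?x (blocked ?t) [] (lvars ?t Cur) ?t"
      unfolding bfs_inv_def by (simp add: reach_base)
    moreover have "in_lists A ?t" using lists eq(2) by (simp add: in_lists_def)
    ultimately have "wps inv ?loop (\<lambda>t' m'. seen t' = reach A ?x (blocked ?t) \<and>
        m' \<le> m + 3 + 9 * card V + 6 * card A0 + 1) ?t (m + 3)"
      by (intro bfs_loop[OF inv_t2 _ A x]) simp_all
    then have "wps inv ?loop ?Q ?t (m + 3)"
      by (rule wps_conseq) (use post len b in simp)
    then show "wps inv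
      (Seen\<lbrakk>Co (Reg rX)\<rbrakk> :=\<^sub>T Push (Reg rX) Empty ;;
       Cur :=\<^sub>S Push (Co (Reg rX)) Empty ;; Nxt :=\<^sub>S Empty ;; ?loop) ?Q t m"
      using inv_t inv_t2 compl_V[OF x] K_pos[OF x] eq(1) by (simp add: bounded_def eval_nat_numeral)
  qed
  then show ?thesis unfolding bfs_def using inv1 by simp
qed

end

section \<open>Sorted adjacency lists, storing the successors, and removing a unit arc\<close>

definition out_lists :: "'v lit rel \<Rightarrow> ('v lit \<times> 'v lit) set \<Rightarrow> 'v store \<Rightarrow> bool" where
  "out_lists L A s \<longleftrightarrow> (\<forall>u. sorted_wrt (\<lambda>a b. (a, b) \<in> L \<and> a \<noteq> b) (tables s Out u) \<and>
     set (tables s Out u) = {v. (u, v) \<in> A})"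

lemma sorted_wrt_distinct: "sorted_wrt (\<lambda>a b. (a, b) \<in> L \<and> a \<noteq> b) xs \<Longrightarrow> distinct xs"
  by (induction xs) auto

lemma in_lists_insert:
  assumes "in_lists A s" "(u, v) \<notin> A" "\<And>w. tables t In w = (if w = v then u # tables s In v else tables s In w)"
  shows "in_lists (insert (u, v) A) t"
  using assms unfolding in_lists_def by auto

lemma in_lists_length: "in_lists A s \<Longrightarrow> length (tables s In v) = indeg A v"
  unfolding in_lists_def indeg_def using distinct_card by metis

lemma out_lists_length: "out_lists L A s \<Longrightarrow> length (tables s Out u) = outdeg A u"
proof -
  assume "out_lists L A s"
  then have "sorted_wrt (\<lambda>a b. (a, b) \<in> L \<and> a \<noteq> b) (tables s Out u)" "set (tables s Out u) = {v. (u, v) \<in> A}"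
    by (auto simp: out_lists_def)
  with distinct_card[OF sorted_wrt_distinct[OF this(1)]] show ?thesis by (simp add: outdeg_def)
qed

locale ordered_network = network V A0 K for V :: "'v lit set" and A0 K +
  fixes L :: "'v lit rel" and ls :: "'v lit list"
  assumes lin: "linear_order_on V L" and set_ls: "set ls = V"
    and sorted_ls: "sorted_wrt (\<lambda>a b. (a, b) \<in> L \<and> a \<noteq> b) ls"
begin

lemma distinct_ls: "distinct ls"
  using sorted_ls by (rule sorted_wrt_distinct)

lemma length_ls: "length ls = card V"
  using distinct_ls set_ls distinct_card by metis

lemma finite_A0: "finite A0"
  using arcs_V finite_V by (auto intro: finite_subset)

lemma indeg_mono: "A \<subseteq> A0 \<Longrightarrow> indeg A v \<le> indeg A0 v"
proof -
  assume "A \<subseteq> A0"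
  moreover have "{u. (u, v) \<in> A0} \<subseteq> V" using arcs_V by auto
  ultimately show ?thesis unfolding indeg_def using finite_V
    by (intro card_mono) (auto intro: finite_subset)
qed

lemma outdeg_mono: "A \<subseteq> A0 \<Longrightarrow> outdeg A v \<le> outdeg A0 v"
proof -
  assume "A \<subseteq> A0"
  moreover have "{u. (v, u) \<in> A0} \<subseteq> V" using arcs_V by auto
  ultimately show ?thesis unfolding outdeg_def using finite_V
    by (intro card_mono) (auto intro: finite_subset)
qed

lemma indeg_le_arcs: "indeg A0 v \<le> card A0"
proof -
  have "(\<lambda>u. (u, v)) ` {u. (u, v) \<in> A0} \<subseteq> A0" by auto
  then show ?thesis unfolding indeg_def using finite_A0
    by (intro card_inj_on_le[of "\<lambda>u. (u, v)"]) (auto intro: inj_onI)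
qed

lemma outdeg_le_arcs: "outdeg A0 v \<le> card A0"
proof -
  have "(\<lambda>u. (v, u)) ` {u. (v, u) \<in> A0} \<subseteq> A0" by auto
  then show ?thesis unfolding outdeg_def using finite_A0
    by (intro card_inj_on_le[of "\<lambda>u. (v, u)"]) (auto intro: inj_onI)
qed

text \<open>Shared by the selection of the viable out-neighbours and by the removal of an arc. The
  filtered list comes out reversed; \<open>push_cell\<close> reverses it again, so that the order
  \<open>L\<close> survives.\<close>

lemma push_filter:
  assumes inv: "inv s" and b: "\<And>t. regs t rX = regs s rX \<Longrightarrow> tables t = tables s \<Longrightarrow> bval b t \<longleftrightarrow> \<not> p (regs t rV)"
    and len: "length (lvars s It) + length (lvars s Tmp) \<le> K"
  shows "wps inv (for_each rV It (IF b THEN Skip ELSE Tmp :=\<^sub>S Push (Reg rV) (Lst Tmp)))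
    (\<lambda>t m. lvars t Tmp = rev (filter p (lvars s It)) @ lvars s Tmp \<and> m \<le> n + 5 * length (lvars s It) + 1) s n"
proof -
  define J where "J = (\<lambda>xs (t :: 'v store) m. \<exists>Y. lvars s It = Y @ xs \<and> lvars t Tmp = rev (filter p Y) @ lvars s Tmp \<and>
    m \<le> n + 5 * length Y)"
  show ?thesis
  proof (rule wps_for_each[where J = J])
    show "J (lvars s It) s n" unfolding J_def by auto
    fix x xs s' n'
    assume J: "J (x # xs) s' n'" and l: "lvars s' It = x # xs" and inv': "inv s'"
      and same: "same (rV :=\<^sub>R Top (Lst It) ;; It :=\<^sub>S Pop (Lst It) ;; IF b THEN Skip ELSE Tmp :=\<^sub>S Push (Reg rV) (Lst Tmp)) s s'"
    from J obtain Y where Y: "lvars s It = Y @ x # xs" "lvars s' Tmp = rev (filter p Y) @ lvars s Tmp"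
      "n' \<le> n + 5 * length Y" unfolding J_def by auto
    let ?s1 = "s'\<lparr>regs := (regs s')(rV := x), lvars := (lvars s')(It := xs)\<rparr>"
    have "tables s' = tables s" "regs s' rX = regs s rX" using same by (auto simp: same_def)
    then have bx: "bval b ?s1 \<longleftrightarrow> \<not> p x" using b[of ?s1] by simp
    have "length xs \<le> K" using lbD[of K "lvars s'" It] inv' l by (simp add: bounded_def)
    moreover have "Suc (length (lvars s' Tmp)) \<le> K"
      using Y(1,2) len length_filter_le[of p Y] by (simp del: length_filter_le)
    moreover have J1: "J xs t m" if "lvars t Tmp = (if p x then [x] else []) @ lvars s' Tmp" "m \<le> n' + 5" for t m
      using that Y unfolding J_def by (intro exI[of _ "Y @ [x]"]) auto
    ultimately show "wps inv (IF b THEN Skip ELSE Tmp :=\<^sub>S Push (Reg rV) (Lst Tmp))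
      (\<lambda>t m. lvars t It = xs \<and> J xs t m) ?s1 (n' + 3)"
      using bx inv' by (auto simp: wps_Cond bounded_def eval_nat_numeral intro!: J1)
  next
    fix s' n' assume "J [] s' n'"
    then show "lvars s' Tmp = rev (filter p (lvars s It)) @ lvars s Tmp \<and> Suc n' \<le> n + 5 * length (lvars s It) + 1"
      unfolding J_def by auto
  qed (use inv in auto)
qed

lemma push_cell:
  assumes inv: "inv s" and a: "\<And>t. \<forall>r. r \<noteq> rV \<longrightarrow> regs t r = regs s r \<Longrightarrow> lval a t = w"
    and len: "length (lvars s Tmp) + length (tables s T w) \<le> cap T w"
  shows "wps inv (for_each rV Tmp (T\<lbrakk>a\<rbrakk> :=\<^sub>T Push (Reg rV) (Tab T a)))
    (\<lambda>t m. tables t T = (tables s T)(w := rev (lvars s Tmp) @ tables s T w) \<and> m \<le> n + 4 * length (lvars s Tmp) + 1) s n"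
proof -
  define J where "J = (\<lambda>xs (t :: 'v store) m. \<exists>Y. lvars s Tmp = Y @ xs \<and>
    tables t T = (tables s T)(w := rev Y @ tables s T w) \<and> m \<le> n + 4 * length Y)"
  show ?thesis
  proof (rule wps_for_each[where J = J])
    show "J (lvars s Tmp) s n" unfolding J_def by auto
    fix x xs s' n'
    assume J: "J (x # xs) s' n'" and l: "lvars s' Tmp = x # xs" and inv': "inv s'"
      and same: "same (rV :=\<^sub>R Top (Lst Tmp) ;; Tmp :=\<^sub>S Pop (Lst Tmp) ;; T\<lbrakk>a\<rbrakk> :=\<^sub>T Push (Reg rV) (Tab T a)) s s'"
    from J obtain Y where Y: "lvars s Tmp = Y @ x # xs" "tables s' T = (tables s T)(w := rev Y @ tables s T w)"
      "n' \<le> n + 4 * length Y" unfolding J_def by auto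
    let ?s1 = "s'\<lparr>regs := (regs s')(rV := x), lvars := (lvars s')(Tmp := xs)\<rparr>"
    have ax: "lval a ?s1 = w" using same by (intro a) (simp add: same_def)
    have "length xs \<le> K" using lbD[of K "lvars s'" Tmp] inv' l by (simp add: bounded_def)
    moreover have "Suc (length (tables s' T w)) \<le> cap T w"
      using Y(1,2) len by simp
    moreover have J1: "J xs t m" if "tables t T = (tables s' T)(w := x # tables s' T w)" "m \<le> n' + 4" for t m
      using that Y unfolding J_def by (intro exI[of _ "Y @ [x]"]) auto
    ultimately show "wps inv (T\<lbrakk>a\<rbrakk> :=\<^sub>T Push (Reg rV) (Tab T a))
      (\<lambda>t m. lvars t Tmp = xs \<and> J xs t m) ?s1 (n' + 3)"
      using ax inv' by (auto simp: bounded_def eval_nat_numeral intro!: J1)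
  next
    fix s' n' assume "J [] s' n'"
    then show "tables s' T = (tables s T)(w := rev (lvars s Tmp) @ tables s T w) \<and> Suc n' \<le> n + 4 * length (lvars s Tmp) + 1"
      unfolding J_def by auto
  qed (use inv in auto)
qed

text \<open>The part of \<^term>\<open>enter\<close> that stores the out-neighbours found by the search.\<close>
definition store_successors :: com where
  "store_successors =
     It :=\<^sub>S Tab Out (Reg rY) ;; Tmp :=\<^sub>S Empty ;;
     for_each rV It (IF IsEmpty (Tab Seen (Reg rV)) THEN Skip ELSE Tmp :=\<^sub>S Push (Reg rV) (Lst Tmp)) ;;
     for_each rV Tmp (Rem\<lbrakk>Reg rY\<rbrakk> :=\<^sub>T Push (Reg rV) (Tab Rem (Reg rY)))"

lemma store_successors_spec:
  assumes inv: "inv s" and lists: "out_lists L A s" and A: "A \<subseteq> A0" and rem: "tables s Rem (regs s rY) = []"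
  shows "wps inv store_successors
    (\<lambda>t m. tables t Rem = (tables s Rem)(regs s rY := filter (\<lambda>v. v \<in> seen s) (tables s Out (regs s rY))) \<and>
      m \<le> n + 9 * card A0 + 4) s n"
proof -
  let ?y = "regs s rY" and ?p = "\<lambda>v. v \<in> seen s"
  let ?out = "tables s Out ?y"
  let ?s1 = "s\<lparr>lvars := (lvars s)(It := ?out, Tmp := [])\<rparr>"
  let ?c2 = "for_each rV Tmp (Rem\<lbrakk>Reg rY\<rbrakk> :=\<^sub>T Push (Reg rV) (Tab Rem (Reg rY)))"
  let ?Q = "\<lambda>t m. tables t Rem = (tables s Rem)(?y := filter ?p ?out) \<and> m \<le> n + 9 * card A0 + 4"
  have "length ?out \<le> outdeg A0 ?y"
    using out_lists_length[OF lists] outdeg_mono[OF A] by simp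
  then have lens: "length ?out \<le> outdeg A0 ?y" "length ?out \<le> K" "length ?out \<le> card A0"
    using outdeg_le[of ?y] outdeg_le_arcs[of ?y] by auto
  have inv1: "inv ?s1" using inv lens by (simp add: bounded_def)
  have "wps inv (for_each rV It (IF IsEmpty (Tab Seen (Reg rV)) THEN Skip ELSE Tmp :=\<^sub>S Push (Reg rV) (Lst Tmp)))
    (wps inv ?c2 ?Q) ?s1 (n + 2)"
  proof (rule wps_conseq[OF push_filter[where p = ?p, OF inv1]])
    fix t m
    assume post: "lvars t Tmp = rev (filter ?p (lvars ?s1 It)) @ lvars ?s1 Tmp \<and> m \<le> n + 2 + 5 * length (lvars ?s1 It) + 1"
      and same: "same (for_each rV It (IF IsEmpty (Tab Seen (Reg rV)) THEN Skip ELSE Tmp :=\<^sub>S Push (Reg rV) (Lst Tmp))) ?s1 t"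
      and inv_t: "inv t"
    have eq: "regs t rY = ?y" "tables t = tables s" using same by (auto simp: same_def)
    have tmp: "lvars t Tmp = rev (filter ?p ?out)" using post by simp
    note flen = le_trans[OF length_filter_le[of ?p ?out] lens(1)] le_trans[OF length_filter_le[of ?p ?out] lens(3)]
    show "wps inv ?c2 ?Q t m"
    proof (rule wps_conseq[OF push_cell[where w = ?y, OF inv_t]])
      show "length (lvars t Tmp) + length (tables t Rem ?y) \<le> cap Rem ?y"
        using tmp eq rem flen lens by simp
      fix t' m'
      assume "tables t' Rem = (tables t Rem)(?y := rev (lvars t Tmp) @ tables t Rem ?y) \<and> m' \<le> m + 4 * length (lvars t Tmp) + 1"
      then show "?Q t' m'" using tmp eq rem flen lens post by simp
    qed (use eq in simp)
  qed (use lens in \<open>auto simp: seen_def\<close>)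
  then show ?thesis unfolding store_successors_def using inv inv1 lens by (simp add: bounded_def eval_nat_numeral)
qed

text \<open>The arc of a unit-clause is its own contraposition, so only two cells change. The
  \<open>Out\<close> cell passes through two reversals to stay sorted, whereas the \<open>In\<close>
  cell, whose order is arbitrary, may be left reversed.\<close>

lemma remove_unit_spec:
  assumes inv: "inv s" and il: "in_lists A s" and ol: "out_lists L A s" and A: "A \<subseteq> A0" and x: "regs s rX = x"
  shows "wps inv remove_unit
    (\<lambda>t m. in_lists (A - {(compl x, x)}) t \<and> out_lists L (A - {(compl x, x)}) t \<and> m \<le> n + 15 * card A0 + 10) s n"
proof -
  let ?out = "tables s Out (compl x)" and ?p = "\<lambda>v. v \<noteq> x"
  let ?A' = "A - {(compl x, x)}"
  let ?s1 = "s\<lparr>lvars := (lvars s)(It := ?out, Tmp := [])\<rparr>"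
  let ?c1 = "for_each rV It (IF EqL (Reg rV) (Reg rX) THEN Skip ELSE Tmp :=\<^sub>S Push (Reg rV) (Lst Tmp))"
  let ?c2 = "for_each rV Tmp (Out\<lbrakk>Co (Reg rX)\<rbrakk> :=\<^sub>T Push (Reg rV) (Tab Out (Co (Reg rX))))"
  let ?b3 = "IF EqL (Reg rV) (Co (Reg rX)) THEN Skip ELSE In\<lbrakk>Reg rX\<rbrakk> :=\<^sub>T Push (Reg rV) (Tab In (Reg rX))"
  let ?c3 = "It :=\<^sub>S Tab In (Reg rX) ;; In\<lbrakk>Reg rX\<rbrakk> :=\<^sub>T Empty ;; for_each rV It ?b3"
  let ?Q = "\<lambda>t m. in_lists ?A' t \<and> out_lists L ?A' t \<and> m \<le> n + 15 * card A0 + 10"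
  have "length ?out \<le> outdeg A0 (compl x)"
    using out_lists_length[OF ol] outdeg_mono[OF A] by simp
  then have lens: "length ?out \<le> outdeg A0 (compl x)" "length ?out \<le> K" "length ?out \<le> card A0"
    using outdeg_le[of "compl x"] outdeg_le_arcs[of "compl x"] by auto
  have inlens: "length (tables s In x) \<le> indeg A0 x" "length (tables s In x) \<le> K" "length (tables s In x) \<le> card A0"
    using in_lists_length[OF il, of x] indeg_mono[OF A, of x] indeg_le[of x] indeg_le_arcs[of x] by auto
  have inv1: "inv ?s1" using inv lens by (simp add: bounded_def)
  have loop3: "wps inv ?c3 ?Q t m"
    if t: "inv t" "regs t rX = x" "tables t In = tables s In" "tables t Out = (tables s Out)(compl x := filter ?p ?out)"
      "m \<le> n + 9 * card A0 + 5" for t m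
  proof -
    let ?in = "tables s In x"
    let ?t1 = "t\<lparr>lvars := (lvars t)(It := ?in), tables := (tables t)(In := (tables s In)(x := []))\<rparr>"
    have inv_t1: "inv ?t1" using t(1) inlens t(3)[symmetric] by (simp add: bounded_def)
    define J where "J = (\<lambda>xs (u :: 'v store) k. \<exists>Y. ?in = Y @ xs \<and>
      tables u In = (tables s In)(x := rev (filter (\<lambda>v. v \<noteq> compl x) Y)) \<and> k \<le> m + 2 + 5 * length Y)"
    have "wps inv (for_each rV It ?b3) ?Q ?t1 (m + 2)"
    proof (rule wps_for_each[where J = J])
      show "J (lvars ?t1 It) ?t1 (m + 2)" unfolding J_def by (intro exI[of _ "[]"]) auto
      fix v xs s' n'
      assume J: "J (v # xs) s' n'" and l: "lvars s' It = v # xs" and inv': "inv s'"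
        and same: "same (rV :=\<^sub>R Top (Lst It) ;; It :=\<^sub>S Pop (Lst It) ;; ?b3) ?t1 s'"
      from J obtain Y where Y: "?in = Y @ v # xs" "tables s' In = (tables s In)(x := rev (filter (\<lambda>v. v \<noteq> compl x) Y))"
        "n' \<le> m + 2 + 5 * length Y" unfolding J_def by auto
      have x': "regs s' rX = x" using same t(2) by (simp add: same_def)
      have "length xs \<le> K" using lbD[of K "lvars s'" It] inv' l by (simp add: bounded_def)
      moreover have "Suc (length (filter (\<lambda>v. v \<noteq> compl x) Y)) \<le> length ?in"
        using Y(1) length_filter_le[of "\<lambda>v. v \<noteq> compl x" Y] by (simp del: length_filter_le)
      then have "Suc (length (tables s' In x)) \<le> indeg A0 x"
        unfolding Y(2) using le_trans[OF _ inlens(1)] by simp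
      moreover have J1: "J xs u k"
        if "tables u In = (if v = compl x then tables s' In else (tables s' In)(x := v # tables s' In x))" "k \<le> n' + 5" for u k
        using that Y unfolding J_def by (intro exI[of _ "Y @ [v]"]) auto
      ultimately show "wps inv ?b3 (\<lambda>t m. lvars t It = xs \<and> J xs t m)
          (s'\<lparr>regs := (regs s')(rV := v), lvars := (lvars s')(It := xs)\<rparr>) (n' + 3)"
        using x' inv' by (auto simp: wps_Cond bounded_def eval_nat_numeral intro!: J1)
    next
      fix s' n'
      assume J: "J [] s' n'" and same: "same (rV :=\<^sub>R Top (Lst It) ;; It :=\<^sub>S Pop (Lst It) ;; ?b3) ?t1 s'"
      have "tables s' Out = (tables s Out)(compl x := filter ?p ?out)" using same t(4) by (simp add: same_def)
      then have "out_lists L ?A' s'" using ol unfolding out_lists_def by (auto simp: sorted_wrt_filter)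
      moreover from J have "tables s' In = (tables s In)(x := rev (filter (\<lambda>v. v \<noteq> compl x) ?in))"
        "n' \<le> m + 2 + 5 * length ?in" unfolding J_def by auto
      then have "in_lists ?A' s'" "n' \<le> m + 2 + 5 * length ?in" using il unfolding in_lists_def by auto
      ultimately show "?Q s' (Suc n')" using t(5) inlens by simp
    qed (use inv_t1 in auto)
    then show ?thesis using t inlens inv_t1 by (simp add: bounded_def eval_nat_numeral)
  qed
  have "wps inv ?c1 (wps inv (Out\<lbrakk>Co (Reg rX)\<rbrakk> :=\<^sub>T Empty ;; ?c2 ;; ?c3) ?Q) ?s1 (n + 2)"
  proof (rule wps_conseq[OF push_filter[where p = ?p, OF inv1]])
    fix t m
    assume post: "lvars t Tmp = rev (filter ?p (lvars ?s1 It)) @ lvars ?s1 Tmp \<and> m \<le> n + 2 + 5 * length (lvars ?s1 It) + 1"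
      and same: "same ?c1 ?s1 t" and inv_t: "inv t"
    have eq: "regs t rX = x" "tables t = tables s" using same x by (auto simp: same_def)
    have tmp: "lvars t Tmp = rev (filter ?p ?out)" using post by simp
    note flen = le_trans[OF length_filter_le[of ?p ?out] lens(1)] le_trans[OF length_filter_le[of ?p ?out] lens(3)]
    let ?t1 = "t\<lparr>tables := (tables t)(Out := (tables t Out)(compl x := []))\<rparr>"
    have inv_t1: "inv ?t1" using inv_t by (simp add: bounded_def)
    have "wps inv ?c2 (wps inv ?c3 ?Q) ?t1 (Suc m)"
    proof (rule wps_conseq[OF push_cell[where w = "compl x", OF inv_t1]])
      show "length (lvars ?t1 Tmp) + length (tables ?t1 Out (compl x)) \<le> cap Out (compl x)"
        using tmp flen lens by simp
      fix t' m'
      assume post2: "tables t' Out = (tables ?t1 Out)(compl x := rev (lvars ?t1 Tmp) @ tables ?t1 Out (compl x)) \<and>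
          m' \<le> Suc m + 4 * length (lvars ?t1 Tmp) + 1" and same2: "same ?c2 ?t1 t'" and inv_t': "inv t'"
      show "wps inv ?c3 ?Q t' m'"
      proof (rule loop3[OF inv_t'])
        show "regs t' rX = x" "tables t' In = tables s In" using same2 eq by (auto simp: same_def)
        show "tables t' Out = (tables s Out)(compl x := filter ?p ?out)" using post2 tmp eq by simp
        show "m' \<le> n + 9 * card A0 + 5" using post2 post tmp flen lens by simp
      qed
    qed (use eq in simp)
    then show "wps inv (Out\<lbrakk>Co (Reg rX)\<rbrakk> :=\<^sub>T Empty ;; ?c2 ;; ?c3) ?Q t m"
      using inv_t1 eq by simp
  qed (use lens x in auto)
  then show ?thesis unfolding remove_unit_def using inv inv1 lens x by (simp add: bounded_def eval_nat_numeral)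
qed

end

section \<open>Building the implication digraph clause by clause\<close>

lemma idg_insert_unit: "parcs (idg (insert {a} C)) = insert (compl a, a) (parcs (idg C))"
proof -
  have "{compl u, v} = {a} \<longleftrightarrow> u = compl a \<and> v = a" for u v by auto
  then have "(u, v) \<in> parcs (idg (insert {a} C)) \<longleftrightarrow> (u, v) \<in> insert (compl a, a) (parcs (idg C))" for u v
    unfolding mem_idg insert_iff prod.inject by simp
  then show ?thesis by auto
qed

lemma idg_insert_binary:
  "parcs (idg (insert {a, b} C)) = insert (compl a, b) (insert (compl b, a) (parcs (idg C)))"
proof -
  have "{compl u, v} = {a, b} \<longleftrightarrow> u = compl a \<and> v = b \<or> u = compl b \<and> v = a" for u v
    by (auto simp: doubleton_eq_iff)
  then have "(u, v) \<in> parcs (idg (insert {a, b} C)) \<longleftrightarrow>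
      (u, v) \<in> insert (compl a, b) (insert (compl b, a) (parcs (idg C)))" for u v
    unfolding mem_idg insert_iff prod.inject by simp
  then show ?thesis by auto
qed

lemma out_lists_insert:
  assumes "out_lists L A s" "\<And>w. (u, w) \<in> A \<Longrightarrow> (v, w) \<in> L \<and> v \<noteq> w"
    "\<And>w. tables t Out w = (if w = u then v # tables s Out u else tables s Out w)"
  shows "out_lists L (insert (u, v) A) t"
  using assms unfolding out_lists_def by auto

abbreviation flat :: "('v lit \<times> 'v lit) list \<Rightarrow> 'v lit list" where
  "flat bs \<equiv> concat (map (\<lambda>(a, b). [a, b]) bs)"

context ordered_network
begin

text \<open>The cell together with a new arc still lists distinct predecessors within
  \<open>A0\<close>, so the push respects its capacity.\<close>

lemma in_room:
  assumes "in_lists A s" "(u, v) \<notin> A" "insert (u, v) A \<subseteq> A0"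
  shows "Suc (length (tables s In v)) \<le> indeg A0 v"
proof -
  have "set (u # tables s In v) \<subseteq> {w. (w, v) \<in> A0}" "distinct (u # tables s In v)"
    using assms unfolding in_lists_def by auto
  moreover have "finite {w. (w, v) \<in> A0}" using arcs_V finite_V by (auto intro: finite_subset[of _ V])
  ultimately show ?thesis unfolding indeg_def using card_mono distinct_card by (metis length_Cons)
qed

lemma out_room:
  assumes "out_lists L A s" "(u, v) \<notin> A" "insert (u, v) A \<subseteq> A0"
  shows "Suc (length (tables s Out u)) \<le> outdeg A0 u"
proof -
  have "set (v # tables s Out u) \<subseteq> {w. (u, w) \<in> A0}" "distinct (v # tables s Out u)"
    using assms sorted_wrt_distinct[of L "tables s Out u"] unfolding out_lists_def by auto
  moreover have "finite {w. (u, w) \<in> A0}" using arcs_V finite_V by (auto intro: finite_subset[of _ V])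
  ultimately show ?thesis unfolding outdeg_def using card_mono distinct_card by (metis length_Cons)
qed

lemma build_units:
  assumes inv: "inv s" and empty: "tables s = (\<lambda>_ _. [])" and us: "distinct (lvars s It)"
    and sub: "(\<lambda>a. {a}) ` set (lvars s It) \<subseteq> F" and A0: "A0 = parcs (idg F)"
  shows "wps inv (for_each rV It (IsUnit\<lbrakk>Reg rV\<rbrakk> :=\<^sub>T Push (Reg rV) Empty ;;
       In\<lbrakk>Reg rV\<rbrakk> :=\<^sub>T Push (Co (Reg rV)) (Tab In (Reg rV))))
    (\<lambda>t m. in_lists (parcs (idg ((\<lambda>a. {a}) ` set (lvars s It)))) t \<and>
      (\<forall>v. tables t IsUnit v \<noteq> [] \<longleftrightarrow> v \<in> set (lvars s It)) \<and> m \<le> n + 5 * length (lvars s It) + 1) s n"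
proof -
  let ?b = "IsUnit\<lbrakk>Reg rV\<rbrakk> :=\<^sub>T Push (Reg rV) Empty ;; In\<lbrakk>Reg rV\<rbrakk> :=\<^sub>T Push (Co (Reg rV)) (Tab In (Reg rV))"
  define G where "G = (\<lambda>Y :: 'v lit list. parcs (idg ((\<lambda>a. {a}) ` set Y)))"
  define J where "J = (\<lambda>xs (t :: 'v store) m. \<exists>Y. lvars s It = Y @ xs \<and> in_lists (G Y) t \<and>
    (\<forall>v. tables t IsUnit v \<noteq> [] \<longleftrightarrow> v \<in> set Y) \<and> m \<le> n + 5 * length Y)"
  show ?thesis
  proof (rule wps_for_each[where J = J])
    show "J (lvars s It) s n" unfolding J_def
      by (intro exI[of _ "[]"]) (auto simp: empty in_lists_def G_def mem_idg)
    fix x xs s' n'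
    assume J: "J (x # xs) s' n'" and l: "lvars s' It = x # xs" and inv': "inv s'"
    from J obtain Y where Y: "lvars s It = Y @ x # xs" "in_lists (G Y) s'"
      "\<forall>v. tables s' IsUnit v \<noteq> [] \<longleftrightarrow> v \<in> set Y" "n' \<le> n + 5 * length Y" unfolding J_def by auto
    have ins: "G (Y @ [x]) = insert (compl x, x) (G Y)" by (simp add: G_def idg_insert_unit)
    have new: "(compl x, x) \<notin> G Y" using us Y(1) by (auto simp: G_def mem_idg)
    have "G (Y @ [x]) \<subseteq> A0" unfolding G_def A0 using sub Y(1) by (intro idg_mono) auto
    then have room: "Suc (length (tables s' In x)) \<le> indeg A0 x"
      using in_room[OF Y(2) new] ins by simp
    then have "indeg A0 x \<noteq> 0" by simp
    \<comment> \<open>The existence of an incoming arc shows that \<open>x\<close> is a vertex, so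
      that its \<open>IsUnit\<close> cell may hold a mark.\<close>
    then have x: "x \<in> V" unfolding indeg_def using arcs_V by (metis (no_types, lifting) card.empty empty_Collect_eq mem_Sigma_iff subsetD)
    have "length xs \<le> K" using lbD[of K "lvars s'" It] inv' l by (simp add: bounded_def)
    moreover have J1: "J xs t m" if "\<And>w. tables t In w = (if w = x then compl x # tables s' In x else tables s' In w)"
      "\<And>w. tables t IsUnit w = (if w = x then [x] else tables s' IsUnit w)" "m \<le> n' + 5" for t m
    proof -
      have "in_lists (G (Y @ [x])) t" unfolding ins by (rule in_lists_insert[OF Y(2) new that(1)])
      then show ?thesis using that(2,3) Y unfolding J_def by (intro exI[of _ "Y @ [x]"]) auto
    qed
    ultimately show "wps inv ?b (\<lambda>t m. lvars t It = xs \<and> J xs t m)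
        (s'\<lparr>regs := (regs s')(rV := x), lvars := (lvars s')(It := xs)\<rparr>) (n' + 3)"
      using room inv' x by (auto simp: bounded_def eval_nat_numeral intro!: J1)
  next
    fix s' n' assume "J [] s' n'"
    then show "in_lists (parcs (idg ((\<lambda>a. {a}) ` set (lvars s It)))) s' \<and>
      (\<forall>v. tables s' IsUnit v \<noteq> [] \<longleftrightarrow> v \<in> set (lvars s It)) \<and> Suc n' \<le> n + 5 * length (lvars s It) + 1"
      unfolding J_def G_def by auto
  qed (use inv in auto)
qed

text \<open>The rule for \<open>for_each\<close> does not apply, because the body itself removes a
  second entry from \<open>It\<close>; the loop rule is used with the number of remaining clauses as
  variant. The two literals of a clause differ, so its two arcs are distinct and both are
  new.\<close>

lemma build_binary:
  assumes inv: "inv s" and il: "in_lists (parcs (idg C)) s" and it: "lvars s It = flat bs"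
    and dist: "distinct (map (\<lambda>(a, b). {a, b}) bs)" "(\<lambda>(a, b). {a, b}) ` set bs \<inter> C = {}"
    and sub: "(\<lambda>(a, b). {a, b}) ` set bs \<union> C \<subseteq> F" and neq: "\<forall>(a, b) \<in> set bs. a \<noteq> b" and A0: "A0 = parcs (idg F)"
  shows "wps inv (for_each rV It (rW :=\<^sub>R Top (Lst It) ;; It :=\<^sub>S Pop (Lst It) ;;
       In\<lbrakk>Reg rV\<rbrakk> :=\<^sub>T Push (Co (Reg rW)) (Tab In (Reg rV)) ;;
       In\<lbrakk>Reg rW\<rbrakk> :=\<^sub>T Push (Co (Reg rV)) (Tab In (Reg rW))))
    (\<lambda>t m. in_lists (parcs (idg ((\<lambda>(a, b). {a, b}) ` set bs \<union> C))) t \<and> m \<le> n + 7 * length bs + 1) s n"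
  unfolding for_each_def
proof -
  let ?b = "rV :=\<^sub>R Top (Lst It) ;; It :=\<^sub>S Pop (Lst It) ;; rW :=\<^sub>R Top (Lst It) ;; It :=\<^sub>S Pop (Lst It) ;;
       In\<lbrakk>Reg rV\<rbrakk> :=\<^sub>T Push (Co (Reg rW)) (Tab In (Reg rV)) ;;
       In\<lbrakk>Reg rW\<rbrakk> :=\<^sub>T Push (Co (Reg rV)) (Tab In (Reg rW))"
  define G where "G = (\<lambda>Y :: ('v lit \<times> 'v lit) list. parcs (idg ((\<lambda>(a, b). {a, b}) ` set Y \<union> C)))"
  define J where "J = (\<lambda>k (t :: 'v store) m. \<exists>Y zs. bs = Y @ zs \<and> lvars t It = flat zs \<and> k = length zs \<and>
    in_lists (G Y) t \<and> m \<le> n + 7 * length Y)"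
  show "wps inv (WHILE NotB (IsEmpty (Lst It)) DO ?b)
    (\<lambda>t m. in_lists (parcs (idg ((\<lambda>(a, b). {a, b}) ` set bs \<union> C))) t \<and> m \<le> n + 7 * length bs + 1) s n"
  proof (rule wps_While[where J = J])
    show "J (length bs) s n" unfolding J_def using it il by (intro exI[of _ "[]"] exI[of _ bs]) (auto simp: G_def)
  next
    fix k s' n'
    assume J: "J k s' n'" and inv': "inv s'" and bv: "bval (NotB (IsEmpty (Lst It))) s'"
    from J obtain Y zs where Y: "bs = Y @ zs" "lvars s' It = flat zs" "k = length zs" "in_lists (G Y) s'"
      "n' \<le> n + 7 * length Y" unfolding J_def by auto
    from bv Y(2) obtain a b zs' where zs: "zs = (a, b) # zs'" by (cases zs) auto
    have ab: "a \<noteq> b" using neq Y(1) zs by auto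
    have ins: "G (Y @ [(a, b)]) = insert (compl a, b) (insert (compl b, a) (G Y))"
      by (simp add: G_def idg_insert_binary)
    have "{a, b} \<notin> (\<lambda>(a, b). {a, b}) ` set Y \<union> C" using dist Y(1) zs by auto
    then have new: "(compl a, b) \<notin> insert (compl b, a) (G Y)" "(compl b, a) \<notin> G Y"
      using ab by (auto simp: G_def mem_idg insert_commute)
    have sub': "G (Y @ [(a, b)]) \<subseteq> A0" unfolding G_def A0 using sub Y(1) zs by (intro idg_mono) auto
    define s1 where "s1 = s'\<lparr>tables := (tables s')(In := (tables s' In)(a := compl b # tables s' In a))\<rparr>"
    have il1: "in_lists (insert (compl b, a) (G Y)) s1"
      by (rule in_lists_insert[OF Y(4) new(2)]) (simp add: s1_def)
    have room: "Suc (length (tables s' In a)) \<le> indeg A0 a" "Suc (length (tables s' In b)) \<le> indeg A0 b"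
      using in_room[OF Y(4) new(2)] in_room[OF il1 new(1)] sub' ab unfolding ins by (auto simp: s1_def)
    have "length (flat zs) \<le> K" using lbD[of K "lvars s'" It] inv' Y(2) by (simp add: bounded_def)
    then have len: "Suc (Suc (length (flat zs'))) \<le> K" unfolding zs by simp
    have J1: "\<exists>k'<k. J k' t m"
      if "\<And>w. tables t In w = (if w = b then compl a # tables s' In b else if w = a then compl b # tables s' In a else tables s' In w)"
        "lvars t It = flat zs'" "m \<le> n' + 7" for t m
    proof -
      have "in_lists (G (Y @ [(a, b)])) t" unfolding ins
        by (rule in_lists_insert[OF il1 new(1)]) (use that(1) ab in \<open>auto simp: s1_def\<close>)
      then have "J (length zs') t m" using that Y zs unfolding J_def
        by (intro exI[of _ "Y @ [(a, b)]"] exI[of _ zs']) auto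
      then show ?thesis using Y(3) zs by (intro exI[of _ "length zs'"]) auto
    qed
    show "wps inv ?b (\<lambda>t m. \<exists>k'<k. J k' t m) s' (Suc n')"
      using room inv' len Y(2) ab zs by (auto simp: bounded_def intro!: J1)
  next
    fix k s' n' assume "J k s' n'" "\<not> bval (NotB (IsEmpty (Lst It))) s'"
    then obtain Y zs where Y: "bs = Y @ zs" "flat zs = []" "in_lists (G Y) s'" "n' \<le> n + 7 * length Y"
      unfolding J_def by auto
    then have "zs = []" by (cases zs) auto
    with Y show "in_lists (parcs (idg ((\<lambda>(a, b). {a, b}) ` set bs \<union> C))) s' \<and> Suc n' \<le> n + 7 * length bs + 1"
      unfolding G_def by auto
  qed (use inv in auto)
qed

abbreviation add_arcs :: com where
  "add_arcs \<equiv> for_each rW It (Out\<lbrakk>Reg rW\<rbrakk> :=\<^sub>T Push (Reg rV) (Tab Out (Reg rW)))"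

text \<open>\<open>T\<close> contains the heads already treated, all larger than \<open>v\<close>;
  pushing \<open>v\<close> to the front keeps every cell sorted.\<close>

lemma build_out_arcs:
  assumes inv: "inv s" and v: "regs s rV = v" and it: "distinct (lvars s It)" "set (lvars s It) = {u. (u, v) \<in> A0}"
    and ol: "out_lists L {(u, w) \<in> A0. w \<in> T} s" and T: "\<forall>w\<in>T. (v, w) \<in> L \<and> v \<noteq> w"
  shows "wps inv add_arcs (\<lambda>t m. out_lists L {(u, w) \<in> A0. w \<in> insert v T} t \<and>
    m \<le> n + 4 * length (lvars s It) + 1) s n"
proof -
  let ?b = "Out\<lbrakk>Reg rW\<rbrakk> :=\<^sub>T Push (Reg rV) (Tab Out (Reg rW))"
  define B where "B = (\<lambda>Y. {(u, w) \<in> A0. w \<in> T \<or> w = v \<and> u \<in> set Y})"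
  define J where "J = (\<lambda>xs (t :: 'v store) m. \<exists>Y. lvars s It = Y @ xs \<and> out_lists L (B Y) t \<and> m \<le> n + 4 * length Y)"
  show ?thesis
  proof (rule wps_for_each[where J = J])
    show "J (lvars s It) s n" unfolding J_def using ol by (auto simp: B_def)
    fix u xs s' n'
    assume J: "J (u # xs) s' n'" and l: "lvars s' It = u # xs" and inv': "inv s'"
      and same: "same (rW :=\<^sub>R Top (Lst It) ;; It :=\<^sub>S Pop (Lst It) ;; ?b) s s'"
    from J obtain Y where Y: "lvars s It = Y @ u # xs" "out_lists L (B Y) s'" "n' \<le> n + 4 * length Y"
      unfolding J_def by auto
    have v': "regs s' rV = v" using same v by (simp add: same_def)
    have "u \<in> set (lvars s It)" using Y(1) by simp
    then have arc: "(u, v) \<in> A0" using it(2) by simp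
    have uY: "u \<notin> set Y" using it(1) Y(1) by auto
    have ins: "B (Y @ [u]) = insert (u, v) (B Y)" using arc by (auto simp: B_def)
    have new: "(u, v) \<notin> B Y" using uY T by (auto simp: B_def)
    have sub: "insert (u, v) (B Y) \<subseteq> A0" using arc by (auto simp: B_def)
    note room = out_room[OF Y(2) new sub]
    have "length xs \<le> K" using lbD[of K "lvars s'" It] inv' l by (simp add: bounded_def)
    moreover have J1: "J xs t m"
      if "\<And>w. tables t Out w = (if w = u then v # tables s' Out u else tables s' Out w)" "m \<le> n' + 4" for t m
    proof -
      have "out_lists L (B (Y @ [u])) t" unfolding ins
        by (rule out_lists_insert[OF Y(2) _ that(1)]) (use T uY in \<open>auto simp: B_def\<close>)
      then show ?thesis using that(2) Y unfolding J_def by (intro exI[of _ "Y @ [u]"]) auto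
    qed
    ultimately show "wps inv ?b (\<lambda>t m. lvars t It = xs \<and> J xs t m)
        (s'\<lparr>regs := (regs s')(rW := u), lvars := (lvars s')(It := xs)\<rparr>) (n' + 3)"
      using room inv' v' by (auto simp: bounded_def eval_nat_numeral intro!: J1)
  next
    fix s' n' assume J: "J [] s' n'"
    have "B (lvars s It) = {(u, w) \<in> A0. w \<in> insert v T}" using it(2) by (auto simp: B_def)
    with J show "out_lists L {(u, w) \<in> A0. w \<in> insert v T} s' \<and> Suc n' \<le> n + 4 * length (lvars s It) + 1"
      unfolding J_def by auto
  qed (use inv in auto)
qed

lemma build_out:
  assumes inv: "inv s" and il: "in_lists A0 s" and tmp: "lvars s Tmp = rev ls" and empty: "tables s Out = (\<lambda>_. [])"
  shows "wps inv (for_each rV Tmp (It :=\<^sub>S Tab In (Reg rV) ;; add_arcs))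
    (\<lambda>t m. out_lists L A0 t \<and> m \<le> n + 5 * card V + 4 * card A0 + 1) s n"
proof -
  let ?b = "It :=\<^sub>S Tab In (Reg rV) ;; add_arcs"
  \<comment> \<open>\<open>Tmp\<close> holds the order reversed, so the treated heads always form a
    final segment \<open>T\<close> of \<open>ls\<close>.\<close>
  define J where "J = (\<lambda>xs (t :: 'v store) m. \<exists>T. ls = rev xs @ T \<and> out_lists L {(u, w) \<in> A0. w \<in> set T} t \<and>
    m \<le> n + (\<Sum>v\<leftarrow>T. 5 + 4 * indeg A0 v))"
  show ?thesis
  proof (rule wps_for_each[where J = J])
    show "J (lvars s Tmp) s n" unfolding J_def tmp by (auto simp: empty out_lists_def)
    fix v xs s' n'
    assume J: "J (v # xs) s' n'" and l: "lvars s' Tmp = v # xs" and inv': "inv s'"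
      and same: "same (rV :=\<^sub>R Top (Lst Tmp) ;; Tmp :=\<^sub>S Pop (Lst Tmp) ;; ?b) s s'"
    from J obtain T where T: "ls = rev xs @ v # T" "out_lists L {(u, w) \<in> A0. w \<in> set T} s'"
      "n' \<le> n + (\<Sum>v\<leftarrow>T. 5 + 4 * indeg A0 v)" unfolding J_def by auto
    have In: "tables s' In = tables s In" using same by (simp add: same_def)
    have less: "\<forall>w\<in>set T. (v, w) \<in> L \<and> v \<noteq> w" using sorted_ls T(1) by (simp add: sorted_wrt_append)
    let ?s1 = "s'\<lparr>regs := (regs s')(rV := v), lvars := (lvars s')(Tmp := xs, It := tables s In v)\<rparr>"
    have lens: "length xs \<le> K" using lbD[of K "lvars s'" Tmp] inv' l by (simp add: bounded_def)
    have "length (tables s' In v) \<le> K" using inv' by (simp add: bounded_def)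
    then have inv1: "inv ?s1" using inv' lens In by (simp add: bounded_def)
    have il_v: "distinct (tables s In v)" "set (tables s In v) = {u. (u, v) \<in> A0}" "length (tables s In v) = indeg A0 v"
      using il in_lists_length[OF il] by (auto simp: in_lists_def)
    have "wps inv add_arcs (\<lambda>t m. lvars t Tmp = xs \<and> J xs t m) ?s1 (n' + 4)"
    proof (rule wps_conseq[OF build_out_arcs[OF inv1, of v "set T"]])
      show "out_lists L {(u, w). (u, w) \<in> A0 \<and> w \<in> set T} ?s1" using T(2) by (simp add: out_lists_def)
      fix t m
      assume post: "out_lists L {(u, w). (u, w) \<in> A0 \<and> w \<in> insert v (set T)} t \<and> m \<le> n' + 4 + 4 * length (lvars ?s1 It) + 1"
        and "same add_arcs ?s1 t"
      then have "lvars t Tmp = xs" by (simp add: same_def)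
      moreover have "J xs t m" unfolding J_def using post T il_v(3) by (intro exI[of _ "v # T"]) auto
      ultimately show "lvars t Tmp = xs \<and> J xs t m" by simp
    qed (use il_v less in auto)
    then show "wps inv ?b (\<lambda>t m. lvars t Tmp = xs \<and> J xs t m)
        (s'\<lparr>regs := (regs s')(rV := v), lvars := (lvars s')(Tmp := xs)\<rparr>) (n' + 3)"
      using inv1 In by (simp add: eval_nat_numeral)
  next
    fix s' n' assume "J [] s' n'"
    then have J: "out_lists L {(u, w) \<in> A0. w \<in> V} s'" "n' \<le> n + (\<Sum>v\<leftarrow>ls. 5 + 4 * indeg A0 v)"
      unfolding J_def set_ls[symmetric] by auto
    have "{(u, w) \<in> A0. w \<in> V} = A0" using arcs_V by auto
    moreover have "(\<Sum>v\<leftarrow>ls. 5 + 4 * indeg A0 v) \<le> 5 * card V + 4 * card A0"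
      using distinct_ls set_ls by (intro weight_le) auto
    ultimately show "out_lists L A0 s' \<and> Suc n' \<le> n + 5 * card V + 4 * card A0 + 1" using J by simp
  qed (use inv in auto)
qed

lemma reverse_order:
  assumes inv: "inv s" and len: "length (lvars s It) \<le> K" and tmp: "lvars s Tmp = []"
  shows "wps inv (for_each rV It (Tmp :=\<^sub>S Push (Reg rV) (Lst Tmp)))
    (\<lambda>t m. lvars t Tmp = rev (lvars s It) \<and> m \<le> n + 4 * length (lvars s It) + 1) s n"
proof -
  define J where "J = (\<lambda>xs (t :: 'v store) m. \<exists>Y. lvars s It = Y @ xs \<and> lvars t Tmp = rev Y \<and> m \<le> n + 4 * length Y)"
  show ?thesis
  proof (rule wps_for_each[where J = J])
    show "J (lvars s It) s n" unfolding J_def using tmp by auto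
    fix x xs s' n'
    assume J: "J (x # xs) s' n'" and l: "lvars s' It = x # xs" and inv': "inv s'"
    from J obtain Y where Y: "lvars s It = Y @ x # xs" "lvars s' Tmp = rev Y" "n' \<le> n + 4 * length Y"
      unfolding J_def by auto
    have "J xs t m" if "lvars t Tmp = x # lvars s' Tmp" "m \<le> n' + 4" for t m
      using that Y unfolding J_def by (intro exI[of _ "Y @ [x]"]) auto
    then show "wps inv (Tmp :=\<^sub>S Push (Reg rV) (Lst Tmp)) (\<lambda>t m. lvars t It = xs \<and> J xs t m)
        (s'\<lparr>regs := (regs s')(rV := x), lvars := (lvars s')(It := xs)\<rparr>) (n' + 3)"
      using inv' len Y(1,2) by (auto simp: bounded_def eval_nat_numeral)
  next
    fix s' n' assume "J [] s' n'"
    then show "lvars s' Tmp = rev (lvars s It) \<and> Suc n' \<le> n + 4 * length (lvars s It) + 1"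
      unfolding J_def by auto
  qed (use inv in auto)
qed


lemma build_idg_spec:
  assumes inv: "inv s" and empty: "tables s = (\<lambda>_ _. [])"
    and store: "lvars s Units = us" "lvars s Bins = flat bs" "lvars s Ord = ls"
    and us: "distinct us" "set us = {a. {a} \<in> F}"
    and bs: "distinct (map (\<lambda>(a, b). {a, b}) bs)" "(\<lambda>(a, b). {a, b}) ` set bs = {C \<in> F. card C = 2}"
    and card: "\<forall>C\<in>F. card C = 1 \<or> card C = 2" and A0: "A0 = parcs (idg F)"
  shows "wps inv build_idg
    (\<lambda>t m. in_lists A0 t \<and> out_lists L A0 t \<and> (\<forall>v. tables t IsUnit v \<noteq> [] \<longleftrightarrow> {v} \<in> F) \<and>
      m \<le> n + 5 * length us + 7 * length bs + 9 * card V + 4 * card A0 + 8) s n"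
proof -
  define C where "C = (\<lambda>a. {a}) ` set us"
  have C: "C = {C \<in> F. card C = 1}" using us(2) by (auto simp: C_def card_1_singleton_iff)
  have F: "(\<lambda>(a, b). {a, b}) ` set bs \<union> C = F" using card unfolding bs(2) C by auto
  have neq: "\<forall>(a, b)\<in>set bs. a \<noteq> b"
  proof clarify
    fix b assume "(b, b) \<in> set bs"
    then have "{b, b} \<in> {C \<in> F. card C = 2}" unfolding bs(2)[symmetric] by force
    then show False by simp
  qed
  let ?Q = "\<lambda>t m. in_lists A0 t \<and> out_lists L A0 t \<and> (\<forall>v. tables t IsUnit v \<noteq> [] \<longleftrightarrow> {v} \<in> F) \<and>
      m \<le> n + 5 * length us + 7 * length bs + 9 * card V + 4 * card A0 + 8"
  let ?f1 = "for_each rV It (IsUnit\<lbrakk>Reg rV\<rbrakk> :=\<^sub>T Push (Reg rV) Empty ;;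
       In\<lbrakk>Reg rV\<rbrakk> :=\<^sub>T Push (Co (Reg rV)) (Tab In (Reg rV)))"
  let ?f2 = "for_each rV It (rW :=\<^sub>R Top (Lst It) ;; It :=\<^sub>S Pop (Lst It) ;;
       In\<lbrakk>Reg rV\<rbrakk> :=\<^sub>T Push (Co (Reg rW)) (Tab In (Reg rV)) ;;
       In\<lbrakk>Reg rW\<rbrakk> :=\<^sub>T Push (Co (Reg rV)) (Tab In (Reg rW)))"
  let ?f3 = "for_each rV It (Tmp :=\<^sub>S Push (Reg rV) (Lst Tmp))"
  let ?f4 = "for_each rV Tmp (It :=\<^sub>S Tab In (Reg rV) ;; add_arcs)"
  let ?s1 = "s\<lparr>lvars := (lvars s)(It := us)\<rparr>"
  have len: "length us \<le> K" "length (flat bs) \<le> K" "length ls \<le> K"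
    using inv store lbD[of K "lvars s" Units] lbD[of K "lvars s" Bins] lbD[of K "lvars s" Ord]
    by (auto simp: bounded_def)
  have inv1: "inv ?s1" using inv len by (simp add: bounded_def)
  have "wps inv ?f1 (wps inv (It :=\<^sub>S Lst Bins ;; ?f2 ;; It :=\<^sub>S Lst Ord ;; Tmp :=\<^sub>S Empty ;; ?f3 ;; ?f4) ?Q) ?s1 (Suc n)"
  proof (rule wps_conseq[OF build_units[OF inv1, of F]])
    fix t m
    assume post: "in_lists (parcs (idg ((\<lambda>a. {a}) ` set (lvars ?s1 It)))) t \<and>
      (\<forall>v. tables t IsUnit v \<noteq> [] \<longleftrightarrow> v \<in> set (lvars ?s1 It)) \<and> m \<le> Suc n + 5 * length (lvars ?s1 It) + 1"
      and same: "same ?f1 ?s1 t" and inv_t: "inv t"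
    let ?t1 = "t\<lparr>lvars := (lvars t)(It := flat bs)\<rparr>"
    have t: "lvars t Bins = flat bs" "lvars t Ord = ls" "tables t Out = (\<lambda>_. [])"
      using same store empty by (auto simp: same_def)
    have inv_t1: "inv ?t1" using inv_t len by (simp add: bounded_def)
    have "wps inv ?f2 (wps inv (It :=\<^sub>S Lst Ord ;; Tmp :=\<^sub>S Empty ;; ?f3 ;; ?f4) ?Q) ?t1 (Suc m)"
    proof (rule wps_conseq[OF build_binary[OF inv_t1, of C bs F]])
      show "in_lists (parcs (idg C)) ?t1" using post by (simp add: in_lists_def C_def)
      show "(\<lambda>(a, b). {a, b}) ` set bs \<inter> C = {}" unfolding bs(2) C by auto
      fix u k
      assume post2: "in_lists (parcs (idg ((\<lambda>(a, b). {a, b}) ` set bs \<union> C))) u \<and> k \<le> Suc m + 7 * length bs + 1"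
        and same2: "same ?f2 ?t1 u" and inv_u: "inv u"
      let ?u1 = "u\<lparr>lvars := (lvars u)(It := ls, Tmp := [])\<rparr>"
      have u: "lvars u Ord = ls" "tables u Out = (\<lambda>_. [])" "tables u IsUnit = tables t IsUnit"
        using same2 t by (auto simp: same_def)
      have inv_u1: "inv ?u1" using inv_u len by (simp add: bounded_def)
      have "wps inv ?f3 (wps inv ?f4 ?Q) ?u1 (k + 2)"
      proof (rule wps_conseq[OF reverse_order[OF inv_u1]])
        fix v j
        assume post3: "lvars v Tmp = rev (lvars ?u1 It) \<and> j \<le> k + 2 + 4 * length (lvars ?u1 It) + 1"
          and same3: "same ?f3 ?u1 v" and inv_v: "inv v"
        have v: "tables v = tables u" using same3 by (auto simp: same_def)
        show "wps inv ?f4 ?Q v j"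
        proof (rule wps_conseq[OF build_out[OF inv_v]])
          show il: "in_lists A0 v" using post2 v unfolding F A0 by (simp add: in_lists_def)
          fix w i
          assume post4: "out_lists L A0 w \<and> i \<le> j + 5 * card V + 4 * card A0 + 1" and same4: "same ?f4 v w"
          have w: "tables w In = tables v In" "tables w IsUnit = tables t IsUnit"
            using same4 v u by (auto simp: same_def)
          have "\<forall>v. tables w IsUnit v \<noteq> [] \<longleftrightarrow> {v} \<in> F" using post us(2) unfolding w(2) by simp
          moreover have "in_lists A0 w" using il w(1) by (simp add: in_lists_def)
          moreover have "i \<le> n + 5 * length us + 7 * length bs + 9 * card V + 4 * card A0 + 8"
            using post post2 post3 post4 length_ls by simp
          ultimately show "?Q w i" using post4 by blast
        qed (use post3 v u in simp_all)
      qed (use len in simp_all)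
      then show "wps inv (It :=\<^sub>S Lst Ord ;; Tmp :=\<^sub>S Empty ;; ?f3 ;; ?f4) ?Q u k"
        using inv_u inv_u1 u len by (simp add: bounded_def eval_nat_numeral)
    qed (use bs neq F A0 in auto)
    then show "wps inv (It :=\<^sub>S Lst Bins ;; ?f2 ;; It :=\<^sub>S Lst Ord ;; Tmp :=\<^sub>S Empty ;; ?f3 ;; ?f4) ?Q t m"
      using inv_t1 t by simp
  qed (use us A0 empty in auto)
  then show ?thesis unfolding build_idg_def using inv1 store by simp
qed

section \<open>Comparing a path with its partner\<close>

lemma extract_last_part:
  assumes inv: "inv s" and it: "lvars s It = xs @ compl w # zs" and fwd: "lvars s Fwd = []"
    and w: "regs s rY = w" "compl w \<notin> set xs" and len: "length (lvars s It) \<le> K"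
  shows "wps inv (WHILE NotB (EqL (Top (Lst It)) (Co (Reg rY))) DO
        (Fwd :=\<^sub>S Push (Top (Lst It)) (Lst Fwd) ;; It :=\<^sub>S Pop (Lst It)))
    (\<lambda>t m. lvars t Fwd = rev xs \<and> m \<le> n + 3 * length xs + 1) s n"
proof -
  let ?b = "Fwd :=\<^sub>S Push (Top (Lst It)) (Lst Fwd) ;; It :=\<^sub>S Pop (Lst It)"
  define J where "J = (\<lambda>k (t :: 'v store) m. \<exists>Y ys. xs = Y @ ys \<and> k = length ys \<and> lvars t It = ys @ compl w # zs \<and>
    lvars t Fwd = rev Y \<and> m \<le> n + 3 * length Y)"
  show ?thesis
  proof (rule wps_While[where J = J])
    show "J (length xs) s n" unfolding J_def using it fwd by (intro exI[of _ "[]"] exI[of _ xs]) auto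
  next
    fix k s' n'
    assume J: "J k s' n'" and inv': "inv s'" and same: "same ?b s s'"
      and bv: "bval (NotB (EqL (Top (Lst It)) (Co (Reg rY)))) s'"
    from J obtain Y ys where Y: "xs = Y @ ys" "k = length ys" "lvars s' It = ys @ compl w # zs"
      "lvars s' Fwd = rev Y" "n' \<le> n + 3 * length Y" unfolding J_def by auto
    have "regs s' rY = w" using same w by (simp add: same_def)
    with bv Y(3) obtain y ys' where ys: "ys = y # ys'" by (cases ys) auto
    have J1: "\<exists>k'<k. J k' t m"
      if "lvars t It = ys' @ compl w # zs" "lvars t Fwd = y # lvars s' Fwd" "m \<le> n' + 3" for t m
      using that Y ys unfolding J_def by (intro exI[of _ "length ys'"] conjI exI[of _ "Y @ [y]"] exI[of _ ys']) auto
    show "wps inv ?b (\<lambda>t m. \<exists>k'<k. J k' t m) s' (Suc n')"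
      using inv' len it Y(1,3,4) ys by (auto simp: bounded_def intro!: J1)
  next
    fix k s' n'
    assume J: "J k s' n'" and same: "same ?b s s'" and bv: "\<not> bval (NotB (EqL (Top (Lst It)) (Co (Reg rY)))) s'"
    from J obtain Y ys where Y: "xs = Y @ ys" "lvars s' It = ys @ compl w # zs"
      "lvars s' Fwd = rev Y" "n' \<le> n + 3 * length Y" unfolding J_def by auto
    have "regs s' rY = w" using same w by (simp add: same_def)
    with bv Y(1,2) w(2) have "ys = []" by (cases ys) auto
    with Y show "lvars s' Fwd = rev xs \<and> Suc n' \<le> n + 3 * length xs + 1" by simp
  qed (use inv in auto)
qed

text \<open>\<open>R'\<close> is never built: its complemented word is the top of the stored path.
  Equal lengths ensure that both words end together.\<close>

lemma strip_common_prefix: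
  assumes inv: "inv s" and fwd: "lvars s Fwd = R" and it: "lvars s It = map compl R' @ zs" and len: "length R' = length R"
  shows "wps inv (WHILE AndB (NotB (IsEmpty (Lst Fwd))) (EqL (Top (Lst Fwd)) (Co (Top (Lst It)))) DO
        (Fwd :=\<^sub>S Pop (Lst Fwd) ;; It :=\<^sub>S Pop (Lst It)))
    (\<lambda>t m. (\<exists>r F F'. R = r @ F \<and> R' = r @ F' \<and> lvars t Fwd = F \<and> lvars t It = map compl F' @ zs \<and>
      (F \<noteq> [] \<longrightarrow> hd F \<noteq> hd F')) \<and> m \<le> n + 3 * length R + 1) s n"
proof -
  let ?b = "Fwd :=\<^sub>S Pop (Lst Fwd) ;; It :=\<^sub>S Pop (Lst It)"
  let ?e = "AndB (NotB (IsEmpty (Lst Fwd))) (EqL (Top (Lst Fwd)) (Co (Top (Lst It))))"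
  define J where "J = (\<lambda>k (t :: 'v store) m. \<exists>r F F'. R = r @ F \<and> R' = r @ F' \<and> k = length F \<and> lvars t Fwd = F \<and>
    lvars t It = map compl F' @ zs \<and> m \<le> n + 3 * length r)"
  show ?thesis
  proof (rule wps_While[where J = J])
    show "J (length R) s n" unfolding J_def using fwd it by (intro exI[of _ "[]"] exI[of _ R] exI[of _ R']) auto
  next
    fix k s' n'
    assume J: "J k s' n'" and inv': "inv s'" and bv: "bval ?e s'"
    from J obtain r F F' where r: "R = r @ F" "R' = r @ F'" "k = length F" "lvars s' Fwd = F"
      "lvars s' It = map compl F' @ zs" "n' \<le> n + 3 * length r" unfolding J_def by auto
    have "length F' = length F" using len r(1,2) by simp
    with bv r(4,5) obtain a F1 F1' where F: "F = a # F1" "F' = a # F1'" by (cases F; cases F') auto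
    have J1: "\<exists>k'<k. J k' t m" if "lvars t Fwd = F1" "lvars t It = map compl F1' @ zs" "m \<le> n' + 3" for t m
      using that r F unfolding J_def by (intro exI[of _ "length F1"] conjI exI[of _ "r @ [a]"] exI[of _ F1] exI[of _ F1']) auto
    have "length F \<le> K" "length (map compl F' @ zs) \<le> K"
      using inv' r(4,5) lbD[of K "lvars s'" Fwd] lbD[of K "lvars s'" It] by (auto simp: bounded_def)
    then show "wps inv ?b (\<lambda>t m. \<exists>k'<k. J k' t m) s' (Suc n')"
      using inv' r(4,5) F by (auto simp: bounded_def intro!: J1)
  next
    fix k s' n'
    assume J: "J k s' n'" and bv: "\<not> bval ?e s'"
    from J obtain r F F' where r: "R = r @ F" "R' = r @ F'" "k = length F" "lvars s' Fwd = F"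
      "lvars s' It = map compl F' @ zs" "n' \<le> n + 3 * length r" unfolding J_def by auto
    have "length F' = length F" using len r(1,2) by simp
    with bv r(4,5) have "F \<noteq> [] \<longrightarrow> hd F \<noteq> hd F'" by (cases F; cases F') auto
    with r show "(\<exists>r F F'. R = r @ F \<and> R' = r @ F' \<and> lvars s' Fwd = F \<and> lvars s' It = map compl F' @ zs \<and>
      (F \<noteq> [] \<longrightarrow> hd F \<noteq> hd F')) \<and> Suc n' \<le> n + 3 * length R + 1" by auto
  qed (use inv in auto)
qed

text \<open>\<open>Ord\<close> replaces the missing comparison: the literal met first is the smaller
  one, by antisymmetry.\<close>

lemma find_first:
  assumes inv: "inv s" and it: "lvars s It = ls" and r: "regs s rV \<in> V" "regs s rW \<in> V" "regs s rV \<noteq> regs s rW"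
  shows "wps inv (WHILE AndB (NotB (EqL (Top (Lst It)) (Reg rV))) (NotB (EqL (Top (Lst It)) (Reg rW)))
         DO It :=\<^sub>S Pop (Lst It))
    (\<lambda>t m. (hd (lvars t It) = regs s rV \<longleftrightarrow> (regs s rV, regs s rW) \<in> L) \<and> m \<le> n + 2 * card V + 1) s n"
proof -
  let ?a = "regs s rV" and ?b = "regs s rW"
  let ?e = "AndB (NotB (EqL (Top (Lst It)) (Reg rV))) (NotB (EqL (Top (Lst It)) (Reg rW)))"
  define J where "J = (\<lambda>k (t :: 'v store) m. \<exists>Y ys. ls = Y @ ys \<and> k = length ys \<and> lvars t It = ys \<and>
    ?a \<notin> set Y \<and> ?b \<notin> set Y \<and> m \<le> n + 2 * length Y)"
  show ?thesis
  proof (rule wps_While[where J = J])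
    show "J (length ls) s n" unfolding J_def using it by (intro exI[of _ "[]"] exI[of _ ls]) auto
  next
    fix k s' n'
    assume J: "J k s' n'" and inv': "inv s'" and same: "same (It :=\<^sub>S Pop (Lst It)) s s'" and bv: "bval ?e s'"
    from J obtain Y ys where Y: "ls = Y @ ys" "k = length ys" "lvars s' It = ys" "?a \<notin> set Y" "?b \<notin> set Y"
      "n' \<le> n + 2 * length Y" unfolding J_def by auto
    have "?a \<in> set ls" using r set_ls by simp
    with Y obtain y ys' where ys: "ys = y # ys'" by (cases ys) auto
    have J1: "\<exists>k'<k. J k' t m" if "lvars t It = ys'" "m \<le> n' + 2" for t m
      using that Y ys bv same unfolding J_def
      by (intro exI[of _ "length ys'"] conjI exI[of _ "Y @ [y]"] exI[of _ ys']) (auto simp: same_def)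
    have "length ys \<le> K" using inv' Y(3) lbD[of K "lvars s'" It] by (simp add: bounded_def)
    then show "wps inv (It :=\<^sub>S Pop (Lst It)) (\<lambda>t m. \<exists>k'<k. J k' t m) s' (Suc n')"
      using inv' Y(3) ys by (auto simp: bounded_def intro!: J1)
  next
    fix k s' n'
    assume J: "J k s' n'" and same: "same (It :=\<^sub>S Pop (Lst It)) s s'" and bv: "\<not> bval ?e s'"
    from J obtain Y ys where Y: "ls = Y @ ys" "lvars s' It = ys" "?a \<notin> set Y" "?b \<notin> set Y"
      "n' \<le> n + 2 * length Y" unfolding J_def by auto
    have "?a \<in> set ys" "?b \<in> set ys" using r set_ls Y by auto
    then obtain y ys' where ys: "ys = y # ys'" by (cases ys) auto
    have y: "y = ?a \<or> y = ?b" using bv Y(2) ys same by (auto simp: same_def)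
    have less: "\<forall>z\<in>set ys'. (y, z) \<in> L" using sorted_ls Y(1) ys by (auto simp: sorted_wrt_append)
    have "y = ?a \<longleftrightarrow> (?a, ?b) \<in> L"
    proof
      assume "y = ?a"
      with \<open>?b \<in> set ys\<close> ys r(3) less show "(?a, ?b) \<in> L" by auto
    next
      assume ab: "(?a, ?b) \<in> L"
      show "y = ?a"
      proof (rule ccontr)
        assume "y \<noteq> ?a"
        with y \<open>?a \<in> set ys\<close> ys less have "(?b, ?a) \<in> L" by auto
        with ab r(3) lin show False unfolding order_on_defs antisym_def by blast
      qed
    qed
    moreover have "length Y \<le> card V" using Y(1) length_ls by (metis le_add1 length_append)
    ultimately show "(hd (lvars s' It) = ?a \<longleftrightarrow> (?a, ?b) \<in> L) \<and> Suc n' \<le> n + 2 * card V + 1"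
      using Y ys by simp
  qed (use inv in auto)
qed

end

section \<open>Commands with output\<close>

text \<open>Unlike \<open>wps\<close>, this admits deliveries and printings; the postcondition
  therefore receives the whole trace and not just its length.\<close>

definition wp :: "('v store \<Rightarrow> bool) \<Rightarrow> com \<Rightarrow> ('v store \<Rightarrow> 'v event list \<Rightarrow> bool) \<Rightarrow> 'v store \<Rightarrow> bool" where
  "wp I c Q s \<longleftrightarrow> (\<exists>tr t. exec c s tr t \<and> (\<forall>s'. Step s' \<in> set tr \<longrightarrow> I s') \<and> Q t tr)"

definition silent :: "nat \<Rightarrow> 'v event list \<Rightarrow> bool" where
  "silent k tr \<longleftrightarrow> (\<forall>e\<in>set tr. is_step e) \<and> length tr \<le> k"

lemma wps_Seq_fun: "wps I (c1 ;; c2) Q = wps I c1 (wps I c2 Q)"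
  by (intro ext) simp

lemma exec_inv': "exec c s tr t \<Longrightarrow> I s \<Longrightarrow> \<forall>s'. Step s' \<in> set tr \<longrightarrow> I s' \<Longrightarrow> I t"
  by (induction rule: exec.induct) auto

lemma wp_conseq:
  assumes "wp I c Q s" "I s" "\<And>t tr. Q t tr \<Longrightarrow> same c s t \<Longrightarrow> I t \<Longrightarrow> Q' t tr"
  shows "wp I c Q' s"
proof -
  from assms(1) obtain tr t where *: "exec c s tr t" "\<forall>s'. Step s' \<in> set tr \<longrightarrow> I s'" "Q t tr"
    by (auto simp: wp_def)
  with assms(3)[OF *(3) exec_same[OF *(1)] exec_inv'[where I = I, OF *(1) assms(2) *(2)]] show ?thesis
    unfolding wp_def by blast
qed

lemma wp_wps:
  assumes "wps I c R s 0"
  shows "wp I c (\<lambda>t tr. silent (length tr) tr \<and> R t (length tr)) s"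
proof -
  from assms obtain tr t where *: "exec c s tr t" "\<forall>e\<in>set tr. \<exists>s'. e = Step s' \<and> I s'" "R t (0 + length tr)"
    by (rule wpsE)
  then show ?thesis unfolding wp_def silent_def by (intro exI[of _ tr] exI[of _ t]) force
qed

lemma wp_Seq:
  assumes "wp I c1 (\<lambda>t tr1. wp I c2 (\<lambda>u tr2. Q u (tr1 @ tr2)) t) s"
  shows "wp I (c1 ;; c2) Q s"
proof -
  from assms obtain tr1 t where 1: "exec c1 s tr1 t" "\<forall>s'. Step s' \<in> set tr1 \<longrightarrow> I s'"
    "wp I c2 (\<lambda>u tr2. Q u (tr1 @ tr2)) t" by (auto simp: wp_def)
  from 1(3) obtain tr2 u where 2: "exec c2 t tr2 u" "\<forall>s'. Step s' \<in> set tr2 \<longrightarrow> I s'" "Q u (tr1 @ tr2)"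
    by (auto simp: wp_def)
  from 1(2) 2 exec.Seq[OF 1(1) 2(1)] show ?thesis unfolding wp_def
    by (intro exI[of _ "tr1 @ tr2"] exI[of _ u]) auto
qed

text \<open>Regrouping turns a silent initial part into a single first command, to which
  \<open>wp_Seq_wps\<close> applies.\<close>

lemma wp_assoc: "wp I (c1 ;; c2 ;; c3) Q s \<longleftrightarrow> wp I ((c1 ;; c2) ;; c3) Q s"
proof -
  have "exec (c1 ;; c2 ;; c3) s tr t \<longleftrightarrow> exec ((c1 ;; c2) ;; c3) s tr t" for tr t
  proof
    assume "exec (c1 ;; c2 ;; c3) s tr t"
    then obtain tr1 s1 tr2 s2 tr3 where *: "tr = tr1 @ tr2 @ tr3" "exec c1 s tr1 s1" "exec c2 s1 tr2 s2" "exec c3 s2 tr3 t"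
      by (elim SeqE) auto
    from exec.Seq[OF exec.Seq[OF *(2,3)] *(4)] *(1) show "exec ((c1 ;; c2) ;; c3) s tr t" by simp
  next
    assume "exec ((c1 ;; c2) ;; c3) s tr t"
    then obtain tr1 s1 tr2 s2 tr3 where *: "tr = (tr1 @ tr2) @ tr3" "exec c1 s tr1 s1" "exec c2 s1 tr2 s2" "exec c3 s2 tr3 t"
      by (elim SeqE) auto
    from exec.Seq[OF *(2) exec.Seq[OF *(3,4)]] *(1) show "exec (c1 ;; c2 ;; c3) s tr t" by simp
  qed
  then show ?thesis unfolding wp_def by simp
qed

lemma wp_Seq_wps:
  assumes "wps I c1 R s 0" "I s"
    and "\<And>t tr1. R t (length tr1) \<Longrightarrow> silent (length tr1) tr1 \<Longrightarrow> same c1 s t \<Longrightarrow> I t \<Longrightarrow>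
      wp I c2 (\<lambda>u tr2. Q u (tr1 @ tr2)) t"
  shows "wp I (c1 ;; c2) Q s"
  by (rule wp_Seq, rule wp_conseq[OF wp_wps[OF assms(1)] assms(2)]) (use assms(3) in blast)

lemma wp_Cond:
  assumes "I s" "if bval b s then wp I c1 (\<lambda>t tr. Q t (Step s # tr)) s else wp I c2 (\<lambda>t tr. Q t (Step s # tr)) s"
  shows "wp I (IF b THEN c1 ELSE c2) Q s"
proof (cases "bval b s")
  case True
  with assms obtain tr t where "exec c1 s tr t" "\<forall>s'. Step s' \<in> set tr \<longrightarrow> I s'" "Q t (Step s # tr)"
    by (auto simp: wp_def)
  with assms(1) exec.IfTrue[OF True] show ?thesis unfolding wp_def by (intro exI[of _ "Step s # tr"] exI[of _ t]) auto
next
  case False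
  with assms obtain tr t where "exec c2 s tr t" "\<forall>s'. Step s' \<in> set tr \<longrightarrow> I s'" "Q t (Step s # tr)"
    by (auto simp: wp_def)
  with assms(1) exec.IfFalse[OF False] show ?thesis unfolding wp_def by (intro exI[of _ "Step s # tr"] exI[of _ t]) auto
qed

lemma wp_Skip: "I s \<Longrightarrow> Q s [Step s] \<Longrightarrow> wp I Skip Q s"
  unfolding wp_def by (intro exI[of _ "[Step s]"] exI[of _ s]) (auto intro: exec.Skip)

lemma wp_Deliver: "I s \<Longrightarrow> Q s [Step s, Delivered (rev (lvars s i))] \<Longrightarrow> wp I (Deliver i) Q s"
  unfolding wp_def by (intro exI[of _ "[Step s, Delivered (rev (lvars s i))]"] exI[of _ s]) (auto intro: exec.Deliver)

lemma wp_Print: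
  assumes "I s" "Q s (replicate (length (lvars s i)) (Step s) @ [Printed (F_of (rev (lvars s i)))])"
  shows "wp I (Print i) Q s"
  unfolding wp_def using assms
  by (intro exI[of _ "replicate (length (lvars s i)) (Step s) @ [Printed (F_of (rev (lvars s i)))]"] exI[of _ s])
    (auto intro: exec.Print)

section \<open>Delays of the delivered paths\<close>

lemma delays_append:
  "delays p (tr1 @ tr2) = butlast (delays p tr1) @ (last (delays p tr1) + hd (delays p tr2)) # tl (delays p tr2)"
proof (induction tr1)
  case Nil
  show ?case using delays_nonempty[of p tr2] by (cases "delays p tr2") auto
next
  case (Cons e tr1)
  obtain d ds where d: "delays p tr1 = d # ds" using delays_nonempty[of p tr1] by (cases "delays p tr1") auto
  show ?case
  proof (cases "p e")
    case True
    with Cons show ?thesis using delays_nonempty[of p tr1] by simp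
  next
    case False
    with Cons d show ?thesis by (cases e; cases ds) simp_all
  qed
qed

lemma delays_silent: "\<forall>e\<in>set tr. is_step e \<Longrightarrow> delays is_delivered tr = [length tr]"
proof (induction tr)
  case (Cons e tr)
  then show ?case by (cases e) auto
qed simp

text \<open>At least one path is delivered: the first after at most \<open>a\<close> steps, with at most \<open>b\<close> steps after the last.\<close>
definition mid :: "nat \<Rightarrow> nat \<Rightarrow> nat \<Rightarrow> 'v event list \<Rightarrow> bool" where
  "mid D a b tr \<longleftrightarrow> (\<exists>d1 ds d2. delays is_delivered tr = d1 # ds @ [d2] \<and> d1 \<le> a \<and> d2 \<le> b \<and> (\<forall>d\<in>set ds. d \<le> D))"

text \<open>Meant for initial parts of a whole run, possibly without any delivery. Only the last
  stretch is singled out by \<open>b\<close>, as it may still grow; the completed ones obey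
  \<open>D\<close>.\<close>

definition pre :: "nat \<Rightarrow> nat \<Rightarrow> 'v event list \<Rightarrow> bool" where
  "pre D b tr \<longleftrightarrow> (\<exists>ds d. delays is_delivered tr = ds @ [d] \<and> d \<le> b \<and> (\<forall>d\<in>set ds. d \<le> D))"

lemma silent_append: "silent k tr1 \<Longrightarrow> silent l tr2 \<Longrightarrow> silent (k + l) (tr1 @ tr2)"
  by (auto simp: silent_def)

lemma silent_mono: "silent k tr \<Longrightarrow> k \<le> l \<Longrightarrow> silent l tr"
  by (auto simp: silent_def)

lemma mid_mono: "mid D a b tr \<Longrightarrow> a \<le> a' \<Longrightarrow> b \<le> b' \<Longrightarrow> mid D a' b' tr"
  unfolding mid_def by fastforce

lemma pre_mono: "pre D b tr \<Longrightarrow> b \<le> b' \<Longrightarrow> pre D b' tr"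
  unfolding pre_def by fastforce

lemma silent_mid:
  assumes "silent k tr1" "mid D a b tr2"
  shows "mid D (k + a) b (tr1 @ tr2)"
proof -
  from assms(2) obtain d1 ds d2 where "delays is_delivered tr2 = d1 # ds @ [d2]" "d1 \<le> a" "d2 \<le> b" "\<forall>d\<in>set ds. d \<le> D"
    by (auto simp: mid_def)
  with assms(1) show ?thesis unfolding mid_def
    by (intro exI[of _ "length tr1 + d1"] exI[of _ ds] exI[of _ d2]) (auto simp: delays_append delays_silent silent_def)
qed

lemma mid_silent:
  assumes "mid D a b tr1" "silent k tr2"
  shows "mid D a (b + k) (tr1 @ tr2)"
proof -
  from assms(1) obtain d1 ds d2 where "delays is_delivered tr1 = d1 # ds @ [d2]" "d1 \<le> a" "d2 \<le> b" "\<forall>d\<in>set ds. d \<le> D"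
    by (auto simp: mid_def)
  with assms(2) show ?thesis unfolding mid_def
    by (intro exI[of _ d1] exI[of _ ds] exI[of _ "d2 + length tr2"]) (auto simp: delays_append delays_silent silent_def)
qed

lemma mid_mid:
  assumes "mid D a b tr1" "mid D a' b' tr2" "b + a' \<le> D"
  shows "mid D a b' (tr1 @ tr2)"
proof -
  from assms(1) obtain d1 ds d2 where 1: "delays is_delivered tr1 = d1 # ds @ [d2]" "d1 \<le> a" "d2 \<le> b" "\<forall>d\<in>set ds. d \<le> D"
    by (auto simp: mid_def)
  from assms(2) obtain e1 es e2 where 2: "delays is_delivered tr2 = e1 # es @ [e2]" "e1 \<le> a'" "e2 \<le> b'" "\<forall>d\<in>set es. d \<le> D"
    by (auto simp: mid_def)
  from 1 2 assms(3) show ?thesis unfolding mid_def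
    by (intro exI[of _ d1] exI[of _ "ds @ (d2 + e1) # es"] exI[of _ e2]) (auto simp: delays_append)
qed

lemma pre_silent:
  assumes "pre D b tr1" "silent k tr2"
  shows "pre D (b + k) (tr1 @ tr2)"
proof -
  from assms(1) obtain ds d2 where "delays is_delivered tr1 = ds @ [d2]" "d2 \<le> b" "\<forall>d\<in>set ds. d \<le> D"
    by (auto simp: pre_def)
  with assms(2) show ?thesis unfolding pre_def
    by (intro exI[of _ ds] exI[of _ "d2 + length tr2"]) (auto simp: delays_append delays_silent silent_def)
qed

lemma pre_mid:
  assumes "pre D b tr1" "mid D a' b' tr2" "b + a' \<le> D"
  shows "pre D b' (tr1 @ tr2)"
proof -
  from assms(1) obtain ds d2 where 1: "delays is_delivered tr1 = ds @ [d2]" "d2 \<le> b" "\<forall>d\<in>set ds. d \<le> D"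
    by (auto simp: pre_def)
  from assms(2) obtain e1 es e2 where 2: "delays is_delivered tr2 = e1 # es @ [e2]" "e1 \<le> a'" "e2 \<le> b'" "\<forall>d\<in>set es. d \<le> D"
    by (auto simp: mid_def)
  from 1 2 assms(3) show ?thesis unfolding pre_def
    by (intro exI[of _ "ds @ (d2 + e1) # es"] exI[of _ e2]) (auto simp: delays_append)
qed

lemma outputs_silent: "silent k tr \<Longrightarrow> outputs tr = []"
  by (auto simp: silent_def filter_empty_conv)

lemma pre_Nil: "pre D b []"
  by (auto simp: pre_def)

context ordered_network
begin

text \<open>The one step before the delivery is that of \<open>Deliver\<close> itself. Afterwards
  there are two passes over the last part of the path with 3 steps per vertex, a scan of
  \<open>Ord\<close> with 2 steps per literal and the printing with one step per vertex, which fit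
  into the bound.\<close>

lemma wp_output_path:
  assumes inv: "inv s" and P: "nr_path A0 x P" and skew: "skew A0" and path: "lvars s Path = rev P" and y: "regs s rY = last P"
    and ord: "lvars s Ord = ls"
  shows "wp inv output_path (\<lambda>t tr. outputs tr = path_events (good L) P \<and> mid D 1 (10 * card V + 15) tr) s"
proof -
  from P obtain p1 p2 w where p: "P = p1 @ compl w # p2 @ [w]" "distinct P"
    "alt P = p1 @ compl w # rev (map compl p2) @ [w]" by (rule nr_path_splitE')
  have P_V: "set P \<subseteq> V" using nr_path_vertices[OF lin P arcs_V] .
  have len: "length P \<le> card V" using card_mono[OF finite_V P_V] distinct_card[OF p(2)] by simp
  let ?cond = "EqL (Top (Pop (Lst Path))) (Co (Reg rY))"
  let ?w1 = "WHILE NotB (EqL (Top (Lst It)) (Co (Reg rY))) DO (Fwd :=\<^sub>S Push (Top (Lst It)) (Lst Fwd) ;; It :=\<^sub>S Pop (Lst It))"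
  let ?w2 = "WHILE AndB (NotB (IsEmpty (Lst Fwd))) (EqL (Top (Lst Fwd)) (Co (Top (Lst It)))) DO
        (Fwd :=\<^sub>S Pop (Lst Fwd) ;; It :=\<^sub>S Pop (Lst It))"
  let ?w3 = "WHILE AndB (NotB (EqL (Top (Lst It)) (Reg rV))) (NotB (EqL (Top (Lst It)) (Reg rW))) DO It :=\<^sub>S Pop (Lst It)"
  let ?c3 = "rV :=\<^sub>R Top (Lst Fwd) ;; rW :=\<^sub>R Co (Top (Lst It)) ;; It :=\<^sub>S Lst Ord ;; ?w3 ;;
         IF EqL (Top (Lst It)) (Reg rV) THEN Print Path ELSE Skip"
  let ?c2 = "It :=\<^sub>S Lst Path ;; Fwd :=\<^sub>S Empty ;; ?w1 ;; Fwd :=\<^sub>S Push (Co (Reg rY)) (Lst Fwd) ;; It :=\<^sub>S Lst Path ;; ?w2"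
  let ?c2L = "((((It :=\<^sub>S Lst Path ;; Fwd :=\<^sub>S Empty) ;; ?w1) ;; Fwd :=\<^sub>S Push (Co (Reg rY)) (Lst Fwd)) ;; It :=\<^sub>S Lst Path) ;; ?w2"
  let ?e2 = "It :=\<^sub>S Lst Path ;; Fwd :=\<^sub>S Empty ;; ?w1 ;; Fwd :=\<^sub>S Push (Co (Reg rY)) (Lst Fwd) ;; It :=\<^sub>S Lst Path ;; ?w2 ;;
    IF IsEmpty (Lst Fwd) THEN Skip ELSE ?c3"
  let ?Q = "\<lambda>tr. outputs tr = path_events (good L) P \<and> mid D 1 (10 * card V + 15) tr"
  \<comment> \<open>Nothing is delivered after \<open>P\<close> here, so the rest of the trace forms
    one stretch.\<close>
  have after: "?Q ([Step s, Delivered P] @ tr)"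
    if "outputs tr = tl (path_events (good L) P)" "pre D (10 * card V + 15) tr" "delivered tr = []" for tr
  proof -
    have "length (delays is_delivered tr) = 1"
      using that(3) by (induction tr rule: delivered.induct) (auto simp: Suc_length_conv)
    then obtain d where d: "delays is_delivered tr = [d]" by (auto simp: length_Suc_conv)
    with that(2) have "d \<le> 10 * card V + 15" by (auto simp: pre_def)
    with that(1) d show ?thesis by (auto simp: mid_def path_events_def intro!: exI[of _ 1] exI[of _ "[]"])
  qed
  have silent_out: "?Q ([Step s, Delivered P] @ tr @ [Step s'])"
    if "silent (10 * card V + 14) tr" "\<not> good L P" for tr s'
  proof (rule after)
    show "pre D (10 * card V + 15) (tr @ [Step s'])"
      using pre_silent[OF pre_Nil[of D 0] silent_append[OF that(1), of 1 "[Step s']"]]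
      by (simp add: silent_def add.commute)
    have "delivered tr = []" if "silent k tr" for k and tr :: "'v event list"
      using that unfolding silent_def by (induction tr rule: delivered.induct) auto
    from this[OF silent_append[OF that(1), of 1 "[Step s']"]] show "delivered (tr @ [Step s']) = []" by (simp add: silent_def)
  qed (use that outputs_silent[OF that(1)] in \<open>auto simp: path_events_def\<close>)
  have print_out: "?Q ([Step s, Delivered P] @ tr @ replicate (length P) (Step s') @ [Printed (F_of P)])"
    if "silent (9 * card V + 15) tr" "good L P" for tr s'
  proof (rule after)
    let ?tr = "tr @ replicate (length P) (Step s')"
    have sil: "silent (10 * card V + 15) ?tr" using that(1) len by (auto simp: silent_def)
    have "delays is_delivered (?tr @ [Printed (F_of P)]) = [length ?tr]"
      unfolding delays_append[of _ ?tr] using sil by (auto simp: silent_def delays_silent)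
    with sil show "pre D (10 * card V + 15) (tr @ replicate (length P) (Step s') @ [Printed (F_of P)])"
      by (auto simp: pre_def silent_def)
    have "delivered (tr @ [Printed F]) = []" if "silent k tr" for k F and tr :: "'v event list"
      using that unfolding silent_def by (induction tr rule: delivered.induct) auto
    from this[OF sil] show "delivered (tr @ replicate (length P) (Step s') @ [Printed (F_of P)]) = []" by simp
  qed (use that outputs_silent[OF that(1)] in \<open>auto simp: path_events_def\<close>)
  have unit: "bval ?cond s \<longleftrightarrow> alt P = P"
    unfolding alt_eq_iff[OF skew P] by (simp add: path y butlast_rev[symmetric] hd_rev[symmetric])
      (metis butlast_rev hd_rev rev_rev_ident)
  have "wp inv (IF ?cond THEN Print Path ELSE (?e2))
    (\<lambda>t tr. ?Q ([Step s, Delivered P] @ tr)) s"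
  proof (rule wp_Cond)
      show "inv s" by fact
    show "if bval ?cond s then wp inv (Print Path) (\<lambda>t tr. ?Q ([Step s, Delivered P] @ Step s # tr)) s
      else wp inv (?e2) (\<lambda>t tr. ?Q ([Step s, Delivered P] @ Step s # tr)) s"
    proof (cases "alt P = P")
      case True
      then have "?Q ([Step s, Delivered P] @ [Step s] @ replicate (length P) (Step s) @ [Printed (F_of P)])"
        by (intro print_out) (auto simp: silent_def good_def)
      then have "wp inv (Print Path) (\<lambda>t tr. ?Q ([Step s, Delivered P] @ Step s # tr)) s"
        using inv path by (intro wp_Print) auto
      then show ?thesis using unit True by simp
    next
      case False
      let ?R = "compl w # p2 @ [w]" and ?R' = "compl w # rev (map compl p2) @ [w]"
      have rev_P: "rev P = (w # rev p2) @ compl w # rev p1" using p(1) by simp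
      \<comment> \<open>Read from the top with complemented entries, the stored path spells the
        contraposition of its last part.\<close>
      have rev_P': "rev P = map compl ?R' @ rev p1" using p(1) by (simp add: rev_map comp_def)
      have y': "regs s rY = w" using y p(1) by simp
      let ?s1 = "s\<lparr>lvars := (lvars s)(It := rev P, Fwd := [])\<rparr>"
      have inv1: "inv ?s1" using inv len card_V_K by (simp add: bounded_def)
      have W2: "wps inv ?c2 (\<lambda>t m. (\<exists>r F F'. ?R = r @ F \<and> ?R' = r @ F' \<and> lvars t Fwd = F \<and>
          lvars t It = map compl F' @ rev p1 \<and> (F \<noteq> [] \<longrightarrow> hd F \<noteq> hd F')) \<and> m \<le> 6 * card V + 6) s 0"
        (is "wps inv ?c2 ?R2 s 0")
      proof -
        have "wps inv ?w1 (wps inv (Fwd :=\<^sub>S Push (Co (Reg rY)) (Lst Fwd) ;; It :=\<^sub>S Lst Path ;; ?w2) ?R2) ?s1 2"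
        proof (rule wps_conseq[OF extract_last_part[OF inv1, of "w # rev p2" w "rev p1"]])
          show "compl w \<notin> set (w # rev p2)" using p(1,2) by auto
          fix t m
          assume post: "lvars t Fwd = rev (w # rev p2) \<and> m \<le> 2 + 3 * length (w # rev p2) + 1"
            and same: "same ?w1 ?s1 t" and inv_t: "inv t"
          have t: "regs t rY = w" "lvars t Path = rev P" using same y' path by (auto simp: same_def)
          let ?t1 = "t\<lparr>lvars := (lvars t)(Fwd := ?R, It := rev P)\<rparr>"
          have inv_t1: "inv ?t1" using inv_t len card_V_K p(1) by (simp add: bounded_def)
          have "wps inv ?w2 ?R2 ?t1 (m + 2)"
          proof (rule wps_conseq[OF strip_common_prefix[OF inv_t1, of ?R ?R' "rev p1"]])
            show "lvars ?t1 It = map compl ?R' @ rev p1" using rev_P' by simp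
          qed (use post len p(1) in auto)
          then show "wps inv (Fwd :=\<^sub>S Push (Co (Reg rY)) (Lst Fwd) ;; It :=\<^sub>S Lst Path ;; ?w2) ?R2 t m"
            using inv_t inv_t1 t post len card_V_K p(1) by (simp add: bounded_def)
        qed (use rev_P y' len card_V_K in auto)
        then show ?thesis using inv inv1 path len card_V_K by (simp add: bounded_def eval_nat_numeral)
      qed
      have "wp inv ?e2 (\<lambda>t tr. ?Q ([Step s, Delivered P] @ Step s # tr)) s"
        unfolding wp_assoc
      proof (rule wp_Seq_wps[where R = ?R2 and I = inv])
        show "inv s" by fact
        show "wps inv ?c2L ?R2 s 0" using W2 by (simp only: wps_Seq_fun)
        fix t and tr1 :: "'v event list"
        assume post: "?R2 t (length tr1)" and sil: "silent (length tr1) tr1" and same: "same ?c2L s t" and inv_t: "inv t"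
        from post obtain r F F' where F: "?R = r @ F" "?R' = r @ F'" "lvars t Fwd = F"
          "lvars t It = map compl F' @ rev p1" "F \<noteq> [] \<longrightarrow> hd F \<noteq> hd F'" by blast
        have "length F = length F'" using arg_cong[OF F(1), of length] arg_cong[OF F(2), of length] by simp
        moreover have "F \<noteq> F'" using False F(1,2) p(1,3) by auto
        ultimately obtain a F1 b F1' where ab: "F = a # F1" "F' = b # F1'" by (cases F; cases F') auto
        then have neq: "a \<noteq> b" using F(5) by simp
        have "a \<in> set ?R" "b \<in> set ?R'" unfolding F(1,2) ab by auto
        then have ab_V: "a \<in> V" "b \<in> V" using P_V compl_V p(1) by auto
        have t: "lvars t Ord = ls" "lvars t Path = rev P" using same ord path by (auto simp: same_def)
        let ?t1 = "t\<lparr>regs := (regs t)(rV := a, rW := b), lvars := (lvars t)(It := ls)\<rparr>"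
        have inv_t1: "inv ?t1" using inv_t length_ls card_V_K by (simp add: bounded_def)
        \<comment> \<open>\<open>P\<close> and \<open>alt P\<close> share \<open>p1 @ r\<close> and
          then differ in \<open>a\<close> and \<open>b\<close>, so these two literals
          decide.\<close>
        have good: "good L P \<longleftrightarrow> (a, b) \<in> L"
        proof -
          have P_eq: "P = (p1 @ r) @ a # F1" "alt P = (p1 @ r) @ b # F1'"
            using p(1,3) F(1,2) ab by (metis append.assoc)+
          have "(a, b) \<in> L - Id \<Longrightarrow> pathlex L P (alt P)" "(b, a) \<in> L - Id \<Longrightarrow> pathlex L (alt P) P"
            using pathlex_differ[OF lin, of a b "p1 @ r" F1 F1'] pathlex_differ[OF lin, of b a "p1 @ r" F1' F1] P_eq by metis+
          then show ?thesis
            using strict_total[OF lin ab_V neq] pathlex_asym[OF lin, of P "alt P"] neq False strict_asym[OF lin]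
            unfolding good_def by (auto dest: asymD)
        qed
        have W3: "wps inv (rV :=\<^sub>R Top (Lst Fwd) ;; rW :=\<^sub>R Co (Top (Lst It)) ;; It :=\<^sub>S Lst Ord ;; ?w3)
          (\<lambda>u m. regs u rV = a \<and> (hd (lvars u It) = a \<longleftrightarrow> (a, b) \<in> L) \<and> m \<le> 2 * card V + 4) t 0"
        proof -
          have "wps inv ?w3 (\<lambda>u m. regs u rV = a \<and> (hd (lvars u It) = a \<longleftrightarrow> (a, b) \<in> L) \<and> m \<le> 2 * card V + 4) ?t1 3"
            by (rule wps_conseq[OF find_first[OF inv_t1]]) (use ab_V neq in \<open>auto simp: same_def\<close>)
          then show ?thesis using inv_t inv_t1 F(3,4) ab t by (simp add: bounded_def eval_nat_numeral)
        qed
        show "wp inv (IF IsEmpty (Lst Fwd) THEN Skip ELSE ?c3) (\<lambda>u tr2. ?Q ([Step s, Delivered P] @ Step s # tr1 @ tr2)) t"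
        proof (rule wp_Cond)
      show "inv t" by fact
          have "wp inv ?c3 (\<lambda>u tr2. ?Q ([Step s, Delivered P] @ Step s # tr1 @ Step t # tr2)) t"
            unfolding wp_assoc
          proof (rule wp_Seq_wps[where R = "\<lambda>u m. regs u rV = a \<and> (hd (lvars u It) = a \<longleftrightarrow> (a, b) \<in> L) \<and> m \<le> 2 * card V + 4" and I = inv])
            show "inv t" by fact
            show "wps inv (((rV :=\<^sub>R Top (Lst Fwd) ;; rW :=\<^sub>R Co (Top (Lst It))) ;; It :=\<^sub>S Lst Ord) ;; ?w3)
              (\<lambda>u m. regs u rV = a \<and> (hd (lvars u It) = a \<longleftrightarrow> (a, b) \<in> L) \<and> m \<le> 2 * card V + 4) t 0" using W3 by (simp only: wps_Seq_fun)
            fix u and tr2 :: "'v event list"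
            assume post2: "regs u rV = a \<and> (hd (lvars u It) = a \<longleftrightarrow> (a, b) \<in> L) \<and> length tr2 \<le> 2 * card V + 4"
              and sil2: "silent (length tr2) tr2" and inv_u: "inv u"
              and same2: "same (((rV :=\<^sub>R Top (Lst Fwd) ;; rW :=\<^sub>R Co (Top (Lst It))) ;; It :=\<^sub>S Lst Ord) ;; ?w3) t u"
            show "wp inv (IF EqL (Top (Lst It)) (Reg rV) THEN Print Path ELSE Skip)
              (\<lambda>v tr3. ?Q ([Step s, Delivered P] @ Step s # tr1 @ Step t # tr2 @ tr3)) u"
            proof (rule wp_Cond)
      show "inv u" by fact
              have u: "lvars u Path = rev P" using same2 t by (simp add: same_def)
              have sil3: "silent (8 * card V + 13) (Step s # tr1 @ Step t # tr2 @ [Step u])"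
                using sil sil2 post post2 by (auto simp: silent_def)
              have "wp inv (Print Path) (\<lambda>v tr3. ?Q ([Step s, Delivered P] @ Step s # tr1 @ Step t # tr2 @ Step u # tr3)) u"
                if "good L P"
                using print_out[OF silent_mono[OF sil3] that, of u] inv_u u by (intro wp_Print) auto
              moreover have "wp inv Skip (\<lambda>v tr3. ?Q ([Step s, Delivered P] @ Step s # tr1 @ Step t # tr2 @ Step u # tr3)) u"
                if "\<not> good L P"
                using silent_out[OF silent_mono[OF sil3] that, of u] inv_u by (intro wp_Skip) auto
              ultimately show "if bval (EqL (Top (Lst It)) (Reg rV)) u
                then wp inv (Print Path) (\<lambda>v tr3. ?Q ([Step s, Delivered P] @ Step s # tr1 @ Step t # tr2 @ Step u # tr3)) u
                else wp inv Skip (\<lambda>v tr3. ?Q ([Step s, Delivered P] @ Step s # tr1 @ Step t # tr2 @ Step u # tr3)) u"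
                using post2 good by simp
            qed
          qed
          then show "if bval (IsEmpty (Lst Fwd)) t then wp inv Skip (\<lambda>u tr2. ?Q ([Step s, Delivered P] @ Step s # tr1 @ Step t # tr2)) t
            else wp inv ?c3 (\<lambda>u tr2. ?Q ([Step s, Delivered P] @ Step s # tr1 @ Step t # tr2)) t"
            using F(3) ab by simp
        qed
      qed
      then show ?thesis using unit False by simp
    qed
  qed
  then show ?thesis unfolding output_path_def using inv path
    by (intro wp_Seq wp_Deliver) simp_all
qed

end

section \<open>The depth-first search\<close>

definition dfs_body :: com where
  "dfs_body = (rY :=\<^sub>R Top (Lst Path) ;;
         IF IsEmpty (Tab Rem (Reg rY))
         THEN (OnPath\<lbrakk>Reg rY\<rbrakk> :=\<^sub>T Empty ;; Path :=\<^sub>S Pop (Lst Path))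
         ELSE (rV :=\<^sub>R Top (Tab Rem (Reg rY)) ;; Rem\<lbrakk>Reg rY\<rbrakk> :=\<^sub>T Pop (Tab Rem (Reg rY)) ;;
               rY :=\<^sub>R Reg rV ;; enter))"

text \<open>A block of complete loop iterations without the final failing test. One call of DFS
  corresponds to such a block, and blocks can be concatenated.\<close>

inductive iter :: "bexp \<Rightarrow> com \<Rightarrow> 'v store \<Rightarrow> 'v event list \<Rightarrow> 'v store \<Rightarrow> bool" for b c where
  iter_refl: "iter b c s [] s"
| iter_step: "bval b s \<Longrightarrow> exec c s tr1 s1 \<Longrightarrow> iter b c s1 tr2 t \<Longrightarrow> iter b c s (Step s # tr1 @ tr2) t"

lemma iter_trans: "iter b c s tr1 t \<Longrightarrow> iter b c t tr2 u \<Longrightarrow> iter b c s (tr1 @ tr2) u"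
proof (induction rule: iter.induct)
  case (iter_step s tr1 s1 tr2' t)
  then show ?case using iter.iter_step[of b s c tr1 s1 "tr2' @ tr2" u] by simp
qed simp

lemma iter_wpshile: "iter b c s tr1 t \<Longrightarrow> exec (WHILE b DO c) t tr2 u \<Longrightarrow> exec (WHILE b DO c) s (tr1 @ tr2) u"
proof (induction rule: iter.induct)
  case (iter_step s tr1 s1 tr2' t)
  then show ?case using exec.WhileTrue[of b s c tr1 s1 "tr2' @ tr2" u] by simp
qed simp

definition frame :: "'v store \<Rightarrow> 'v store \<Rightarrow> bool" where
  "frame s t \<longleftrightarrow> regs t rX = regs s rX \<and> (\<forall>i\<in>{Units, Bins, Ord, Todo}. lvars t i = lvars s i) \<and>
     (\<forall>tb\<in>{In, Out, IsUnit}. tables t tb = tables s tb)"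

lemma frame_trans: "frame s t \<Longrightarrow> frame t u \<Longrightarrow> frame s u"
  by (simp add: frame_def)

lemma frame_refl: "frame s s"
  by (simp add: frame_def)

lemma wr_output_path:
  "wr_lvars output_path \<subseteq> {It, Fwd}" "wr_tabs output_path = {}" "wr_regs output_path \<subseteq> {rV, rW}"
  by (auto simp: output_path_def)

lemma wr_bfs:
  "wr_lvars bfs \<subseteq> {It, Cur, Nxt}" "wr_tabs bfs = {Seen}" "wr_regs bfs \<subseteq> {rV, rW}"
  by (auto simp: bfs_def)

lemma enter_frame: "same enter s t \<Longrightarrow> frame s t"
  using wr_output_path wr_bfs unfolding same_def frame_def enter_def by auto

lemma dfs_body_frame: "same dfs_body s t \<Longrightarrow> frame s t"
  using wr_output_path wr_bfs unfolding same_def frame_def enter_def dfs_body_def by auto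

lemma iter_wps:
  assumes "bval b s" "wps I c R s 0" "I s"
  shows "\<exists>tr t. iter b c s tr t \<and> (\<forall>s'. Step s' \<in> set tr \<longrightarrow> I s') \<and> silent (length tr) tr \<and>
    R t (length tr - 1) \<and> same c s t \<and> I t"
proof -
  from assms(2) obtain tr t where *: "exec c s tr t" "\<forall>e\<in>set tr. \<exists>s'. e = Step s' \<and> I s'" "R t (0 + length tr)"
    by (rule wpsE)
  have "iter b c s (Step s # tr) t" using iter_step[OF assms(1) *(1) iter_refl] by simp
  with * exec_same[OF *(1)] exec_inv[OF *(1,2)] assms(3) show ?thesis
    by (intro exI[of _ "Step s # tr"] exI[of _ t]) (auto simp: silent_def)
qed

context ordered_network
begin

text \<open>The state between two calls, with \<open>q\<close> on the stack. \<open>Rem\<close>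
  cells off the path are empty, so that a vertex is always entered with a clean cell; those on the
  path hold the out-neighbours still to be tried.\<close>

definition dstate :: "('v lit \<times> 'v lit) set \<Rightarrow> 'v lit \<Rightarrow> 'v lit list \<Rightarrow> 'v store \<Rightarrow> bool" where
  "dstate A x q s \<longleftrightarrow> inv s \<and> in_lists A s \<and> out_lists L A s \<and> regs s rX = x \<and> lvars s Ord = ls \<and>
     lvars s Path = rev q \<and> blocked s = set q \<and> (\<forall>v. v \<notin> set q \<longrightarrow> tables s Rem v = [])"

text \<open>13 steps per vertex and 6 per arc for the search, 9 per arc for storing the successors,
  and constant overhead.\<close>

definition enter_cost :: nat where
  "enter_cost = 13 * card V + 15 * card A0 + 20"

definition output_cost :: nat where
  "output_cost = 10 * card V + 15"

lemma dfs_descend: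
  assumes path: "lvars s Path = y # p" and rem: "tables s Rem y = z # zs" and inv: "inv s"
  obtains u tr where "silent 5 tr" "\<forall>s'. Step s' \<in> set tr \<longrightarrow> inv s'" "inv u" "regs u rY = z" "regs u rX = regs s rX"
    "lvars u = lvars s" "tables u = (tables s)(Rem := (tables s Rem)(y := zs))"
    "\<And>tr0 s1. exec enter u tr0 s1 \<Longrightarrow> exec dfs_body s (tr @ tr0) s1"
proof -
  define s1 where "s1 = s\<lparr>regs := (regs s)(rY := y)\<rparr>"
  define s2 where "s2 = s1\<lparr>regs := (regs s1)(rV := z)\<rparr>"
  define s3 where "s3 = s2\<lparr>tables := (tables s2)(Rem := (tables s2 Rem)(y := zs))\<rparr>"
  define u where "u = s3\<lparr>regs := (regs s3)(rY := z)\<rparr>"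
  note defs = u_def s3_def s2_def s1_def
  have lz: "Suc (length zs) \<le> outdeg A0 y"
    using inv tb_cell[of cap "tables s" Rem y] rem by (simp add: bounded_def)
  have inv': "inv s1" "inv s2" "inv s3" "inv u" using inv lz by (auto simp: defs bounded_def)
  have e1: "exec (rY :=\<^sub>R Top (Lst Path)) s [Step s1] s1" by (rule exec.SetR) (simp add: path s1_def)
  have e2: "exec (rV :=\<^sub>R Top (Tab Rem (Reg rY))) s1 [Step s2] s2" by (rule exec.SetR) (simp add: rem s1_def s2_def)
  have e3: "exec (Rem\<lbrakk>Reg rY\<rbrakk> :=\<^sub>T Pop (Tab Rem (Reg rY))) s2 [Step s3] s3"
    by (rule exec.SetT) (simp add: rem s1_def s2_def s3_def)
  have e4: "exec (rY :=\<^sub>R Reg rV) s3 [Step u] u" by (rule exec.SetR) (simp add: defs)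
  have nb: "\<not> bval (IsEmpty (Tab Rem (Reg rY))) s1" by (simp add: s1_def rem)
  have "exec dfs_body s ([Step s1, Step s1, Step s2, Step s3, Step u] @ tr0) t" if "exec enter u tr0 t" for tr0 t
    using exec.Seq[OF e1 exec.IfFalse[OF nb exec.Seq[OF e2 exec.Seq[OF e3 exec.Seq[OF e4 that]]]]]
    unfolding dfs_body_def by simp
  then show thesis
    by (rule that[of "[Step s1, Step s1, Step s2, Step s3, Step u]" u, rotated -1])
      (use inv' in \<open>auto simp: silent_def defs\<close>)
qed

lemma dfs_pop:
  assumes path: "lvars s Path = y # p" and rem: "tables s Rem y = []" and inv: "inv s"
  shows "\<exists>tr t. iter (NotB (IsEmpty (Lst Path))) dfs_body s tr t \<and> (\<forall>s'. Step s' \<in> set tr \<longrightarrow> inv s') \<and> silent 5 tr \<and>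
    lvars t Path = p \<and> blocked t = blocked s - {y} \<and> tables t Rem = tables s Rem \<and> frame s t \<and> inv t"
proof -
  have "length p \<le> K" using inv lbD[of K "lvars s" Path] path by (simp add: bounded_def)
  then have "wps inv dfs_body (\<lambda>t m. lvars t Path = p \<and> blocked t = blocked s - {y} \<and> tables t Rem = tables s Rem \<and> m \<le> 4) s 0"
    using assms unfolding dfs_body_def by (auto simp: wps_Cond bounded_def blocked_def)
  from iter_wps[OF _ this inv, of "NotB (IsEmpty (Lst Path))"] obtain tr t where
    "iter (NotB (IsEmpty (Lst Path))) dfs_body s tr t" "\<forall>s'. Step s' \<in> set tr \<longrightarrow> inv s'" "silent (length tr) tr"
    "lvars t Path = p" "blocked t = blocked s - {y}" "tables t Rem = tables s Rem" "length tr - 1 \<le> 4" "same dfs_body s t" "inv t"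
    using path by auto
  then show ?thesis using dfs_body_frame silent_mono[of "length tr" tr 5] by fastforce
qed

text \<open>\<open>y\<close> is marked before the search starts, so the deleted set is that of
  \<open>q @ [y]\<close> and includes \<open>y\<close> itself.\<close>

lemma enter_regular:
  assumes st: "dstate A x q s" and y: "regs s rY = y" and A: "A \<subseteq> A0" and x: "x \<in> V"
    and q: "distinct (q @ [y])" "set (q @ [y]) \<subseteq> V" "compl y \<notin> set q"
  shows "wps inv enter (\<lambda>t m. lvars t Path = rev (q @ [y]) \<and> blocked t = set (q @ [y]) \<and>
    tables t Rem = (tables s Rem)(y := filter (\<lambda>v. v \<in> reach A x (set (q @ [y]))) (tables s Out y)) \<and>
    m \<le> n + enter_cost) s n"
proof -
  let ?s1 = "s\<lparr>lvars := (lvars s)(Path := rev (q @ [y])), tables := (tables s)(OnPath := (tables s OnPath)(y := [y]))\<rparr>"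
  let ?Q = "\<lambda>t m. lvars t Path = rev (q @ [y]) \<and> blocked t = set (q @ [y]) \<and>
    tables t Rem = (tables s Rem)(y := filter (\<lambda>v. v \<in> reach A x (set (q @ [y]))) (tables s Out y)) \<and>
    m \<le> n + enter_cost"
  have s: "inv s" "in_lists A s" "out_lists L A s" "regs s rX = x" "lvars s Ord = ls" "lvars s Path = rev q"
    "blocked s = set q" "tables s Rem y = []" using st q(1) by (auto simp: dstate_def)
  have len: "Suc (length q) \<le> K" using distinct_le_K[OF q(1,2)] by simp
  then have inv1: "inv ?s1" using s(1) q(2) by (simp add: bounded_def)
  have bl: "blocked ?s1 = set (q @ [y])" using s(7) by (auto simp: blocked_def)
  have emp: "tables s OnPath (compl y) = []" using s(7) q(3) by (auto simp: blocked_def)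
  have "wps inv bfs (wps inv store_successors ?Q) ?s1 (n + 3)"
  proof (rule wps_conseq[OF bfs_spec[OF inv1 _ A]])
    show "in_lists A ?s1" using s(2) by (simp add: in_lists_def)
    show "regs ?s1 rX \<in> V" using s(4) x by simp
    show "set (lvars ?s1 Ord) = V" "distinct (lvars ?s1 Ord)" using s(5) set_ls distinct_ls by auto
    fix t m
    assume post: "seen t = reach A (regs ?s1 rX) (blocked ?s1) \<and> m \<le> n + 3 + 13 * card V + 6 * card A0 + 6"
      and same: "same bfs ?s1 t" and inv_t: "inv t"
    have t: "lvars t Path = rev (q @ [y])" "tables t OnPath = tables ?s1 OnPath" "tables t Rem = tables s Rem"
      "tables t Out = tables s Out" "regs t rY = y"
      using same wr_bfs y unfolding same_def by auto
    have bl_t: "blocked t = set (q @ [y])" using bl t(2) by (simp add: blocked_def)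
    show "wps inv store_successors ?Q t m"
    proof (rule wps_conseq[OF store_successors_spec[OF inv_t _ A]])
      show "out_lists L A t" using s(3) t(4) by (simp add: out_lists_def)
      show "tables t Rem (regs t rY) = []" using t s(8) by simp
      fix u k
      assume post2: "tables u Rem = (tables t Rem)(regs t rY := filter (\<lambda>v. v \<in> seen t) (tables t Out (regs t rY))) \<and>
          k \<le> m + 9 * card A0 + 4" and same2: "same store_successors t u"
      have "lvars u Path = rev (q @ [y])" "blocked u = blocked t"
        using same2 t(1) by (auto simp: same_def store_successors_def blocked_def)
      then show "?Q u k" using post post2 bl bl_t t s(4) by (simp add: enter_cost_def)
    qed
  qed
  then show ?thesis
    unfolding enter_def store_successors_def[symmetric] using s(1,6) inv1 emp y len q(2)
    by (simp add: wps_Cond bounded_def eval_nat_numeral)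
qed

text \<open>The cell of \<open>y\<close> in \<open>Rem\<close> stays empty, so the next iteration
  pops \<open>y\<close>. The four steps up to the delivery are two assignments, the test and the
  step of \<open>Deliver\<close>.\<close>

lemma enter_complete:
  assumes st: "dstate A x q s" and y: "regs s rY = y" and P: "nr_path A0 x (q @ [y])" and skew: "skew A0"
    and q: "compl y \<in> set q"
  shows "wp inv enter (\<lambda>t tr. outputs tr = path_events (good L) (q @ [y]) \<and> mid D 4 output_cost tr \<and>
    lvars t Path = rev (q @ [y]) \<and> blocked t = set (q @ [y]) \<and> tables t Rem = tables s Rem) s"
proof -
  let ?s1 = "s\<lparr>lvars := (lvars s)(Path := rev (q @ [y])), tables := (tables s)(OnPath := (tables s OnPath)(y := [y]))\<rparr>"
  have s: "inv s" "lvars s Ord = ls" "lvars s Path = rev q" "blocked s = set q" using st by (auto simp: dstate_def)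
  have q_V: "set (q @ [y]) \<subseteq> V" using nr_path_vertices[OF lin P arcs_V] .
  have "distinct (q @ [y])" using P by (simp add: nr_path_def)
  then have len: "Suc (length q) \<le> K" using distinct_le_K[OF _ q_V] by simp
  then have inv1: "inv ?s1" using s(1) q_V by (simp add: bounded_def)
  have bl: "blocked ?s1 = set (q @ [y])" using s(4) by (auto simp: blocked_def)
  have ne: "tables s OnPath (compl y) \<noteq> []" using s(4) q by (auto simp: blocked_def)
  let ?R = "\<lambda>t m. t = ?s1 \<and> m = 2"
  let ?Q = "\<lambda>t tr. outputs tr = path_events (good L) (q @ [y]) \<and> mid D 4 output_cost tr \<and>
    lvars t Path = rev (q @ [y]) \<and> blocked t = set (q @ [y]) \<and> tables t Rem = tables s Rem"
  show ?thesis
    unfolding enter_def wp_assoc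
  proof (rule wp_Seq_wps[where R = ?R and I = inv])
    show "inv s" by fact
    show "wps inv (Path :=\<^sub>S Push (Reg rY) (Lst Path) ;; OnPath\<lbrakk>Reg rY\<rbrakk> :=\<^sub>T Push (Reg rY) Empty) ?R s 0"
      using s(1,3) inv1 y len by (simp add: bounded_def eval_nat_numeral)
    fix t and tr1 :: "'v event list"
    assume R: "?R t (length tr1)" and sil: "silent (length tr1) tr1"
    have "wp inv output_path (\<lambda>u tr2. ?Q u (tr1 @ Step ?s1 # tr2)) ?s1"
    proof (rule wp_conseq[OF wp_output_path[OF inv1 P skew]])
      fix u tr2
      assume post: "outputs tr2 = path_events (good L) (q @ [y]) \<and> mid D 1 (10 * card V + 15) tr2"
        and same: "same output_path ?s1 u"
      have "silent 3 (tr1 @ [Step ?s1])" using R sil by (auto simp: silent_def)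
      from silent_mid[OF this] post have "mid D 4 output_cost (tr1 @ Step ?s1 # tr2)"
        by (fastforce simp: output_cost_def)
      moreover have "lvars u Path = rev (q @ [y])" "tables u = tables ?s1"
        using same wr_output_path unfolding same_def by auto
      ultimately show "?Q u (tr1 @ Step ?s1 # tr2)"
        using post bl outputs_silent[OF sil] by (auto simp: blocked_def)
    qed (use y inv1 s(2) in auto)
    then show "wp inv (IF NotB (IsEmpty (Tab OnPath (Co (Reg rY)))) THEN output_path
     ELSE (bfs ;;
       It :=\<^sub>S Tab Out (Reg rY) ;; Tmp :=\<^sub>S Empty ;;
       for_each rV It (IF IsEmpty (Tab Seen (Reg rV)) THEN Skip ELSE Tmp :=\<^sub>S Push (Reg rV) (Lst Tmp)) ;;
       for_each rV Tmp (Rem\<lbrakk>Reg rY\<rbrakk> :=\<^sub>T Push (Reg rV) (Tab Rem (Reg rY))))) (\<lambda>u tr2. ?Q u (tr1 @ tr2)) t"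
      using R inv1 ne y by (intro wp_Cond) auto
  qed
qed

end

section \<open>The trace of a subtree of the search\<close>

context ordered_network
begin

abbreviation path_nonempty :: bexp where
  "path_nonempty \<equiv> NotB (IsEmpty (Lst Path))"

text \<open>Keeping deliveries and printings in one list records their interleaving, from which the
  delays of the printed clause-sets are derived.\<close>

definition lists_paths :: "'v event list \<Rightarrow> 'v lit list set \<Rightarrow> bool" where
  "lists_paths tr S \<longleftrightarrow> (\<exists>Ps. outputs tr = concat (map (path_events (good L)) Ps) \<and> set Ps = S \<and>
     sorted_wrt (pathlex L) Ps)"

definition safe :: "'v event list \<Rightarrow> bool" where
  "safe tr \<longleftrightarrow> (\<forall>s'. Step s' \<in> set tr \<longrightarrow> inv s')"

lemma safe_append [simp]: "safe (tr1 @ tr2) \<longleftrightarrow> safe tr1 \<and> safe tr2"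
  by (auto simp: safe_def)

lemma safe_simps [simp]: "safe []" "safe (Step s # tr) \<longleftrightarrow> inv s \<and> safe tr"
  by (auto simp: safe_def)

lemma lists_paths_silent: "silent k tr \<Longrightarrow> lists_paths tr {}"
  by (auto simp: lists_paths_def outputs_silent)

lemma lists_paths_append:
  assumes "lists_paths tr1 S1" "lists_paths tr2 S2" "\<And>P Q. P \<in> S1 \<Longrightarrow> Q \<in> S2 \<Longrightarrow> pathlex L P Q"
  shows "lists_paths (tr1 @ tr2) (S1 \<union> S2)"
proof -
  from assms(1,2) obtain Ps Qs where
    "outputs tr1 = concat (map (path_events (good L)) Ps)" "set Ps = S1" "sorted_wrt (pathlex L) Ps"
    "outputs tr2 = concat (map (path_events (good L)) Qs)" "set Qs = S2" "sorted_wrt (pathlex L) Qs"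
    by (auto simp: lists_paths_def)
  with assms(3) show ?thesis unfolding lists_paths_def
    by (intro exI[of _ "Ps @ Qs"]) (auto simp: sorted_wrt_append)
qed

lemma lists_paths_silent_append: "silent k tr1 \<Longrightarrow> lists_paths tr2 S \<Longrightarrow> lists_paths (tr1 @ tr2) S"
  by (simp add: lists_paths_def outputs_silent)

lemma lists_paths_append_silent: "lists_paths tr1 S \<Longrightarrow> silent k tr2 \<Longrightarrow> lists_paths (tr1 @ tr2) S"
  by (simp add: lists_paths_def outputs_silent)

lemma ext_less:
  assumes "P \<in> ext A x (q @ [z])" "Q \<in> ext A x (q @ [z'])" "(z, z') \<in> L" "z \<noteq> z'"
  shows "pathlex L P Q"
  using assms pathlex_differ[OF lin, of z z' q] by (auto simp: ext_def)

lemma dstate_frame: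
  assumes "dstate A x q s" "frame s t" "inv t" "lvars t Path = rev p" "blocked t = set p"
    "\<And>v. v \<notin> set p \<Longrightarrow> tables t Rem v = []"
  shows "dstate A x p t"
  using assms unfolding dstate_def frame_def in_lists_def out_lists_def by auto

text \<open>The longest stretch inside one search lies between neighbouring subtrees: finishing an
  output, climbing up at most \<open>card V\<close> levels with 6 steps each, and descending as many
  levels with one \<open>enter\<close> each.\<close>

context
  fixes A :: "('v lit \<times> 'v lit) set" and x :: "'v lit" and D :: nat
  assumes A: "A \<subseteq> A0" and skew: "skew A" and skew0: "skew A0" and x: "x \<in> V"
    and D: "output_cost + 6 * card V + card V * (enter_cost + 6) + 20 \<le> D"
begin

text \<open>A subtree always delivers a path, which is what \<open>mid\<close> demands. The number
  of levels below \<open>q\<close> bounds the descent to the first path and the climb after the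
  last.\<close>

definition result :: "'v lit list \<Rightarrow> 'v lit list set \<Rightarrow> 'v store \<Rightarrow> 'v event list \<Rightarrow> 'v store \<Rightarrow> bool" where
  "result q S s tr t \<longleftrightarrow> safe tr \<and> frame s t \<and> dstate A x q t \<and> tables t Rem = tables s Rem \<and> lists_paths tr S \<and>
     mid D ((card V - length q) * (enter_cost + 6) + 4) (output_cost + 6 * (card V - length q)) tr"

text \<open>The loop over the out-neighbours, by induction on the contents of the \<open>Rem\<close>
  cell of \<open>y\<close>. The assumption \<open>IH\<close> is the statement about subtrees for
  longer paths.\<close>

lemma dfs_children:
  assumes q': "q' = q @ [y]" and reg: "regular q'" and hd: "hd q' = x" and arcs: "set (vwalk_arcs q') \<subseteq> A"
    and dist: "distinct q'" and q'_V: "set q' \<subseteq> V"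
    and IH: "\<And>u z. dstate A x q' u \<Longrightarrow> regs u rY = z \<Longrightarrow> distinct (q' @ [z]) \<Longrightarrow> set (q' @ [z]) \<subseteq> V \<Longrightarrow>
      set (vwalk_arcs (q' @ [z])) \<subseteq> A \<Longrightarrow> hd (q' @ [z]) = x \<Longrightarrow> z \<in> reach A x (set q') \<Longrightarrow>
      \<exists>tr0 s1 tr1 t. exec enter u tr0 s1 \<and> iter path_nonempty dfs_body s1 tr1 t \<and>
        result q' (ext A x (q' @ [z])) u (tr0 @ tr1) t"
    and st: "dstate A x q' s" "tables s Rem y = zs" "sorted_wrt (\<lambda>a b. (a, b) \<in> L \<and> a \<noteq> b) zs"
      "set zs \<subseteq> {z. (y, z) \<in> A \<and> z \<in> reach A x (set q')}"
  shows "\<exists>tr t. iter path_nonempty dfs_body s tr t \<and> safe tr \<and> frame s t \<and> dstate A x q' t \<and>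
    tables t Rem = (tables s Rem)(y := []) \<and> lists_paths tr (\<Union>z\<in>set zs. ext A x (q' @ [z])) \<and>
    (if zs = [] then tr = [] else
      mid D ((card V - length q') * (enter_cost + 6) + 10) (output_cost + 6 * (card V - length q')) tr)"
  using st
proof (induction zs arbitrary: s)
  case Nil
  have "(tables s Rem)(y := []) = tables s Rem" using Nil(2) by auto
  then show ?case using Nil(1) frame_refl lists_paths_silent[of 0 "[]"]
    by (intro exI[of _ "[]"] exI[of _ s]) (auto intro: iter_refl simp: silent_def)
next
  case (Cons z zs)
  let ?h = "card V - length q'"
  have s: "inv s" "lvars s Path = y # rev q" using Cons.prems(1) q' by (auto simp: dstate_def)
  obtain u tr' where
    pre: "silent 5 tr'" "\<forall>s'. Step s' \<in> set tr' \<longrightarrow> inv s'" and u: "inv u" "regs u rY = z" "regs u rX = regs s rX"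
    "lvars u = lvars s" "tables u = (tables s)(Rem := (tables s Rem)(y := zs))"
    and ex: "\<And>tr0 s1. exec enter u tr0 s1 \<Longrightarrow> exec dfs_body s (tr' @ tr0) s1"
    by (rule dfs_descend[OF s(2) Cons.prems(2) s(1)]) blast
  have fr: "frame s u" using u by (simp add: frame_def)
  have du: "dstate A x q' u"
  proof (rule dstate_frame[OF Cons.prems(1) fr u(1)])
    show "lvars u Path = rev q'" using s(2) u(4) q' by simp
    show "blocked u = set q'" using Cons.prems(1) u(5) by (simp add: dstate_def blocked_def)
    show "tables u Rem v = []" if "v \<notin> set q'" for v using Cons.prems(1) that q' u(5) by (simp add: dstate_def)
  qed
  have z: "(y, z) \<in> A" "z \<in> reach A x (set q')" using Cons.prems(4) by auto
  have "x \<in> set q'" using hd q' by (metis hd_in_set snoc_eq_iff_butlast)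
  then have "compl x \<notin> set q'" using reg by (auto simp: regular_iff)
  then have z': "z \<notin> set q'" using reach_not_deleted[OF z(2)] by auto
  have arcs': "set (vwalk_arcs (q' @ [z])) \<subseteq> A" 
  proof -
    have "q' \<noteq> []" "last q' = y" using q' by simp_all
    with set_vwalk_arcs_snoc[of q' z] arcs z(1) show ?thesis by simp
  qed
  have "\<exists>tr0 s1 tr1 t. exec enter u tr0 s1 \<and> iter path_nonempty dfs_body s1 tr1 t \<and>
        result q' (ext A x (q' @ [z])) u (tr0 @ tr1) t"
  proof (rule IH[OF du u(2) _ _ arcs' _ z(2)])
    show "distinct (q' @ [z])" using dist z' by simp
    show "set (q' @ [z]) \<subseteq> V" using q'_V z(1) A arcs_V by auto
    show "hd (q' @ [z]) = x" using hd q' by (cases q) auto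
  qed
  then obtain tr0 s1 tr1 t1 where
    e: "exec enter u tr0 s1" "iter path_nonempty dfs_body s1 tr1 t1" and
    r: "result q' (ext A x (q' @ [z])) u (tr0 @ tr1) t1" by blast
  have it1: "iter path_nonempty dfs_body s (Step s # (tr' @ tr0) @ tr1) t1"
    using iter_step[OF _ ex[OF e(1)] e(2)] s(2) by simp
  have rem1: "tables t1 Rem = (tables s Rem)(y := zs)" using r u(5) by (simp add: result_def)
  have d1: "dstate A x q' t1" using r by (simp add: result_def)
  have "tables t1 Rem y = zs" "sorted_wrt (\<lambda>a b. (a, b) \<in> L \<and> a \<noteq> b) zs"
    "set zs \<subseteq> {z. (y, z) \<in> A \<and> z \<in> reach A x (set q')}" using rem1 Cons.prems(3,4) by auto
  from Cons.IH[OF d1 this] obtain tr2 t where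
    i2: "iter path_nonempty dfs_body t1 tr2 t" "safe tr2" "frame t1 t" "dstate A x q' t"
    "tables t Rem = (tables t1 Rem)(y := [])" "lists_paths tr2 (\<Union>z\<in>set zs. ext A x (q' @ [z]))"
    "if zs = [] then tr2 = [] else mid D (?h * (enter_cost + 6) + 10) (output_cost + 6 * ?h) tr2" by blast
  let ?tr1 = "(Step s # tr') @ (tr0 @ tr1)"
  \<comment> \<open>The loop test and the five steps of \<open>dfs_body\<close> before
    \<open>enter\<close>; they raise the offset 4 of a subtree to 10.\<close>
  have sil: "silent 6 (Step s # tr')" using pre(1) by (auto simp: silent_def)
  have lp1: "lists_paths ?tr1 (ext A x (q' @ [z]))"
    using lists_paths_silent_append[OF sil] r by (auto simp: result_def)
  have mid1: "mid D (?h * (enter_cost + 6) + 10) (output_cost + 6 * ?h) ?tr1"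
    using silent_mid[OF sil] r unfolding result_def by (elim conjE) (rule mid_mono, auto)
  have "iter path_nonempty dfs_body s (?tr1 @ tr2) t" using iter_trans[OF it1 i2(1)] by simp
  moreover have "safe (?tr1 @ tr2)" using pre(2) r i2(2) s(1) by (auto simp: result_def safe_def)
  moreover have "frame s t" using frame_trans[OF fr frame_trans[OF _ i2(3)]] r by (simp add: result_def)
  moreover have "tables t Rem = (tables s Rem)(y := [])" using i2(5) rem1 by simp
  moreover have "lists_paths (?tr1 @ tr2) (ext A x (q' @ [z]) \<union> (\<Union>z\<in>set zs. ext A x (q' @ [z])))"
    using Cons.prems(3) by (intro lists_paths_append[OF lp1 i2(6)]) (auto intro: ext_less)
  moreover have "mid D (?h * (enter_cost + 6) + 10) (output_cost + 6 * ?h) (?tr1 @ tr2)"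
  proof (cases "zs = []")
    case True
    then show ?thesis using mid1 i2(7) by simp
  next
    case False
    then have "mid D (?h * (enter_cost + 6) + 10) (output_cost + 6 * ?h) tr2" using i2(7) by simp
    \<comment> \<open>The climb out of the first subtree and the descent into the next one form a
      single stretch, which must respect \<open>D\<close>.\<close>
    moreover have "?h * (enter_cost + 6) \<le> card V * (enter_cost + 6)" by (intro mult_le_mono1) simp
    then have "output_cost + 6 * ?h + (?h * (enter_cost + 6) + 10) \<le> D"
      using D diff_le_self[of "card V" "length q'"] by linarith
    ultimately show ?thesis by (rule mid_mid[OF mid1])
  qed
  ultimately show ?case using i2(4) by (intro exI[of _ "?tr1 @ tr2"] exI[of _ t]) auto
qed

text \<open>Paths have distinct vertices, so \<open>card V - length q\<close> decreases with every
  level.\<close>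

lemma dfs_subtree:
  assumes "dstate A x q s" "regs s rY = y" "distinct (q @ [y])" "set (q @ [y]) \<subseteq> V"
    "set (vwalk_arcs (q @ [y])) \<subseteq> A" "hd (q @ [y]) = x" "regular q" "y \<in> reach A x (set q)"
  shows "\<exists>tr0 s1 tr1 t. exec enter s tr0 s1 \<and> iter path_nonempty dfs_body s1 tr1 t \<and>
    result q (ext A x (q @ [y])) s (tr0 @ tr1) t"
  using assms
proof (induction "card V - length q" arbitrary: q s y rule: less_induct)
  case less
  note st = less.prems(1) and y = less.prems(2) and dist = less.prems(3) and q_V = less.prems(4)
    and arcs = less.prems(5) and hd = less.prems(6) and reg = less.prems(7) and viable = less.prems(8)
  let ?h = "card V - length q"
  have len: "length (q @ [y]) \<le> card V"
    using card_mono[OF finite_V q_V] distinct_card[OF dist] by simp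
  have s: "inv s" "tables s Rem y = []" "lvars s Path = rev q" "out_lists L A s" using st dist by (auto simp: dstate_def)
  show ?case
  proof (cases "compl y \<in> set q")
    case True
    then have "hd q = x" using hd by (cases q) auto
    then have P: "nr_path A x (q @ [y])" using True dist arcs reg by (auto simp: nr_path_def)
    from enter_complete[OF st y nr_path_mono[OF A P] skew0 True, of D] obtain tr0 s1 where
      e: "exec enter s tr0 s1" "\<forall>s'. Step s' \<in> set tr0 \<longrightarrow> inv s'" "outputs tr0 = path_events (good L) (q @ [y])"
      "mid D 4 output_cost tr0" "lvars s1 Path = rev (q @ [y])" "blocked s1 = set (q @ [y])" "tables s1 Rem = tables s Rem"
      unfolding wp_def by auto
    have inv1: "inv s1" using exec_inv'[where I = inv, OF e(1) s(1) e(2)] .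
    have fr1: "frame s s1" using enter_frame[OF exec_same[OF e(1)]] .
    from dfs_pop[of s1 y "rev q", OF _ _ inv1] e(5,7) s(2) obtain tr1 t where
      p: "iter path_nonempty dfs_body s1 tr1 t" "\<forall>s'. Step s' \<in> set tr1 \<longrightarrow> inv s'" "silent 5 tr1"
      "lvars t Path = rev q" "blocked t = blocked s1 - {y}" "tables t Rem = tables s1 Rem" "frame s1 t" "inv t" by auto
    have fr: "frame s t" using frame_trans[OF fr1 p(7)] .
    have "dstate A x q t"
      using st e(6,7) p(5,6) dist by (intro dstate_frame[OF st fr p(8) p(4)]) (auto simp: dstate_def)
    moreover have "lists_paths tr0 {q @ [y]}"
      unfolding lists_paths_def by (intro exI[of _ "[q @ [y]]"]) (simp add: e(3))
    then have "lists_paths (tr0 @ tr1) (ext A x (q @ [y]))"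
      unfolding ext_complete[OF dist arcs \<open>hd q = x\<close> True reg]
      by (rule lists_paths_append_silent[OF _ p(3)])
    moreover have "mid D (?h * (enter_cost + 6) + 4) (output_cost + 6 * ?h) (tr0 @ tr1)"
      by (rule mid_mono[OF mid_silent[OF e(4) p(3)]]) (use len in auto)
    moreover have "safe (tr0 @ tr1)" using e(2) p(2) by (simp add: safe_def)
    ultimately have "result q (ext A x (q @ [y])) s (tr0 @ tr1) t"
      using fr e(7) p(6) by (simp add: result_def)
    with e(1) p(1) show ?thesis by blast
  next
    case False
    define q' where "q' = q @ [y]"
    have reg': "regular q'" using reg False by (simp add: q'_def regular_snoc)
    \<comment> \<open>The start \<open>x\<close> lies on \<open>q\<close>, so reaching
      \<open>compl x\<close> would have completed a pair. Hence the no-dead-end property applies and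
      the list \<open>?R\<close> of successors is nonempty.\<close>
    have "y \<noteq> compl x"
    proof
      assume "y = compl x"
      with hd have "q \<noteq> []" by auto
      with hd have "x \<in> set q" by (metis hd_append2 hd_in_set)
      with False \<open>y = compl x\<close> show False by simp
    qed
    from reach_successor[OF viable this] obtain z where z: "(y, z) \<in> A" "z \<in> reach A x (set q')"
      by (auto simp: q'_def)
    from enter_regular[OF st y A x dist q_V False, of 0] obtain tr0 s1 where
      e: "exec enter s tr0 s1" "\<forall>e\<in>set tr0. \<exists>s'. e = Step s' \<and> inv s'" "lvars s1 Path = rev q'" "blocked s1 = set q'"
      "tables s1 Rem = (tables s Rem)(y := filter (\<lambda>v. v \<in> reach A x (set q')) (tables s Out y))"
      "length tr0 \<le> enter_cost"
      by (auto elim!: wpsE simp: q'_def)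
    let ?R = "filter (\<lambda>v. v \<in> reach A x (set q')) (tables s Out y)"
    have inv1: "inv s1" using exec_inv[OF e(1,2)] .
    have fr1: "frame s s1" using enter_frame[OF exec_same[OF e(1)]] .
    have sil0: "silent enter_cost tr0" using e(2,6) by (auto simp: silent_def)
    have R: "set ?R = {z. (y, z) \<in> A \<and> z \<in> reach A x (set q')}" "sorted_wrt (\<lambda>a b. (a, b) \<in> L \<and> a \<noteq> b) ?R"
      using s(4) by (auto simp: out_lists_def sorted_wrt_filter)
    have "?R \<noteq> []" using z R(1) by (metis (mono_tags, lifting) empty_iff list.set(1) mem_Collect_eq)
    have d1: "dstate A x q' s1"
      using e(3,4,5) st by (intro dstate_frame[OF st fr1 inv1]) (auto simp: dstate_def q'_def)
    have "\<exists>tr t. iter path_nonempty dfs_body s1 tr t \<and> safe tr \<and> frame s1 t \<and> dstate A x q' t \<and>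
      tables t Rem = (tables s1 Rem)(y := []) \<and> lists_paths tr (\<Union>z\<in>set ?R. ext A x (q' @ [z])) \<and>
      (if ?R = [] then tr = [] else
        mid D ((card V - length q') * (enter_cost + 6) + 10) (output_cost + 6 * (card V - length q')) tr)"
    proof (rule dfs_children[OF q'_def reg' _ _ _ _ _ d1])
      fix u z
      assume a: "dstate A x q' u" "regs u rY = z" "distinct (q' @ [z])" "set (q' @ [z]) \<subseteq> V"
        "set (vwalk_arcs (q' @ [z])) \<subseteq> A" "hd (q' @ [z]) = x" "z \<in> reach A x (set q')"
      have "card V - length q' < card V - length q" using len by (simp add: q'_def)
      from less.hyps[OF this a(1-6) reg' a(7)]
      show "\<exists>tr0 s1 tr1 t. exec enter u tr0 s1 \<and> iter path_nonempty dfs_body s1 tr1 t \<and>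
        result q' (ext A x (q' @ [z])) u (tr0 @ tr1) t" .
    next
      show "hd q' = x" "set (vwalk_arcs q') \<subseteq> A" "distinct q'" "set q' \<subseteq> V"
        unfolding q'_def by fact+
      show "tables s1 Rem y = ?R" using e(5) by simp
    qed (use R in auto)
    then obtain tr1 t1 where c: "iter path_nonempty dfs_body s1 tr1 t1" "safe tr1" "frame s1 t1" "dstate A x q' t1"
      "tables t1 Rem = (tables s1 Rem)(y := [])" "lists_paths tr1 (\<Union>z\<in>set ?R. ext A x (q' @ [z]))"
      "mid D ((card V - length q') * (enter_cost + 6) + 10) (output_cost + 6 * (card V - length q')) tr1"
      using \<open>?R \<noteq> []\<close> by auto
    have t1: "inv t1" "lvars t1 Path = y # rev q" "blocked t1 = set q'" using c(4) by (auto simp: dstate_def q'_def)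
    have rem: "tables t1 Rem = tables s Rem" using c(5) e(5) s(2) by auto
    from dfs_pop[OF t1(2) _ t1(1)] rem s(2) obtain tr2 t where
      p: "iter path_nonempty dfs_body t1 tr2 t" "\<forall>s'. Step s' \<in> set tr2 \<longrightarrow> inv s'" "silent 5 tr2"
      "lvars t Path = rev q" "blocked t = blocked t1 - {y}" "tables t Rem = tables t1 Rem" "frame t1 t" "inv t" by auto
    have fr: "frame s t" using frame_trans[OF fr1 frame_trans[OF c(3) p(7)]] .
    have "dstate A x q t"
      using st t1(3) rem p(5,6) dist by (intro dstate_frame[OF st fr p(8) p(4)]) (auto simp: dstate_def q'_def)
    moreover have "ext A x (q @ [y]) = (\<Union>z\<in>set ?R. ext A x (q' @ [z]))"
      using ext_regular[OF skew reg', of x] R(1) by (simp add: q'_def)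
    then have "lists_paths (tr0 @ tr1 @ tr2) (ext A x (q @ [y]))"
      using lists_paths_silent_append[OF sil0 lists_paths_append_silent[OF c(6) p(3)]] by simp
    moreover have "mid D (?h * (enter_cost + 6) + 4) (output_cost + 6 * ?h) (tr0 @ tr1 @ tr2)"
    proof (rule mid_mono[OF silent_mid[OF sil0 mid_silent[OF c(7) p(3)]]])
      \<comment> \<open>The additional level pays for this call of \<open>enter\<close> and for the
        six steps of descending, and likewise for the final pop.\<close>
      have h: "?h = Suc (card V - length q')" using len by (simp add: q'_def)
      show "enter_cost + ((card V - length q') * (enter_cost + 6) + 10) \<le> ?h * (enter_cost + 6) + 4"
        unfolding h by simp
      show "output_cost + 6 * (card V - length q') + 5 \<le> output_cost + 6 * ?h"
        unfolding h by simp
    qed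
    moreover have "safe (tr0 @ tr1 @ tr2)" using e(2) c(2) p(2) by (auto simp: safe_def)
    ultimately have "result q (ext A x (q @ [y])) s (tr0 @ tr1 @ tr2) t"
      using fr rem p(6) by (simp add: result_def)
    moreover have "iter path_nonempty dfs_body s1 (tr1 @ tr2) t" using iter_trans[OF c(1) p(1)] .
    ultimately show ?thesis using e(1) by blast
  qed
qed

text \<open>Either the initial test fails and the whole run is one silent search, or at least one
  path is delivered.\<close>

lemma enum_spec:
  assumes st: "dstate A x [] s"
  shows "\<exists>tr t. exec enum s tr t \<and> safe tr \<and> frame s t \<and> dstate A x [] t \<and> lists_paths tr {P. nr_path A x P} \<and>
    (silent enter_cost tr \<or>
     mid D (enter_cost + card V * (enter_cost + 6) + 6) (output_cost + 6 * card V + 1) tr)"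
proof -
  have s: "inv s" "in_lists A s" "regs s rX = x" "lvars s Ord = ls" "blocked s = {}" "lvars s Path = []"
    "\<forall>v. tables s Rem v = []" using st by (auto simp: dstate_def)
  have ord: "set (lvars s Ord) = V" "distinct (lvars s Ord)" using s(4) set_ls distinct_ls by auto
  from bfs_spec[OF s(1,2) A _ ord, of 0] x s(3,5) obtain tr1 s1 where
    b: "exec bfs s tr1 s1" "\<forall>e\<in>set tr1. \<exists>s'. e = Step s' \<and> inv s'" "seen s1 = reach A x {}"
    "length tr1 \<le> 13 * card V + 6 * card A0 + 6" by (auto elim!: wpsE)
  have inv1: "inv s1" using exec_inv[OF b(1,2)] .
  have same1: "same bfs s s1" using exec_same[OF b(1)] .
  have fr1: "frame s s1" using same1 wr_bfs unfolding same_def frame_def by auto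
  have s1: "lvars s1 Path = []" "tables s1 Rem = tables s Rem" "tables s1 OnPath = tables s OnPath" "regs s1 rX = x"
    using same1 wr_bfs s unfolding same_def by auto
  have d1: "dstate A x [] s1"
    using s(5,7) s1 by (intro dstate_frame[OF st fr1 inv1]) (auto simp: blocked_def)
  have safe1: "safe tr1" using b(2) by (auto simp: safe_def)
  have paths: "{P. nr_path A x P} = ext A x [x]"
  proof -
    have "\<exists>r. P = [x] @ r" if "nr_path A x P" for P using nr_path_hd[OF that] by (cases P) auto
    then show ?thesis by (auto simp: ext_def)
  qed
  have reg: "regular [x]" by (simp add: regular_iff)
  show ?thesis
  proof (cases "x \<in> reach A x {}")
    case False
    then have b1: "bval (IsEmpty (Tab Seen (Reg rX))) s1" using b(3) s1(4) by (auto simp: seen_def)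
    have e: "exec enum s (tr1 @ [Step s1, Step s1]) s1"
      unfolding enum_def using exec.Seq[OF b(1) exec.IfTrue[OF b1 exec.Skip]] .
    have sil: "silent enter_cost (tr1 @ [Step s1, Step s1])"
      using b(2,4) by (auto simp: silent_def enter_cost_def)
    \<comment> \<open>If \<open>compl x\<close> is not reachable from \<open>x\<close>, then no
      out-neighbour of \<open>x\<close> reaches it even with \<open>x\<close> deleted, so the set of
      paths is empty.\<close>
    have "reach A x {x} \<subseteq> reach A x {}"
      by (rule reach_least) (auto intro: reach_base reach_step)
    then have "ext A x [x] = {}"
      using ext_regular[OF skew reg, of x] False reach_step[of x _ A "{}" x] by auto
    then show ?thesis using e sil safe1 inv1 fr1 d1 lists_paths_silent[OF sil] paths
      by (intro exI[of _ "tr1 @ [Step s1, Step s1]"] exI[of _ s1]) auto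
  next
    case True
    then have b1: "\<not> bval (IsEmpty (Tab Seen (Reg rX))) s1" using b(3) s1(4) by (auto simp: seen_def)
    define u where "u = s1\<lparr>regs := (regs s1)(rY := x)\<rparr>"
    have e2: "exec (rY :=\<^sub>R Reg rX) s1 [Step u] u" by (rule exec.SetR) (simp add: u_def s1)
    have fr_u: "frame s1 u" by (simp add: frame_def u_def)
    have inv_u: "inv u" using inv1 by (simp add: u_def bounded_def)
    have d_u: "dstate A x [] u"
      using d1 by (intro dstate_frame[OF d1 fr_u inv_u]) (auto simp: dstate_def u_def blocked_def)
    have "\<exists>tr0 s1 tr1 t. exec enter u tr0 s1 \<and> iter path_nonempty dfs_body s1 tr1 t \<and>
        result [] (ext A x ([] @ [x])) u (tr0 @ tr1) t"
      by (rule dfs_subtree[OF d_u]) (use x True in \<open>auto simp: u_def regular_iff\<close>)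
    then obtain tr2 s2 tr3 t where r: "exec enter u tr2 s2" "iter path_nonempty dfs_body s2 tr3 t"
      "result [] (ext A x [x]) u (tr2 @ tr3) t" by auto
    have d_t: "dstate A x [] t" "inv t" using r(3) by (auto simp: result_def dstate_def)
    then have "exec (WHILE path_nonempty DO dfs_body) t [Step t] t"
      by (intro exec.WhileFalse) (simp add: dstate_def)
    from iter_wpshile[OF r(2) this] have w: "exec (WHILE path_nonempty DO dfs_body) s2 (tr3 @ [Step t]) t" .
    let ?tr = "(tr1 @ [Step s1, Step u]) @ (tr2 @ tr3) @ [Step t]"
    have e: "exec enum s ?tr t"
      using exec.Seq[OF b(1) exec.IfFalse[OF b1 exec.Seq[OF e2 exec.Seq[OF r(1) w]]]]
      unfolding enum_def dfs_body_def by simp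
    have sil: "silent (enter_cost + 2) (tr1 @ [Step s1, Step u])"
      using b(2,4) by (auto simp: silent_def enter_cost_def)
    have sil': "silent 1 [Step t]" by (simp add: silent_def)
    have m: "mid D (card V * (enter_cost + 6) + 4) (output_cost + 6 * card V) (tr2 @ tr3)"
      using r(3) by (simp add: result_def)
    have mid: "mid D (enter_cost + card V * (enter_cost + 6) + 6) (output_cost + 6 * card V + 1) ?tr"
      by (rule mid_mono[OF silent_mid[OF sil mid_silent[OF m sil']]]) auto
    have lp: "lists_paths ?tr {P. nr_path A x P}"
      unfolding paths using r(3)
      by (intro lists_paths_silent_append[OF sil] lists_paths_append_silent[OF _ sil']) (simp add: result_def)
    have fr: "frame s t" using frame_trans[OF fr1 frame_trans[OF fr_u]] r(3) by (simp add: result_def)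
    have safe: "safe ?tr" using safe1 inv1 inv_u d_t(2) r(3) by (simp add: result_def)
    show ?thesis by (rule exI[of _ ?tr], rule exI[of _ t]) (use e safe fr d_t(1) lp mid in blast)
  qed
qed

end

end

section \<open>The loop over the unit-clauses\<close>

definition left :: "'v clause set \<Rightarrow> 'v lit list \<Rightarrow> 'v clause set" where
  "left F Y = F - (\<lambda>y. {y}) ` set Y"

lemma idg_remove_unit: "parcs (idg (G - {{x}})) = parcs (idg G) - {(compl x, x)}"
proof -
  have "{compl u, v} = {x} \<longleftrightarrow> u = compl x \<and> v = x" for u v by auto
  then have "(u, v) \<in> parcs (idg (G - {{x}})) \<longleftrightarrow> (u, v) \<in> parcs (idg G) - {(compl x, x)}" for u v
    unfolding mem_idg Diff_iff singleton_iff prod.inject by simp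
  then show ?thesis by auto
qed

definition enum_step :: com where
  "enum_step = (IF IsEmpty (Tab IsUnit (Reg rX)) THEN Skip ELSE (enum ;; remove_unit))"

context ordered_network
begin

text \<open>The sum dominates both outcomes for a unit-clause: a fruitless search, or the stretch
  after its last path; in both cases followed by the removal.\<close>

definition unit_cost :: nat where
  "unit_cost = output_cost + 6 * card V + enter_cost + 15 * card A0 + 20"

text \<open>The steps from the beginning of a successful search to its first path, including the few
  loop steps in front of it.\<close>

definition first_cost :: nat where
  "first_cost = enter_cost + card V * (enter_cost + 6) + 10"

context
  fixes F :: "'v clause set" and D :: nat
  assumes A0: "A0 = parcs (idg F)"
    and D: "output_cost + 6 * card V + card V * (enter_cost + 6) + 20 \<le> D"
    and units: "\<And>x. {x} \<in> F \<Longrightarrow> x \<in> V"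
begin

abbreviation is_unit :: "'v lit \<Rightarrow> bool" where
  "is_unit x \<equiv> {x} \<in> F"

text \<open>The loop knows the treated literals as the initial segment \<open>Y\<close> of
  \<open>ls\<close>; sortedness identifies its units with those smaller than
  \<open>x\<close>.\<close>

lemma remaining_eq_left:
  assumes "ls = Y @ x # xs"
  shows "remaining L F x = left F Y"
proof -
  have "(y, x) \<in> L \<and> y \<noteq> x \<longleftrightarrow> y \<in> set Y" if "{y} \<in> F" for y
  proof
    assume *: "(y, x) \<in> L \<and> y \<noteq> x"
    have "y \<in> set ls" using units[OF that] set_ls by simp
    moreover have "y \<notin> set xs"
    proof
      assume "y \<in> set xs"
      then have "(x, y) \<in> L" using sorted_ls assms by (auto simp: sorted_wrt_append)
      with * lin show False unfolding order_on_defs antisym_def by blast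
    qed
    ultimately show "y \<in> set Y" using * assms by auto
  qed (use sorted_ls assms in \<open>auto simp: sorted_wrt_append\<close>)
  then show ?thesis unfolding remaining_def left_def by auto
qed

lemma remove_unit_frame:
  assumes "same remove_unit s t"
  shows "regs t rX = regs s rX \<and> lvars t Todo = lvars s Todo \<and> lvars t Path = lvars s Path \<and> lvars t Ord = lvars s Ord \<and>
    tables t IsUnit = tables s IsUnit \<and> tables t OnPath = tables s OnPath \<and> tables t Rem = tables s Rem"
  using assms unfolding same_def remove_unit_def by auto

text \<open>The steps since the last delivered path are bounded by a budget that grows with each treated literal
  and suffices for the first path of the next successful search.\<close>
lemma enum_all_loop:
  assumes "ls = Y @ xs" "lvars s Todo = xs" "dstate (parcs (idg (left F Y))) (regs s rX) [] s"
    "\<forall>v. tables s IsUnit v \<noteq> [] \<longleftrightarrow> is_unit v"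
  shows "\<exists>tr t. exec (for_each rX Todo enum_step) s tr t \<and> safe tr \<and>
    lists_paths tr (\<Union>x \<in> {x \<in> set xs. is_unit x}. NR x (idg (remaining L F x))) \<and>
    (\<forall>tr0 b. pre D b tr0 \<longrightarrow>
      b + (10 * length xs + 1 + length (filter is_unit xs) * unit_cost) + first_cost \<le> D \<longrightarrow>
      pre D (b + (10 * length xs + 1 + length (filter is_unit xs) * unit_cost)) (tr0 @ tr))"
  using assms
proof (induction xs arbitrary: Y s)
  case Nil
  have "inv s" using Nil(3) by (simp add: dstate_def)
  have sil: "silent 1 [Step s]" by (simp add: silent_def)
  have e: "exec (for_each rX Todo enum_step) s [Step s] s"
    unfolding for_each_def by (rule exec.WhileFalse) (use Nil(2) in simp)
  have "pre D (b + 1) (tr0 @ [Step s])" if "pre D b tr0" for tr0 b using pre_silent[OF that sil] .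
  with e \<open>inv s\<close> lists_paths_silent[OF sil] show ?case
    by (intro exI[of _ "[Step s]"] exI[of _ s]) simp
next
  case (Cons x xs)
  let ?A = "parcs (idg (left F Y))" and ?A' = "parcs (idg (left F (Y @ [x])))"
  let ?c = "rX :=\<^sub>R Top (Lst Todo) ;; Todo :=\<^sub>S Pop (Lst Todo) ;; enum_step"
  let ?S = "\<lambda>xs. (\<Union>x \<in> {x \<in> set xs. is_unit x}. NR x (idg (remaining L F x)))"
  let ?B = "\<lambda>xs. 10 * length xs + 1 + length (filter is_unit xs) * unit_cost"
  define s1 where "s1 = s\<lparr>regs := (regs s)(rX := x)\<rparr>"
  define s2 where "s2 = s1\<lparr>lvars := (lvars s1)(Todo := xs)\<rparr>"
  have s: "inv s" using Cons.prems(3) by (simp add: dstate_def)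
  have e1: "exec (rX :=\<^sub>R Top (Lst Todo)) s [Step s1] s1" by (rule exec.SetR) (simp add: s1_def Cons.prems(2))
  have e2: "exec (Todo :=\<^sub>S Pop (Lst Todo)) s1 [Step s2] s2" by (rule exec.SetS) (simp add: s1_def s2_def Cons.prems(2))
  have "length xs \<le> K" using s lbD[of K "lvars s" Todo] Cons.prems(2) by (simp add: bounded_def)
  then have inv12: "inv s1" "inv s2" using s by (auto simp: s1_def s2_def bounded_def)
  have s2: "regs s2 rX = x" "lvars s2 Todo = xs" "tables s2 = tables s" by (auto simp: s1_def s2_def)
  have d2: "dstate ?A x [] s2"
    using Cons.prems(3) inv12 unfolding dstate_def in_lists_def out_lists_def blocked_def by (simp add: s1_def s2_def)
  have guard: "bval (NotB (IsEmpty (Lst Todo))) s" using Cons.prems(2) by simp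
  have x_V: "x \<in> V" using Cons.prems(1) set_ls by auto
  have ls: "ls = (Y @ [x]) @ xs" using Cons.prems(1) by simp
  show ?case
  proof (cases "is_unit x")
    case False
    have "left F (Y @ [x]) = left F Y" using False by (auto simp: left_def)
    then have "dstate ?A' (regs s2 rX) [] s2" using d2 s2(1) by simp
    from Cons.IH[OF ls s2(2) this] Cons.prems(4) s2(3) obtain tr t where
      t: "exec (for_each rX Todo enum_step) s2 tr t" "safe tr" "lists_paths tr (?S xs)"
      and p: "\<And>tr0 b. pre D b tr0 \<Longrightarrow> b + ?B xs + first_cost \<le> D \<Longrightarrow> pre D (b + ?B xs) (tr0 @ tr)" by auto
    have "tables s IsUnit x = []" using False Cons.prems(4) by blast
    then have "bval (IsEmpty (Tab IsUnit (Reg rX))) s2" using s2 by simp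
    then have e3: "exec enum_step s2 [Step s2, Step s2] s2"
      unfolding enum_step_def using exec.IfTrue[OF _ exec.Skip] by fastforce
    let ?tr = "[Step s, Step s1, Step s2, Step s2, Step s2]"
    have e: "exec (for_each rX Todo enum_step) s (?tr @ tr) t"
      using exec.WhileTrue[OF guard exec.Seq[OF e1 exec.Seq[OF e2 e3]] t(1)[unfolded for_each_def]]
      unfolding for_each_def by simp
    have sil: "silent 10 ?tr" by (simp add: silent_def)
    have "?S (x # xs) = ?S xs" using False by auto
    then have lp: "lists_paths (?tr @ tr) (?S (x # xs))" using lists_paths_silent_append[OF sil t(3)] by simp
    have "pre D (b + ?B (x # xs)) (tr0 @ ?tr @ tr)"
      if "pre D b tr0" "b + ?B (x # xs) + first_cost \<le> D" for tr0 b
    proof -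
      have B: "b + ?B (x # xs) = b + 10 + ?B xs" using False by simp
      have "pre D (b + 10 + ?B xs) ((tr0 @ ?tr) @ tr)"
        by (rule p[OF pre_silent[OF that(1) sil]]) (use that(2)[unfolded B] in simp)
      then show ?thesis unfolding B by simp
    qed
    moreover have "safe (?tr @ tr)" using s inv12 t(2) by simp
    ultimately show ?thesis using e lp by blast
  next
    case True
    have A: "?A \<subseteq> A0" unfolding A0 left_def by (intro idg_mono) auto
    have A': "?A' = ?A - {(compl x, x)}"
      unfolding idg_remove_unit[symmetric] left_def by (rule arg_cong[of _ _ "\<lambda>G. parcs (idg G)"]) auto
    have skew: "skew ?A" "skew A0" unfolding A0 by (rule skew_idg)+
    from enum_spec[OF A skew x_V D d2] obtain tr1 t1 where
      m: "exec enum s2 tr1 t1" "safe tr1" "frame s2 t1" "dstate ?A x [] t1" "lists_paths tr1 {P. nr_path ?A x P}"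
      "silent enter_cost tr1 \<or>
       mid D (enter_cost + card V * (enter_cost + 6) + 6) (output_cost + 6 * card V + 1) tr1" by blast
    have t1: "inv t1" "in_lists ?A t1" "out_lists L ?A t1" "regs t1 rX = x" using m(4) by (auto simp: dstate_def)
    from remove_unit_spec[OF t1(1,2,3) A t1(4), of 0] obtain tr2 t2 where
      r: "exec remove_unit t1 tr2 t2" "\<forall>e\<in>set tr2. \<exists>s'. e = Step s' \<and> inv s'" "in_lists ?A' t2" "out_lists L ?A' t2"
      "length tr2 \<le> 15 * card A0 + 10" unfolding A' by (auto elim!: wpsE)
    have inv2: "inv t2" using exec_inv[OF r(1,2)] .
    note fr2 = remove_unit_frame[OF exec_same[OF r(1)]]
    have t2: "lvars t2 Todo = xs" "tables t2 IsUnit = tables s IsUnit" "regs t2 rX = x"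
      using fr2 m(3) s2 t1(4) by (auto simp: frame_def)
    have d3: "dstate ?A' (regs t2 rX) [] t2"
      using inv2 r(3,4) m(4) fr2 t2 unfolding dstate_def blocked_def by auto
    from Cons.IH[OF ls t2(1) d3] Cons.prems(4) t2(2) obtain tr t where
      t: "exec (for_each rX Todo enum_step) t2 tr t" "safe tr" "lists_paths tr (?S xs)"
      and p: "\<And>tr0 b. pre D b tr0 \<Longrightarrow> b + ?B xs + first_cost \<le> D \<Longrightarrow> pre D (b + ?B xs) (tr0 @ tr)" by auto
    have "\<not> bval (IsEmpty (Tab IsUnit (Reg rX))) s2" using True Cons.prems(4) s2 by simp
    then have e3: "exec enum_step s2 (Step s2 # tr1 @ tr2) t2"
      unfolding enum_step_def using exec.IfFalse[OF _ exec.Seq[OF m(1) r(1)]] by blast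
    let ?pre = "[Step s, Step s1, Step s2, Step s2]"
    let ?tr = "(?pre @ tr1) @ tr2"
    have e: "exec (for_each rX Todo enum_step) s (?tr @ tr) t"
      using exec.WhileTrue[OF guard exec.Seq[OF e1 exec.Seq[OF e2 e3]] t(1)[unfolded for_each_def]]
      unfolding for_each_def by simp
    have sil0: "silent 4 ?pre" by (simp add: silent_def)
    have sil2: "silent (15 * card A0 + 10) tr2" using r(2,5) by (auto simp: silent_def)
    have "NR x (idg (remaining L F x)) = {P. nr_path ?A x P}"
      using remaining_eq_left[OF Cons.prems(1)] by (auto simp: NR_iff)
    then have S: "?S (x # xs) = {P. nr_path ?A x P} \<union> ?S xs" using True by auto
    \<comment> \<open>Paths belonging to different unit-clauses are already ordered by their first
      vertices.\<close>
    have less: "pathlex L P Q" if "P \<in> {P. nr_path ?A x P}" "Q \<in> ?S xs" for P Q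
    proof -
      from that(2) obtain z where z: "z \<in> set xs" "nr_path (parcs (idg (remaining L F z))) z Q" by (auto simp: NR_iff)
      have "(x, z) \<in> L - Id" using sorted_ls Cons.prems(1) z(1) by (auto simp: sorted_wrt_append)
      moreover have "nr_path ?A x P" using that(1) by simp
      from nr_path_hd[OF this] obtain P' where "P = x # P'" by (cases P) auto
      moreover obtain Q' where "Q = z # Q'" using nr_path_hd[OF z(2)] by (cases Q) auto
      ultimately show ?thesis using pathlex_differ[OF lin, of x z "[]"] by simp
    qed
    have lp: "lists_paths (?tr @ tr) (?S (x # xs))"
      unfolding S
      by (rule lists_paths_append[OF lists_paths_append_silent[OF lists_paths_silent_append[OF sil0 m(5)] sil2] t(3) less])
    have "pre D (b + ?B (x # xs)) (tr0 @ ?tr @ tr)"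
      if b: "pre D b tr0" "b + ?B (x # xs) + first_cost \<le> D" for tr0 b
    proof -
      have B: "b + ?B (x # xs) = b + 10 + unit_cost + ?B xs" using True by simp
      \<comment> \<open>A fruitless search extends the open stretch. A successful one closes it, for
        which the reserve \<open>first_cost\<close> is needed, and opens a new stretch that is short
        enough for the same bound.\<close>
      have "pre D (b + 10 + unit_cost) (tr0 @ ?tr)"
        using m(6)
      proof
        assume *: "silent enter_cost tr1"
        show ?thesis
          by (rule pre_mono[OF pre_silent[OF b(1) silent_append[OF silent_append[OF sil0 *] sil2]]])
            (simp add: unit_cost_def)
      next
        assume *: "mid D (enter_cost + card V * (enter_cost + 6) + 6) (output_cost + 6 * card V + 1) tr1"
        have le: "b + (4 + (enter_cost + card V * (enter_cost + 6) + 6)) \<le> D" using b(2) by (simp add: first_cost_def)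
        show ?thesis
          by (rule pre_mono[OF pre_mid[OF b(1) mid_silent[OF silent_mid[OF sil0 *] sil2] le]])
            (simp add: unit_cost_def)
      qed
      from p[OF this] b(2)[unfolded B] have "pre D (b + 10 + unit_cost + ?B xs) ((tr0 @ ?tr) @ tr)" by simp
      then show ?thesis unfolding B by simp
    qed
    moreover have "safe (?tr @ tr)" using s inv12 m(2) r(2) t(2) by (auto simp: safe_def)
    ultimately show ?thesis using e lp by blast
  qed
qed

end

end

section \<open>Sizes\<close>

lemma length_flat: "length (flat bs) = 2 * length bs"
  by (induction bs) auto

context
  fixes F :: "'v clause set" and L us bs ls
  assumes F: "clause_set F" and card: "\<forall>C\<in>F. card C = 1 \<or> card C = 2"
    and pres: "presents us bs ls F L"
begin

lemma us_bs:
  "distinct us" "set us = {a. {a} \<in> F}" "distinct (map (\<lambda>(a, b). {a, b}) bs)"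
  "(\<lambda>(a, b). {a, b}) ` set bs = {C \<in> F. card C = 2}" "set ls = lits F"
  "sorted_wrt (\<lambda>a b. (a, b) \<in> L \<and> a \<noteq> b) ls"
  using pres by (auto simp: presents_def)

lemma units_eq: "{C \<in> F. card C = 1} = (\<lambda>a. {a}) ` set us"
  using us_bs(2) by (auto simp: card_1_singleton_iff)

lemma length_us: "length us = num_units F"
proof -
  have "inj_on (\<lambda>a. {a}) (set us)" by (simp add: inj_on_def)
  then show ?thesis unfolding num_units_def units_eq using us_bs(1) by (simp add: card_image distinct_card)
qed

lemma length_bs: "length bs = card {C \<in> F. card C = 2}"
  using distinct_card[OF us_bs(3)] us_bs(4) by simp

lemma num_occs_eq: "num_occs F = length us + 2 * length bs"
proof -
  have fin: "finite F" using F by (simp add: clause_set_def)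
  have "F = {C \<in> F. card C = 1} \<union> {C \<in> F. card C = 2}" using card by auto
  then have "num_occs F = (\<Sum>C\<in>{C \<in> F. card C = 1} \<union> {C \<in> F. card C = 2}. card C)"
    by (simp add: num_occs_def)
  also have "\<dots> = (\<Sum>C\<in>{C \<in> F. card C = 1}. card C) + (\<Sum>C\<in>{C \<in> F. card C = 2}. card C)"
    using fin by (intro sum.union_disjoint) auto
  also have "\<dots> = length us + 2 * length bs"
    by (simp add: length_us length_bs num_units_def)
  finally show ?thesis .
qed

lemma Union_F: "\<Union>F = set us \<union> set (flat bs)"
proof -
  have "F = (\<lambda>a. {a}) ` set us \<union> (\<lambda>(a, b). {a, b}) ` set bs"
    using card unfolding units_eq[symmetric] us_bs(4) by auto
  then have "\<Union>F = \<Union>((\<lambda>a. {a}) ` set us) \<union> \<Union>((\<lambda>(a, b). {a, b}) ` set bs)" by simp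
  also have "\<dots> = set us \<union> set (flat bs)" by auto
  finally show ?thesis .
qed

lemma num_vars_le: "num_vars F \<le> num_occs F"
proof -
  have "vars F = set (map var (us @ flat bs))" unfolding vars_def Union_F by (simp only: set_map set_append)
  then have "num_vars F \<le> length (us @ flat bs)"
    unfolding num_vars_def using card_length[of "map var (us @ flat bs)"] by simp
  then show ?thesis by (simp add: num_occs_eq length_flat)
qed

lemma lits_bounds: "finite (lits F)" "card (lits F) \<le> 2 * num_vars F"
proof -
  have fin: "finite (vars F)" unfolding vars_def Union_F by (intro finite_imageI finite_UnI finite_set)
  have "a \<in> Pos ` vars F \<union> Neg ` vars F" if "a \<in> lits F" for a
    using that by (cases a) (auto simp: lits_def)
  then have sub: "lits F \<subseteq> Pos ` vars F \<union> Neg ` vars F" by blast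
  with fin show "finite (lits F)" by (auto intro: finite_subset)
  have "card (lits F) \<le> card (Pos ` vars F \<union> Neg ` vars F)" using fin by (intro card_mono[OF _ sub]) auto
  also have "\<dots> \<le> card (Pos ` vars F) + card (Neg ` vars F)" by (rule card_Un_le)
  also have "\<dots> \<le> 2 * num_vars F"
    using card_image_le[OF fin, of Pos] card_image_le[OF fin, of Neg] by (simp add: num_vars_def)
  finally show "card (lits F) \<le> 2 * num_vars F" .
qed

text \<open>A unit-clause contributes one arc and a binary clause two, matching their literal
  occurrences.\<close>

lemma card_arcs_le: "card (parcs (idg F)) \<le> num_occs F"
proof -
  let ?f = "\<lambda>a. (compl a, a)" and ?g = "\<lambda>(a, b). (compl a, b)" and ?h = "\<lambda>(a, b). (compl b, a)"
  have "(u, v) \<in> ?f ` set us \<union> ?g ` set bs \<union> ?h ` set bs" if "{compl u, v} \<in> F" for u v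
  proof (cases "card {compl u, v} = 1")
    case True
    then have "v = compl u" by (cases "v = compl u") (auto simp: card_insert_if)
    with that have "v \<in> set us" "u = compl v" using us_bs(2) by auto
    then show ?thesis by auto
  next
    case False
    with that card have "{compl u, v} \<in> (\<lambda>(a, b). {a, b}) ` set bs" unfolding us_bs(4) by auto
    then obtain a b where ab: "(a, b) \<in> set bs" "{compl u, v} = {a, b}" by auto
    then have "compl u = a \<and> v = b \<or> compl u = b \<and> v = a" by (auto simp: doubleton_eq_iff)
    then have "(u, v) = ?g (a, b) \<or> (u, v) = ?h (a, b)" by auto
    with ab(1) show ?thesis by blast
  qed
  then have sub: "parcs (idg F) \<subseteq> ?f ` set us \<union> ?g ` set bs \<union> ?h ` set bs"
    by (intro subrelI) (simp only: mem_idg)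
  have "card (parcs (idg F)) \<le> card (?f ` set us \<union> ?g ` set bs \<union> ?h ` set bs)" by (intro card_mono[OF _ sub]) simp
  also have "\<dots> \<le> card (?f ` set us) + card (?g ` set bs) + card (?h ` set bs)"
    by (meson add_le_mono1 card_Un_le le_trans)
  also have "\<dots> \<le> length us + length bs + length bs"
    by (intro add_mono order_trans[OF card_image_le card_length]) auto
  finally show ?thesis by (simp add: num_occs_eq)
qed

end

text \<open>Ten list variables and four registers. Each vertex has one cell in each of six tables,
  and three of these are marks of length at most 1, which gives 9; the degree bounds of
  \<open>In\<close>, \<open>Out\<close> and \<open>Rem\<close> sum to three times the number of
  arcs.\<close>

lemma (in network) space_le:
  assumes inv: "inv s" and V: "V = lits F"
  shows "space F s \<le> 10 * (1 + K) + 4 + 9 * card V + 3 * card A0"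
proof -
  have lvars: "(UNIV :: lvar set) = {Units, Bins, Ord, Todo, Path, Cur, Nxt, It, Tmp, Fwd}"
    using lvar.exhaust by auto
  have regs: "(UNIV :: reg set) = {rX, rY, rV, rW}" using reg.exhaust by auto
  have tables: "(UNIV :: table set) = {Out, In, IsUnit, OnPath, Seen, Rem}" using table.exhaust by auto
  have "(\<Sum>i\<in>UNIV. 1 + length (lvars s i)) \<le> (\<Sum>i\<in>(UNIV :: lvar set). 1 + K)"
    using inv by (intro sum_mono) (simp add: bounded_def)
  also have "\<dots> = 10 * (1 + K)" by (simp add: lvars)
  finally have 1: "(\<Sum>i\<in>UNIV. 1 + length (lvars s i)) \<le> 10 * (1 + K)" .
  have 2: "card (UNIV :: reg set) = 4" by (simp add: regs)
  have cell: "length (tables s t a) \<le> cap t a" for t a using inv by (simp add: bounded_def)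
  have out: "tables s t a = []" if "a \<notin> V" for t a
  proof -
    have "{v. (a, v) \<in> A0} = {}" "{v. (v, a) \<in> A0} = {}" using arcs_V that by auto
    then have "cap t a = 0" using that by (cases t) (auto simp: indeg_def outdeg_def)
    with cell[of t a] show ?thesis by simp
  qed
  then have sup: "lits F \<union> {a. tables s t a \<noteq> []} = V" for t unfolding V[symmetric] by blast
  have "(\<Sum>t\<in>UNIV. \<Sum>a\<in>lits F \<union> {a. tables s t a \<noteq> []}. 1 + length (tables s t a)) \<le> (\<Sum>t\<in>UNIV. \<Sum>a\<in>V. 1 + cap t a)"
    unfolding sup using cell by (intro sum_mono) simp
  also have "\<dots> = 9 * card V + ((\<Sum>v\<in>V. indeg A0 v) + 2 * (\<Sum>v\<in>V. outdeg A0 v))"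
    by (simp add: tables sum.distrib sum_Suc)
  also have "\<dots> = 9 * card V + 3 * card A0"
    using sum_indeg[OF finite_V arcs_V] sum_outdeg[OF finite_V arcs_V] by simp
  finally show ?thesis unfolding space_def using 1 2 by simp
qed

section \<open>The bounds with explicit constants, in terms of the size of the input\<close>

theorem theorem7p8:
  "\<exists>c::nat. \<forall>(F :: 'v clause set) L us bs ls.
     clause_set F \<and> (\<forall>C\<in>F. card C = 1 \<or> card C = 2) \<and> linear_order_on (lits F) L \<and>
     presents us bs ls F L \<longrightarrow>
     (\<exists>tr s. exec enum_all (input us bs ls) tr s \<and>
        set (delivered tr) = (\<Union>x \<in> {x. {x} \<in> F}. NR x (idg (remaining L F x))) \<and>
        sorted_wrt (pathlex L) (delivered tr) \<and>
        (\<forall>d \<in> set (butlast (delays is_delivered tr)). d \<le> c * max 1 (num_vars F * num_occs F)) \<and>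
        last (delays is_delivered tr) \<le> c * max 1 (num_units F * num_occs F) \<and>
        (\<forall>s'. Step s' \<in> set tr \<longrightarrow> space F s' \<le> c * max 1 (num_occs F)) \<and>
        set (printed tr) = {F'. F' \<subseteq> F \<and> min_unsat F' \<and> (\<exists>z. {z} \<in> F')} \<and>
        sorted_wrt (mu_less L F) (printed tr) \<and>
        (\<forall>m < length (delays is_printed tr).
           delays is_printed tr ! m \<le> c * max 1 ((m + 1) * num_vars F * num_occs F)))"
proof (rule exI[of _ 1300], intro allI impI, elim conjE)
  fix F :: "'v clause set" and L us bs ls
  assume F: "clause_set F" and card: "\<forall>C\<in>F. card C = 1 \<or> card C = 2" and lin: "linear_order_on (lits F) L"
    and pres: "presents us bs ls F L"
  let ?n = "num_vars F" and ?l = "num_occs F" and ?u = "num_units F" and ?s = "input us bs ls"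
  note us_bs = us_bs[OF F card pres]
  have l: "?l = length us + 2 * length bs" and u: "length us = ?u" and n_l: "?n \<le> ?l"
    and V: "card (lits F) \<le> 2 * ?n" and A: "card (parcs (idg F)) \<le> ?l"
    using num_occs_eq[OF F card pres] length_us[OF F card pres] num_vars_le[OF F card pres]
      lits_bounds(2)[OF F card pres] card_arcs_le[OF F card pres] by auto
  \<comment> \<open>There may be two literals per variable and as many variables as literal
    occurrences, hence twice \<open>num_occs F\<close> as bound for the list variables.\<close>
  interpret ordered_network "lits F" "parcs (idg F)" "2 * ?l" L ls
    using lits_bounds(1)[OF F card pres] idg_arcs_lits V n_l lin us_bs(5,6) by unfold_locales auto
  have lvars_s: "lvars ?s Units = us" "lvars ?s Bins = flat bs" "lvars ?s Ord = ls" "tables ?s = (\<lambda>_ _. [])"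
    by (auto simp: input_def)
  have inv_s: "inv ?s"
    unfolding bounded_def lb_def tb_def tb1_def using length_ls V n_l l
    by (auto simp: input_def length_flat)
  have space: "space F s' \<le> 1300 * max 1 ?l" if "inv s'" for s'
    using space_le[OF that refl] V n_l A by (simp add: max_def)
  show "\<exists>tr s. exec enum_all ?s tr s \<and>
        set (delivered tr) = (\<Union>x \<in> {x. {x} \<in> F}. NR x (idg (remaining L F x))) \<and>
        sorted_wrt (pathlex L) (delivered tr) \<and>
        (\<forall>d \<in> set (butlast (delays is_delivered tr)). d \<le> 1300 * max 1 (?n * ?l)) \<and>
        last (delays is_delivered tr) \<le> 1300 * max 1 (?u * ?l) \<and>
        (\<forall>s'. Step s' \<in> set tr \<longrightarrow> space F s' \<le> 1300 * max 1 ?l) \<and>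
        set (printed tr) = {F'. F' \<subseteq> F \<and> min_unsat F' \<and> (\<exists>z. {z} \<in> F')} \<and>
        sorted_wrt (mu_less L F) (printed tr) \<and>
        (\<forall>m < length (delays is_printed tr). delays is_printed tr ! m \<le> 1300 * max 1 ((m + 1) * ?n * ?l))"
  \<comment> \<open>Without unit-clauses the bound for termination is constant, which excludes even
    reading the clauses; the program stops after two steps.\<close>
  proof (cases "us = []")
    case True
    then have none: "{a. {a} \<in> F} = {}" using us_bs(2) by simp
    have "bval (IsEmpty (Lst Units)) ?s" using lvars_s True by simp
    then have "exec enum_all ?s [Step ?s, Step ?s] ?s"
      unfolding enum_all_def using exec.IfTrue[OF _ exec.Skip] by blast
    moreover have "{F'. F' \<subseteq> F \<and> min_unsat F' \<and> (\<exists>z. {z} \<in> F')} = {}" using none by blast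
    ultimately show ?thesis using none space[OF inv_s]
      by (intro exI[of _ "[Step ?s, Step ?s]"] exI[of _ ?s]) auto
  next
    case False
    \<comment> \<open>The largest demand is the open stretch plus the reserve for a first path,
      estimated below by 416 + 71 + 134 = 621 times \<open>?n * ?l\<close>.\<close>
    define D where "D = 650 * (?n * ?l)"
    have u1: "1 \<le> ?u" using False u by (cases us) auto
    have l1: "1 \<le> ?l" using l u u1 by simp
    \<comment> \<open>Both literals of a variable may be unit-clauses. This inequality lets all
      fruitless searches together fit into one delay.\<close>
    have u_n: "?u \<le> 2 * ?n"
    proof -
      have "set us \<subseteq> lits F" unfolding us_bs(2) by (auto simp: lits_def vars_def intro: rev_image_eqI)
      then have "length us \<le> card (lits F)"
        using card_mono[OF finite_V] distinct_card[OF us_bs(1)] by metis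
      then show ?thesis using V u by simp
    qed
    have n1: "1 \<le> ?n" using u1 u_n by simp
    have l_nl: "?l \<le> ?n * ?l" "?l \<le> ?u * ?l" using n1 u1 by auto
    have ul_nl: "?u * ?l \<le> 2 * (?n * ?l)" using mult_le_mono1[OF u_n, of ?l] by simp
    have ec: "enter_cost \<le> 61 * ?l" using V n_l A l1 by (simp add: enter_cost_def)
    have oc: "output_cost \<le> 35 * ?l" using V n_l l1 by (simp add: output_cost_def)
    have Vec: "card (lits F) * (enter_cost + 6) \<le> 134 * (?n * ?l)"
    proof -
      have "card (lits F) * (enter_cost + 6) \<le> (2 * ?n) * (67 * ?l)" using V ec l1 by (intro mult_le_mono) auto
      then show ?thesis by simp
    qed
    have uc: "unit_cost \<le> 143 * ?l" using ec oc V n_l A l1 by (simp add: unit_cost_def)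
    have uuc: "?u * unit_cost \<le> 143 * (?u * ?l)" using mult_le_mono2[OF uc, of ?u] by simp
    have D1: "output_cost + 6 * card (lits F) + card (lits F) * (enter_cost + 6) + 20 \<le> D"
      using oc V n_l Vec l_nl l1 unfolding D_def by linarith
    have units: "x \<in> lits F" if "{x} \<in> F" for x using that by (force simp: lits_def vars_def)
    let ?b = "5 * length us + 7 * length bs + 9 * card (lits F) + 4 * card (parcs (idg F)) + 8"
    from build_idg_spec[OF inv_s lvars_s(4) lvars_s(1-3) us_bs(1-4) card refl, of 0] obtain tr1 s1 where
      b: "exec build_idg ?s tr1 s1" "\<forall>e\<in>set tr1. \<exists>s'. e = Step s' \<and> inv s'" "in_lists (parcs (idg F)) s1"
      "out_lists L (parcs (idg F)) s1" "\<forall>v. tables s1 IsUnit v \<noteq> [] \<longleftrightarrow> {v} \<in> F" "length tr1 \<le> ?b"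
      by (auto elim!: wpsE)
    have inv1: "inv s1" using exec_inv[OF b(1,2)] .
    have same1: "lvars s1 Path = []" "lvars s1 Ord = ls" "tables s1 OnPath = (\<lambda>_. [])" "tables s1 Rem = (\<lambda>_. [])"
      using exec_same[OF b(1)] by (auto simp: same_def build_idg_def input_def)
    define s2 where "s2 = s1\<lparr>lvars := (lvars s1)(Todo := ls)\<rparr>"
    have e2: "exec (Todo :=\<^sub>S Lst Ord) s1 [Step s2] s2" by (rule exec.SetS) (simp add: s2_def same1)
    have "length ls \<le> 2 * ?l" using length_ls V n_l by simp
    then have inv2: "inv s2" using inv1 by (simp add: s2_def bounded_def)
    have "dstate (parcs (idg (left F []))) (regs s2 rX) [] s2"
      using inv2 b(3,4) same1 unfolding dstate_def in_lists_def out_lists_def blocked_def by (simp add: s2_def left_def)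
    moreover have "lvars s2 Todo = ls" "tables s2 IsUnit = tables s1 IsUnit" by (simp_all add: s2_def)
    ultimately obtain tr2 t where e3: "exec (for_each rX Todo enum_step) s2 tr2 t" and safe2: "safe tr2"
      and lp: "lists_paths tr2 (\<Union>x \<in> {x \<in> set ls. {x} \<in> F}. NR x (idg (remaining L F x)))"
      and pre2: "\<And>tr0 b. pre D b tr0 \<Longrightarrow>
        b + (10 * length ls + 1 + length (filter (\<lambda>x. {x} \<in> F) ls) * unit_cost) + first_cost \<le> D \<Longrightarrow>
        pre D (b + (10 * length ls + 1 + length (filter (\<lambda>x. {x} \<in> F) ls) * unit_cost)) (tr0 @ tr2)"
      using enum_all_loop[OF refl D1 units, of "[]" ls s2] b(5) by auto
    let ?tr1 = "Step ?s # tr1 @ [Step s2]"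
    let ?tr = "?tr1 @ tr2"
    have "\<not> bval (IsEmpty (Lst Units)) ?s" using lvars_s False by simp
    from exec.IfFalse[OF this exec.Seq[OF b(1) exec.Seq[OF e2 e3]]]
    have e: "exec enum_all ?s ?tr t" unfolding enum_all_def enum_step_def by simp
    have safe: "safe ?tr" using inv_s b(2) inv2 safe2 by (auto simp: safe_def)
    have sil: "silent (44 * ?l) ?tr1"
      using b(2,6) u l V n_l A l1 by (auto simp: silent_def)
    have flen: "length (filter (\<lambda>x. {x} \<in> F) ls) = ?u"
    proof -
      have "set (filter (\<lambda>x. {x} \<in> F) ls) = set us" using us_bs(2) set_ls units by auto
      then show ?thesis
        using distinct_card[of "filter (\<lambda>x. {x} \<in> F) ls"] distinct_ls distinct_card[OF us_bs(1)] u by simp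
    qed
    \<comment> \<open>Together with the construction of the digraph the coefficients add up to 44 +
      20 + 1 + 143 = 208.\<close>
    let ?b2 = "10 * length ls + 1 + ?u * unit_cost"
    have b2: "44 * ?l + ?b2 \<le> 208 * (?u * ?l)"
      using uuc length_ls V n_l l_nl l1 by linarith
    have "first_cost \<le> 71 * ?l + 134 * (?n * ?l)" using ec Vec l1 by (simp add: first_cost_def)
    then have "44 * ?l + ?b2 + first_cost \<le> D" using b2 ul_nl l_nl unfolding D_def by linarith
    with pre2[OF pre_silent[OF pre_Nil sil, of D 0]] have "pre D (44 * ?l + ?b2) ?tr"
      unfolding flen by simp
    then obtain ds d where ds: "delays is_delivered ?tr = ds @ [d]" "d \<le> 44 * ?l + ?b2" "\<forall>d\<in>set ds. d \<le> D"
      unfolding pre_def by blast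
    have "{x \<in> set ls. {x} \<in> F} = {x. {x} \<in> F}" using set_ls units by auto
    with lists_paths_silent_append[OF sil lp] have "lists_paths ?tr (all_paths L F)" by (simp add: all_paths_def)
    then obtain Ps where Ps: "outputs ?tr = concat (map (path_events (good L)) Ps)" "set Ps = all_paths L F"
      "sorted_wrt (pathlex L) Ps" unfolding lists_paths_def by blast
    have del: "delivered ?tr = Ps"
      using delivered_outputs[of ?tr] delivered_path_events[of "good L" Ps] Ps(1) by simp
    have pri: "printed ?tr = map F_of (filter (good L) Ps)"
      using printed_outputs[of ?tr] printed_path_events[of "good L" Ps] Ps(1) by simp
    have set_pri: "set (printed ?tr) = {F'. F' \<subseteq> F \<and> min_unsat F' \<and> (\<exists>z. {z} \<in> F')}"
      unfolding min_unsat_subsets[OF F card lin] pri using Ps(2) by auto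
    have sorted_pri: "sorted_wrt (mu_less L F) (printed ?tr)"
      unfolding pri sorted_wrt_map
    proof (rule sorted_wrt_mono_rel[OF _ sorted_wrt_filter[OF Ps(3)]])
      fix P Q assume "P \<in> set (filter (good L) Ps)" "Q \<in> set (filter (good L) Ps)" "pathlex L P Q"
      then show "mu_less L F (F_of P) (F_of Q)"
        using path_of_good[OF F card lin] Ps(2) by (auto simp: mu_less_def)
    qed
    have "44 * ?l + ?b2 \<le> D" using b2 ul_nl unfolding D_def by linarith
    \<comment> \<open>The final stretch is included, since the last gap of the printed clause-sets
      extends to the end of the run.\<close>
    then have all_D: "\<forall>d\<in>set (delays is_delivered ?tr). d \<le> D" using ds by auto
    have gaps: "list_all2 (\<lambda>d c. d \<le> D * Suc c) (delays is_printed ?tr) (gap_counts (concat (map (path_events (good L)) Ps)))"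
      using printed_delays[OF all_D] gap_counts_outputs[of ?tr] Ps(1) by simp
    have printed_delay: "delays is_printed ?tr ! m \<le> 1300 * max 1 ((m + 1) * ?n * ?l)"
      if "m < length (delays is_printed ?tr)" for m
    proof -
      let ?g = "gap_counts (concat (map (path_events (good L)) Ps))"
      have "m < length ?g" using list_all2_lengthD[OF gaps] that by simp
      then have "?g ! m \<le> m + 0 + 1"
        using bad_le_good[OF F card lin Ps(3,2)] by (intro gap_counts_path_events) auto
      moreover have "delays is_printed ?tr ! m \<le> D * Suc (?g ! m)"
        using list_all2_nthD[OF gaps that] .
      \<comment> \<open>At most \<open>m + 1\<close> deliveries give \<open>m + 2\<close> stretches,
        and \<open>m + 2\<close> is at most \<open>2 * (m + 1)\<close>; this doubles 650 to
        1300.\<close>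
      moreover have "D * Suc (?g ! m) \<le> D * (2 * (m + 1))"
        using \<open>?g ! m \<le> m + 0 + 1\<close> by (intro mult_le_mono2) simp
      ultimately have "delays is_printed ?tr ! m \<le> D * (2 * (m + 1))" by linarith
      also have "\<dots> = 1300 * ((m + 1) * ?n * ?l)" by (simp add: D_def algebra_simps)
      also have "\<dots> \<le> 1300 * max 1 ((m + 1) * ?n * ?l)" by simp
      finally show ?thesis .
    qed
    show ?thesis
    proof (intro exI[of _ ?tr] exI[of _ t] conjI)
      show "exec enum_all ?s ?tr t" by (rule e)
      show "set (delivered ?tr) = (\<Union>x \<in> {x. {x} \<in> F}. NR x (idg (remaining L F x)))"
        unfolding del Ps(2) all_paths_def ..
      show "sorted_wrt (pathlex L) (delivered ?tr)" unfolding del by (rule Ps(3))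
      show "\<forall>d \<in> set (butlast (delays is_delivered ?tr)). d \<le> 1300 * max 1 (?n * ?l)"
        unfolding ds(1) using ds(3) by (force simp: D_def)
      show "last (delays is_delivered ?tr) \<le> 1300 * max 1 (?u * ?l)"
        unfolding ds(1) using ds(2) b2 by simp
      show "\<forall>s'. Step s' \<in> set ?tr \<longrightarrow> space F s' \<le> 1300 * max 1 ?l"
        using safe space unfolding safe_def by blast
      show "set (printed ?tr) = {F'. F' \<subseteq> F \<and> min_unsat F' \<and> (\<exists>z. {z} \<in> F')}" by (rule set_pri)
      show "sorted_wrt (mu_less L F) (printed ?tr)" by (rule sorted_pri)
      show "\<forall>m < length (delays is_printed ?tr). delays is_printed ?tr ! m \<le> 1300 * max 1 ((m + 1) * ?n * ?l)"
        using printed_delay by blast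
    qed
  qed
qed

end
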